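(* Let $M$ be a connected three-dimensional non-Riemannian Finsler manifold, with averaged Riemannian metric $\gamma$, admitting a linear connection $\nabla$ that is compatible to the Finsler metric, is non-flat (its curvature tensor is not identically zero) and has totally anti-symmetric torsion tensor. Then there exists a one-dimensional distribution $\mathcal{D}$ on $M$ such that (i) any local section of $\mathcal{D}$ of constant length is a covariant constant vector field with respect to $\nabla$; and (ii) any local section of $\mathcal{D}$ of constant length is a Killing vector field of constant length with respect to $\gamma$.
   Context: Finsler metric: a continuous function $F\colon TM\to[0,\infty)$, smooth off the zero section, with $F(tv)=tF(v)$ for $t>0$, such that with $E=\frac12F^2$ the Hessian $g_{ij}=\frac{\partial^2E}{\partial y^i\partial y^j}$ is positive definite at every nonzero tangent vector; $y^i(v)=v(u^i)$ are the induced fibre coordinates on $TM$ for local coordinates $u^i$ on $M$. The Finsler manifold is Riemannian if $F^2$ is quadratic on every tangent space; otherwise it is non-Riemannian. The indicatrix at $p$ is $\partial K_p=F^{-1}(1)\cap T_pM$, with induced volume form $\mu=\sqrt{\det g_{ij}}\,\sum_{i=1}^3(-1)^{i-1}\frac{y^i}{F}\,dy^1\wedge\ldots\wedge\widehat{dy^i}\wedge\ldots\wedge dy^3$ (hat means omission; $\partial K_p$ is oriented so that $\mu$ is positive). The averaged Riemannian metric is $\gamma_p(v,w)=v^iw^j\int_{\partial K_p}g_{ij}\,\mu$ for $v,w\in T_pM$. Length of sections is meant with respect to $\gamma$. A linear connection $\nabla$ on $M$ is compatible to $F$ if its parallel transports preserve the Finslerian length $F$ of tangent vectors. Its torsion $T$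 is totally anti-symmetric if $T_\flat(X,Y,Z)=\gamma(T(X,Y),Z)$ is a 3-form. A vector field $\beta$ is covariant constant with respect to $\nabla$ if $\nabla_X\beta=0$ for every vector field $X$. *)

theory Defs
  imports "HOL-Analysis.Analysis"
begin

section \<open>Smooth functions between Euclidean spaces\<close>

text \<open>Only used on open sets. Continuity of all iterated directional derivatives is the usual
  \<open>C\<^sup>k\<close> condition because the domain is finite-dimensional.\<close>

primrec Ck_on :: "nat \<Rightarrow> 'a::euclidean_space set \<Rightarrow> ('a \<Rightarrow> 'b::real_normed_vector) \<Rightarrow> bool" where
  "Ck_on 0 S f \<longleftrightarrow> continuous_on S f"
| "Ck_on (Suc k) S f \<longleftrightarrow> (\<forall>x\<in>S. f differentiable (at x)) \<and>
     (\<forall>v. Ck_on k S (\<lambda>x. frechet_derivative f (at x) v))"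

definition smooth_on :: "'a::euclidean_space set \<Rightarrow> ('a \<Rightarrow> 'b::real_normed_vector) \<Rightarrow> bool" where
  "smooth_on S f \<longleftrightarrow> (\<forall>k. Ck_on k S f)"


section \<open>Three-dimensional smooth manifolds\<close>

text \<open>A manifold is a whole type \<open>'m\<close> (Hausdorff and second countable by its sorts) with a smooth
  atlas \<open>A\<close>. The atlas need not be maximal: smoothness tested on the charts of \<open>A\<close> agrees with
  smoothness tested on the maximal atlas containing it.\<close>

type_synonym 'm chart = "'m set \<times> ('m \<Rightarrow> real^3)"

abbreviation cdom :: "'m chart \<Rightarrow> 'm set" where "cdom \<equiv> fst"
abbreviation cmap :: "'m chart \<Rightarrow> 'm \<Rightarrow> real^3" where "cmap \<equiv> snd"

definition cinv :: "'m chart \<Rightarrow> real^3 \<Rightarrow> 'm" where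
  "cinv c = inv_into (cdom c) (cmap c)"

definition is_chart :: "'m::topological_space chart \<Rightarrow> bool" where
  "is_chart c \<longleftrightarrow> open (cdom c) \<and> open (cmap c ` cdom c) \<and>
     homeomorphism (cdom c) (cmap c ` cdom c) (cmap c) (cinv c)"

definition smooth_atlas :: "'m::{t2_space, second_countable_topology} chart set \<Rightarrow> bool" where
  "smooth_atlas A \<longleftrightarrow> (\<forall>c\<in>A. is_chart c) \<and> (\<Union>c\<in>A. cdom c) = UNIV \<and>
     (\<forall>c\<in>A. \<forall>d\<in>A. smooth_on (cmap c ` (cdom c \<inter> cdom d)) (cmap d \<circ> cinv c))"

text \<open>Tangent vectors at \<open>p\<close> are represented by their components with respect to one chart
  \<open>chart_at A p\<close> around \<open>p\<close>, chosen once and for all; so every tangent space is a copy of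
  \<open>real^3\<close>, and vector fields are functions \<open>'m \<Rightarrow> real^3\<close>. The choice depends on \<open>p\<close> in an
  arbitrary way, so anything that compares different points has to be read in a single chart:
  \<open>tcoord A c p v\<close> are the components of \<open>v\<close> with respect to the chart \<open>c\<close>, and \<open>tvec A c p y\<close>
  is the tangent vector at \<open>p\<close> with components \<open>y\<close> with respect to \<open>c\<close>.\<close>

definition chart_at :: "'m chart set \<Rightarrow> 'm \<Rightarrow> 'm chart" where
  "chart_at A p = (SOME c. c \<in> A \<and> p \<in> cdom c)"

definition tcoord :: "'m chart set \<Rightarrow> 'm chart \<Rightarrow> 'm \<Rightarrow> real^3 \<Rightarrow> real^3" where
  "tcoord A c p v =
     frechet_derivative (cmap c \<circ> cinv (chart_at A p)) (at (cmap (chart_at A p) p)) v"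

definition tvec :: "'m chart set \<Rightarrow> 'm chart \<Rightarrow> 'm \<Rightarrow> real^3 \<Rightarrow> real^3" where
  "tvec A c p y = frechet_derivative (cmap (chart_at A p) \<circ> cinv c) (at (cmap c p)) y"

definition smooth_fun_on :: "'m chart set \<Rightarrow> 'm set \<Rightarrow> ('m \<Rightarrow> real) \<Rightarrow> bool" where
  "smooth_fun_on A U f \<longleftrightarrow> (\<forall>c\<in>A. smooth_on (cmap c ` (U \<inter> cdom c)) (f \<circ> cinv c))"

definition vf_coord :: "'m chart set \<Rightarrow> 'm chart \<Rightarrow> ('m \<Rightarrow> real^3) \<Rightarrow> real^3 \<Rightarrow> real^3" where
  "vf_coord A c X x = tcoord A c (cinv c x) (X (cinv c x))"

definition smooth_vf_on :: "'m chart set \<Rightarrow> 'm set \<Rightarrow> ('m \<Rightarrow> real^3) \<Rightarrow> bool" where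
  "smooth_vf_on A U X \<longleftrightarrow> (\<forall>c\<in>A. smooth_on (cmap c ` (U \<inter> cdom c)) (vf_coord A c X))"

definition coord_field :: "'m chart set \<Rightarrow> 'm chart \<Rightarrow> 3 \<Rightarrow> 'm \<Rightarrow> real^3" where
  "coord_field A c i p = tvec A c p (axis i 1)"

text \<open>The derivative \<open>v(f)\<close> of a function and the bracket \<open>[X, Y]\<close>, both computed in the
  chart that also represents the tangent vectors at \<open>p\<close>.\<close>

definition dir_deriv :: "'m chart set \<Rightarrow> ('m \<Rightarrow> real) \<Rightarrow> 'm \<Rightarrow> real^3 \<Rightarrow> real" where
  "dir_deriv A f p v =
     frechet_derivative (f \<circ> cinv (chart_at A p)) (at (cmap (chart_at A p) p)) v"

definition lie_bracket :: "'m chart set \<Rightarrow> ('m \<Rightarrow> real^3) \<Rightarrow> ('m \<Rightarrow> real^3) \<Rightarrow> 'm \<Rightarrow> real^3" where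
  "lie_bracket A X Y p = (let c = chart_at A p in
     frechet_derivative (vf_coord A c Y) (at (cmap c p)) (X p)
     - frechet_derivative (vf_coord A c X) (at (cmap c p)) (Y p))"


section \<open>The fundamental tensor and the indicatrix on a single tangent space\<close>

definition partial :: "3 \<Rightarrow> (real^3 \<Rightarrow> real) \<Rightarrow> real^3 \<Rightarrow> real" where
  "partial i f y = frechet_derivative f (at y) (axis i 1)"

definition energy :: "(real^3 \<Rightarrow> real) \<Rightarrow> real^3 \<Rightarrow> real" where
  "energy N y = (N y)\<^sup>2 / 2"

definition fund_tensor :: "(real^3 \<Rightarrow> real) \<Rightarrow> real^3 \<Rightarrow> real^3^3" where
  "fund_tensor N y = (\<chi> i j. partial i (partial j (energy N)) y)"

definition indicatrix :: "(real^3 \<Rightarrow> real) \<Rightarrow> (real^3) set" where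
  "indicatrix N = {y. N y = 1}"

text \<open>The 2-form
  \<open>\<mu> = sqrt (det g) (y\<^sub>1/N dy\<^sub>2 \<and> dy\<^sub>3 - y\<^sub>2/N dy\<^sub>1 \<and> dy\<^sub>3 + y\<^sub>3/N dy\<^sub>1 \<and> dy\<^sub>2)\<close>
  at the point \<open>y\<close>, evaluated on the vectors \<open>a\<close>, \<open>b\<close>.\<close>

definition ind_vol :: "(real^3 \<Rightarrow> real) \<Rightarrow> real^3 \<Rightarrow> real^3 \<Rightarrow> real^3 \<Rightarrow> real" where
  "ind_vol N y a b = sqrt (det (fund_tensor N y)) *
     (y$1 / N y * (a$2 * b$3 - a$3 * b$2)
      - y$2 / N y * (a$1 * b$3 - a$3 * b$1)
      + y$3 / N y * (a$1 * b$2 - a$2 * b$1))"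

text \<open>The indicatrix is parametrised by spherical angles, projecting the unit sphere radially.\<close>

definition sph :: "real \<times> real \<Rightarrow> real^3" where
  "sph = (\<lambda>(\<theta>, \<phi>). vector [sin \<theta> * cos \<phi>, sin \<theta> * sin \<phi>, cos \<theta>])"

definition ind_param :: "(real^3 \<Rightarrow> real) \<Rightarrow> real \<times> real \<Rightarrow> real^3" where
  "ind_param N z = (1 / N (sph z)) *\<^sub>R sph z"

text \<open>\<open>\<integral> f \<mu>\<close> over the indicatrix, as the integral of the pulled back 2-form. The
  parametrisation is injective off a null set, onto (\<open>ind_param_image\<close>) and positively
  oriented (\<open>ind_vol_pullback\<close>).\<close>

definition indicatrix_integral :: "(real^3 \<Rightarrow> real) \<Rightarrow> (real^3 \<Rightarrow> real) \<Rightarrow> real" where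
  "indicatrix_integral N f = integral (cbox (0, 0) (pi, 2 * pi))
     (\<lambda>z. f (ind_param N z) *
        ind_vol N (ind_param N z)
          (frechet_derivative (ind_param N) (at z) (1, 0))
          (frechet_derivative (ind_param N) (at z) (0, 1)))"


section \<open>Finsler metrics and the averaged metric\<close>

text \<open>\<open>F p\<close> is the Finsler metric on the tangent space at \<open>p\<close>; \<open>finsler_coord A F c\<close> is \<open>F\<close>
  in the bundle chart of the tangent bundle induced by \<open>c\<close>.\<close>

definition finsler_coord ::
  "'m chart set \<Rightarrow> ('m \<Rightarrow> real^3 \<Rightarrow> real) \<Rightarrow> 'm chart \<Rightarrow> (real^3) \<times> (real^3) \<Rightarrow> real" where
  "finsler_coord A F c = (\<lambda>(x, y). F (cinv c x) (tvec A c (cinv c x) y))"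

definition finsler_metric :: "'m chart set \<Rightarrow> ('m \<Rightarrow> real^3 \<Rightarrow> real) \<Rightarrow> bool" where
  "finsler_metric A F \<longleftrightarrow>
     (\<forall>p v. 0 \<le> F p v) \<and>
     (\<forall>c\<in>A. continuous_on ((cmap c ` cdom c) \<times> UNIV) (finsler_coord A F c)) \<and>
     (\<forall>c\<in>A. smooth_on ((cmap c ` cdom c) \<times> (- {0})) (finsler_coord A F c)) \<and>
     (\<forall>p v t. t > 0 \<longrightarrow> F p (t *\<^sub>R v) = t * F p v) \<and>
     (\<forall>c\<in>A. \<forall>x\<in>cmap c ` cdom c. \<forall>y v. y \<noteq> 0 \<longrightarrow> v \<noteq> 0 \<longrightarrow>
        v \<bullet> (fund_tensor (\<lambda>u. finsler_coord A F c (x, u)) y *v v) > 0)"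

definition riemannian :: "('m \<Rightarrow> real^3 \<Rightarrow> real) \<Rightarrow> bool" where
  "riemannian F \<longleftrightarrow> (\<forall>p. \<exists>B. bilinear B \<and> (\<forall>v. (F p v)\<^sup>2 = B v v))"

text \<open>Computed in the fibre coordinates induced by \<open>chart_at A p\<close>; the value does not depend on
  the choice of linear coordinates on the tangent space.\<close>

definition avg_metric :: "('m \<Rightarrow> real^3 \<Rightarrow> real) \<Rightarrow> 'm \<Rightarrow> real^3 \<Rightarrow> real^3 \<Rightarrow> real" where
  "avg_metric F p v w = (\<Sum>i\<in>UNIV. \<Sum>j\<in>UNIV.
     v$i * w$j * indicatrix_integral (F p) (\<lambda>y. fund_tensor (F p) y $ i $ j))"


section \<open>Linear connections\<close>

text \<open>\<open>nabla p v Y\<close> is the covariant derivative at \<open>p\<close> in the direction \<open>v\<close> of a vector field \<open>Y\<close>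
  that is smooth on a neighbourhood of \<open>p\<close>, with \<open>Y\<close> arbitrary elsewhere.\<close>

type_synonym 'm connection = "'m \<Rightarrow> real^3 \<Rightarrow> ('m \<Rightarrow> real^3) \<Rightarrow> real^3"

definition linear_connection :: "'m::topological_space chart set \<Rightarrow> 'm connection \<Rightarrow> bool" where
  "linear_connection A nabla \<longleftrightarrow> (\<forall>U. open U \<longrightarrow>
     (\<forall>Y p. smooth_vf_on A U Y \<longrightarrow> p \<in> U \<longrightarrow> linear (\<lambda>v. nabla p v Y)) \<and>
     (\<forall>Y Z p v. smooth_vf_on A U Y \<longrightarrow> smooth_vf_on A U Z \<longrightarrow> p \<in> U \<longrightarrow>
        nabla p v (\<lambda>q. Y q + Z q) = nabla p v Y + nabla p v Z) \<and>
     (\<forall>f Y p v. smooth_fun_on A U f \<longrightarrow> smooth_vf_on A U Y \<longrightarrow> p \<in> U \<longrightarrow>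
        nabla p v (\<lambda>q. f q *\<^sub>R Y q) = dir_deriv A f p v *\<^sub>R Y p + f p *\<^sub>R nabla p v Y) \<and>
     (\<forall>Y Z p v. smooth_vf_on A U Y \<longrightarrow> (\<forall>q\<in>U. Y q = Z q) \<longrightarrow> p \<in> U \<longrightarrow>
        nabla p v Y = nabla p v Z) \<and>
     (\<forall>X Y. smooth_vf_on A U X \<longrightarrow> smooth_vf_on A U Y \<longrightarrow>
        smooth_vf_on A U (\<lambda>p. nabla p (X p) Y)))"

definition torsion ::
  "'m chart set \<Rightarrow> 'm connection \<Rightarrow> ('m \<Rightarrow> real^3) \<Rightarrow> ('m \<Rightarrow> real^3) \<Rightarrow> 'm \<Rightarrow> real^3" where
  "torsion A nabla X Y p = nabla p (X p) Y - nabla p (Y p) X - lie_bracket A X Y p"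

definition curvature ::
  "'m chart set \<Rightarrow> 'm connection \<Rightarrow> ('m \<Rightarrow> real^3) \<Rightarrow> ('m \<Rightarrow> real^3) \<Rightarrow> ('m \<Rightarrow> real^3) \<Rightarrow> 'm \<Rightarrow> real^3"
  where
  "curvature A nabla X Y Z p =
     nabla p (X p) (\<lambda>q. nabla q (Y q) Z) - nabla p (Y p) (\<lambda>q. nabla q (X q) Z)
     - nabla p (lie_bracket A X Y p) Z"

definition flat :: "'m::topological_space chart set \<Rightarrow> 'm connection \<Rightarrow> bool" where
  "flat A nabla \<longleftrightarrow> (\<forall>U X Y Z. open U \<longrightarrow>
     smooth_vf_on A U X \<longrightarrow> smooth_vf_on A U Y \<longrightarrow> smooth_vf_on A U Z \<longrightarrow>
     (\<forall>p\<in>U. curvature A nabla X Y Z p = 0))"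

text \<open>Antisymmetry under the two adjacent transpositions, hence under all permutations.
  The expression is automatically tensorial in \<open>X\<close>, \<open>Y\<close>, \<open>Z\<close>.\<close>

definition antisymmetric_torsion :: "'m::topological_space chart set \<Rightarrow>
    ('m \<Rightarrow> real^3 \<Rightarrow> real^3 \<Rightarrow> real) \<Rightarrow> 'm connection \<Rightarrow> bool" where
  "antisymmetric_torsion A \<gamma> nabla \<longleftrightarrow> (\<forall>U X Y Z. open U \<longrightarrow>
     smooth_vf_on A U X \<longrightarrow> smooth_vf_on A U Y \<longrightarrow> smooth_vf_on A U Z \<longrightarrow>
     (\<forall>p\<in>U. \<gamma> p (torsion A nabla Y X p) (Z p) = - \<gamma> p (torsion A nabla X Y p) (Z p) \<and>
            \<gamma> p (torsion A nabla X Z p) (Y p) = - \<gamma> p (torsion A nabla X Y p) (Z p)))"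

text \<open>Column \<open>(\<Gamma>\<^sup>k\<^sub>i\<^sub>j)\<^sub>k\<close> of the Christoffel symbols of \<open>nabla\<close> in the chart \<open>c\<close>.\<close>

definition christoffel ::
  "'m chart set \<Rightarrow> 'm connection \<Rightarrow> 'm chart \<Rightarrow> 'm \<Rightarrow> 3 \<Rightarrow> 3 \<Rightarrow> real^3" where
  "christoffel A nabla c p i j =
     tcoord A c p (nabla p (coord_field A c i p) (coord_field A c j))"

definition smooth_curve_on ::
    "'m::topological_space chart set \<Rightarrow> real set \<Rightarrow> (real \<Rightarrow> 'm) \<Rightarrow> bool" where
  "smooth_curve_on A S \<sigma> \<longleftrightarrow> continuous_on S \<sigma> \<and>
     (\<forall>c\<in>A. smooth_on (S \<inter> \<sigma> -` cdom c) (cmap c \<circ> \<sigma>))"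

text \<open>\<open>V\<close> is a parallel vector field along \<open>\<sigma>\<close>: in every chart,
  \<open>dV\<^sup>k/dt + (\<Sum>i j. \<Gamma>\<^sup>k\<^sub>i\<^sub>j d\<sigma>\<^sup>i/dt V\<^sup>j) = 0\<close>. Parallel transport sends \<open>V a\<close> to \<open>V b\<close>.\<close>

definition parallel_along :: "'m chart set \<Rightarrow> 'm connection \<Rightarrow> real \<Rightarrow> real \<Rightarrow>
    (real \<Rightarrow> 'm) \<Rightarrow> (real \<Rightarrow> real^3) \<Rightarrow> bool" where
  "parallel_along A nabla a b \<sigma> V \<longleftrightarrow> (\<forall>t\<in>{a..b}. \<forall>c\<in>A. \<sigma> t \<in> cdom c \<longrightarrow>
     ((\<lambda>s. tcoord A c (\<sigma> s) (V s)) has_vector_derivative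
        - (\<Sum>i\<in>UNIV. \<Sum>j\<in>UNIV.
             (vector_derivative (cmap c \<circ> \<sigma>) (at t) $ i * tcoord A c (\<sigma> t) (V t) $ j)
               *\<^sub>R christoffel A nabla c (\<sigma> t) i j))
       (at t within {a..b}))"

definition compatible :: "'m::topological_space chart set \<Rightarrow>
    ('m \<Rightarrow> real^3 \<Rightarrow> real) \<Rightarrow> 'm connection \<Rightarrow> bool" where
  "compatible A F nabla \<longleftrightarrow> (\<forall>S a b \<sigma> V. open S \<longrightarrow> a \<le> b \<longrightarrow> {a..b} \<subseteq> S \<longrightarrow>
     smooth_curve_on A S \<sigma> \<longrightarrow> parallel_along A nabla a b \<sigma> V \<longrightarrow>
     F (\<sigma> b) (V b) = F (\<sigma> a) (V a))"


section \<open>Distributions, covariant constant fields and Killing fields\<close>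

definition line_distribution ::
    "'m::topological_space chart set \<Rightarrow> ('m \<Rightarrow> (real^3) set) \<Rightarrow> bool" where
  "line_distribution A D \<longleftrightarrow> (\<forall>p. subspace (D p) \<and> dim (D p) = 1) \<and>
     (\<forall>p. \<exists>U X. open U \<and> p \<in> U \<and> smooth_vf_on A U X \<and> (\<forall>q\<in>U. D q = span {X q}))"

definition local_section :: "'m::topological_space chart set \<Rightarrow> ('m \<Rightarrow> (real^3) set) \<Rightarrow>
    'm set \<Rightarrow> ('m \<Rightarrow> real^3) \<Rightarrow> bool" where
  "local_section A D U \<beta> \<longleftrightarrow> open U \<and> smooth_vf_on A U \<beta> \<and> (\<forall>p\<in>U. \<beta> p \<in> D p)"

definition constant_length :: "('m \<Rightarrow> real^3 \<Rightarrow> real^3 \<Rightarrow> real) \<Rightarrow>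
    'm set \<Rightarrow> ('m \<Rightarrow> real^3) \<Rightarrow> bool" where
  "constant_length \<gamma> U \<beta> \<longleftrightarrow> (\<exists>l. \<forall>p\<in>U. sqrt (\<gamma> p (\<beta> p) (\<beta> p)) = l)"

definition covariant_constant_on :: "'m connection \<Rightarrow> 'm set \<Rightarrow> ('m \<Rightarrow> real^3) \<Rightarrow> bool" where
  "covariant_constant_on nabla U \<beta> \<longleftrightarrow> (\<forall>p\<in>U. \<forall>v. nabla p v \<beta> = 0)"

text \<open>The Lie derivative of \<open>\<gamma>\<close> along \<open>\<beta>\<close> vanishes.\<close>

definition killing_on :: "'m::topological_space chart set \<Rightarrow>
    ('m \<Rightarrow> real^3 \<Rightarrow> real^3 \<Rightarrow> real) \<Rightarrow> 'm set \<Rightarrow> ('m \<Rightarrow> real^3) \<Rightarrow> bool" where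
  "killing_on A \<gamma> U \<beta> \<longleftrightarrow> (\<forall>W Y Z. open W \<longrightarrow> W \<subseteq> U \<longrightarrow>
     smooth_vf_on A W Y \<longrightarrow> smooth_vf_on A W Z \<longrightarrow>
     (\<forall>p\<in>W. dir_deriv A (\<lambda>q. \<gamma> q (Y q) (Z q)) p (\<beta> p)
            - \<gamma> p (lie_bracket A \<beta> Y p) (Z p) - \<gamma> p (Y p) (lie_bracket A \<beta> Z p) = 0))"


section \<open>Consistency of the encodings\<close>

lemma chart_at_props:
  assumes "smooth_atlas A"
  shows "chart_at A p \<in> A" "p \<in> cdom (chart_at A p)"
proof -
  have "\<exists>c. c \<in> A \<and> p \<in> cdom c"
    using assms unfolding smooth_atlas_def by blast
  then have "chart_at A p \<in> A \<and> p \<in> cdom (chart_at A p)"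
    unfolding chart_at_def by (rule someI_ex)
  then show "chart_at A p \<in> A" "p \<in> cdom (chart_at A p)" by auto
qed

lemma tcoord_chart_at:
  assumes "smooth_atlas A"
  shows "tcoord A (chart_at A p) p v = v" "tvec A (chart_at A p) p v = v"
proof -
  let ?c = "chart_at A p"
  have c: "is_chart ?c" and p: "p \<in> cdom ?c"
    using chart_at_props[OF assms] assms by (auto simp: smooth_atlas_def)
  have o: "open (cmap ?c ` cdom ?c)" using c by (simp add: is_chart_def)
  have "((cmap ?c \<circ> cinv ?c) has_derivative (\<lambda>v. v)) (at (cmap ?c p))"
    by (rule has_derivative_transform_within_open[OF has_derivative_ident o])
       (use p in \<open>auto simp: cinv_def f_inv_into_f\<close>)
  then have "frechet_derivative (cmap ?c \<circ> cinv ?c) (at (cmap ?c p)) = (\<lambda>v. v)"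
    by (rule frechet_derivative_at[symmetric])
  then show "tcoord A ?c p v = v" "tvec A ?c p v = v"
    by (simp_all add: tcoord_def tvec_def)
qed

lemma norm_sph: "norm (sph z) = 1"
proof -
  obtain a b where z: "z = (a, b)" by fastforce
  have "(sin a * cos b)\<^sup>2 + (sin a * sin b)\<^sup>2 + (cos a)\<^sup>2
      = (sin a)\<^sup>2 * ((sin b)\<^sup>2 + (cos b)\<^sup>2) + (cos a)\<^sup>2"
    by (simp only: power_mult_distrib) algebra
  then have "(sin a * cos b)\<^sup>2 + (sin a * sin b)\<^sup>2 + (cos a)\<^sup>2 = 1" by simp
  then show ?thesis
    by (simp add: z sph_def norm_vec_def L2_set_def sum_3)
qed

lemma sph_image: "sph ` cbox (0, 0) (pi, 2 * pi) = {y. norm y = 1}"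
proof (intro equalityI subsetI)
  fix y :: "real^3" assume "y \<in> {y. norm y = 1}"
  then have s: "(y$1)\<^sup>2 + (y$2)\<^sup>2 + (y$3)\<^sup>2 = 1"
    by (simp add: norm_vec_def L2_set_def sum_3)
  define a where "a = arccos (y$3)"
  have y3: "\<bar>y$3\<bar> \<le> 1"
    using s by (metis abs_square_le_1 le_add_same_cancel2 sum_power2_ge_zero)
  have a: "0 \<le> a" "a \<le> pi" "cos a = y$3"
    using y3 by (auto simp: a_def arccos_lbound arccos_ubound cos_arccos_abs)
  have sa: "sin a \<ge> 0" using a sin_ge_zero by blast
  have r: "(y$1)\<^sup>2 + (y$2)\<^sup>2 = (sin a)\<^sup>2"
    using s sin_cos_squared_add[of a] a(3) by simp
  obtain b where b: "0 \<le> b" "b \<le> 2 * pi" "y$1 = sin a * cos b" "y$2 = sin a * sin b"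
  proof (cases "sin a = 0")
    case True
    with r have "y$1 = 0" "y$2 = 0" by (auto simp: sum_power2_eq_zero_iff)
    with True show thesis by (intro that[of 0]) auto
  next
    case False
    have "(y$1 / sin a)\<^sup>2 + (y$2 / sin a)\<^sup>2 = 1"
      using r False by (simp add: power_divide flip: add_divide_distrib)
    then obtain t where "0 \<le> t" "t < 2 * pi" "y$1 / sin a = cos t" "y$2 / sin a = sin t"
      using sincos_total_2pi by metis
    with False show thesis by (intro that[of t]) (auto simp: field_simps)
  qed
  have "y = sph (a, b)"
    by (simp add: sph_def vec_eq_iff forall_3 a b)
  moreover have "(a, b) \<in> cbox (0, 0) (pi, 2 * pi)"
    using a b by (simp add: cbox_Pair_eq)
  ultimately show "y \<in> sph ` cbox (0, 0) (pi, 2 * pi)" by blast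
qed (auto simp: norm_sph)

lemma ind_param_image:
  assumes hom: "\<And>t y. t > 0 \<Longrightarrow> N (t *\<^sub>R y) = t * N y"
    and pos: "\<And>y. y \<noteq> 0 \<Longrightarrow> N y > 0"
  shows "ind_param N ` cbox (0, 0) (pi, 2 * pi) = indicatrix N"
proof (intro equalityI subsetI)
  fix y assume "y \<in> ind_param N ` cbox (0, 0) (pi, 2 * pi)"
  then obtain z where z: "y = ind_param N z" by blast
  have "N (sph z) > 0" using norm_sph[of z] by (intro pos) auto
  then show "y \<in> indicatrix N" by (simp add: z ind_param_def indicatrix_def hom)
next
  fix y assume "y \<in> indicatrix N"
  then have y: "N y = 1" by (simp add: indicatrix_def)
  have "N 0 = 0" using hom[of 2 0] by simp
  with y have ne: "norm y > 0" by auto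
  have "norm ((1 / norm y) *\<^sub>R y) = 1" using ne by simp
  then obtain z where z: "z \<in> cbox (0, 0) (pi, 2 * pi)" "sph z = (1 / norm y) *\<^sub>R y"
    using sph_image by (metis (mono_tags, lifting) imageE mem_Collect_eq)
  have "N (sph z) = 1 / norm y" using hom[of "1 / norm y" y] ne y z by simp
  then have "ind_param N z = y" using ne z by (simp add: ind_param_def)
  with z show "y \<in> ind_param N ` cbox (0, 0) (pi, 2 * pi)" by blast
qed

lemma sph_has_derivative:
  "(sph has_derivative (\<lambda>z. vector [cos \<theta> * cos \<phi> * fst z - sin \<theta> * sin \<phi> * snd z,
      cos \<theta> * sin \<phi> * fst z + sin \<theta> * cos \<phi> * snd z, - sin \<theta> * fst z])) (at (\<theta>, \<phi>))"
proof -
  have vec: "(vector [a, b, c] :: real^3) = a *\<^sub>R axis 1 1 + b *\<^sub>R axis 2 1 + c *\<^sub>R axis 3 1"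
    for a b c :: real
    by (simp add: vec_eq_iff forall_3 axis_def)
  have sph: "sph = (\<lambda>z. (sin (fst z) * cos (snd z)) *\<^sub>R axis 1 1
      + (sin (fst z) * sin (snd z)) *\<^sub>R axis 2 1 + cos (fst z) *\<^sub>R axis 3 1)"
    by (rule ext) (simp add: sph_def vec split_beta)
  show ?thesis
    unfolding sph vec
    by (auto intro!: derivative_eq_intros ext simp: algebra_simps)
qed

lemma ind_vol_pullback:
  assumes hom: "\<And>t y. t > 0 \<Longrightarrow> N (t *\<^sub>R y) = t * N y"
    and pos: "\<And>y. y \<noteq> 0 \<Longrightarrow> N y > 0"
    and diff: "\<And>y. y \<noteq> 0 \<Longrightarrow> N differentiable (at y)"
  shows "ind_vol N (ind_param N (\<theta>, \<phi>))
      (frechet_derivative (ind_param N) (at (\<theta>, \<phi>)) (1, 0))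
      (frechet_derivative (ind_param N) (at (\<theta>, \<phi>)) (0, 1))
    = sqrt (det (fund_tensor N (ind_param N (\<theta>, \<phi>)))) * (sin \<theta> / N (sph (\<theta>, \<phi>)) ^ 3)"
proof -
  let ?u = "sph (\<theta>, \<phi>)"
  define h where "h = (\<lambda>z. 1 / N (sph z))"
  have u0: "sph z \<noteq> 0" for z using norm_sph[of z] by auto
  have Nu: "N ?u > 0" by (rule pos[OF u0])
  obtain d where d: "(sph has_derivative d) (at (\<theta>, \<phi>))"
    "d (1, 0) = vector [cos \<theta> * cos \<phi>, cos \<theta> * sin \<phi>, - sin \<theta>]"
    "d (0, 1) = vector [- sin \<theta> * sin \<phi>, sin \<theta> * cos \<phi>, 0]"
    using sph_has_derivative[of \<theta> \<phi>] by fastforce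
  have "sph differentiable (at (\<theta>, \<phi>))" using d(1) by (auto simp: differentiable_def)
  then have "(\<lambda>z. N (sph z)) differentiable (at (\<theta>, \<phi>))"
    using differentiable_chain_at[of sph "(\<theta>, \<phi>)" N] diff[OF u0] by (simp add: o_def)
  then have "h differentiable (at (\<theta>, \<phi>))"
    unfolding h_def using Nu by (intro differentiable_divide) auto
  then obtain h' where h': "(h has_derivative h') (at (\<theta>, \<phi>))" by (auto simp: differentiable_def)
  have hN: "ind_param N = (\<lambda>z. h z *\<^sub>R sph z)"
    by (rule ext) (simp add: ind_param_def h_def)
  have "(ind_param N has_derivative (\<lambda>e. h (\<theta>, \<phi>) *\<^sub>R d e + h' e *\<^sub>R ?u)) (at (\<theta>, \<phi>))"
    using has_derivative_scaleR[OF h' d(1)] by (simp add: hN)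
  then have D: "frechet_derivative (ind_param N) (at (\<theta>, \<phi>))
      = (\<lambda>e. h (\<theta>, \<phi>) *\<^sub>R d e + h' e *\<^sub>R ?u)"
    by (rule frechet_derivative_at[symmetric])
  define r where "r = h (\<theta>, \<phi>)"
  have y: "ind_param N (\<theta>, \<phi>) = r *\<^sub>R ?u" by (simp add: ind_param_def r_def h_def)
  have Ny: "N (r *\<^sub>R ?u) = 1" using hom[of r ?u] Nu by (simp add: r_def h_def)
  define a where "a = h' (1, 0)"
  define b where "b = h' (0, 1)"
  define st where "st = sin \<theta>"
  define ct where "ct = cos \<theta>"
  define sp where "sp = sin \<phi>"
  define cp where "cp = cos \<phi>"
  have pt: "st\<^sup>2 + ct\<^sup>2 = 1" and pp: "sp\<^sup>2 + cp\<^sup>2 = 1"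
    by (simp_all add: st_def ct_def sp_def cp_def)
  have key: "r * (st * cp) * ((r * (ct * sp) + a * (st * sp)) * (r * 0 + b * ct)
        - (r * (- st) + a * ct) * (r * (st * cp) + b * (st * sp)))
      - r * (st * sp) * ((r * (ct * cp) + a * (st * cp)) * (r * 0 + b * ct)
        - (r * (- st) + a * ct) * (r * (- (st * sp)) + b * (st * cp)))
      + r * ct * ((r * (ct * cp) + a * (st * cp)) * (r * (st * cp) + b * (st * sp))
        - (r * (ct * sp) + a * (st * sp)) * (r * (- (st * sp)) + b * (st * cp)))
      = r ^ 3 * st"
    using pt pp by algebra
  have "sin \<theta> / N ?u ^ 3 = r ^ 3 * st"
    by (simp add: r_def h_def st_def power_one_over field_simps)
  then show ?thesis
    unfolding ind_vol_def D y Ny d(2,3)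
    using key by (simp add: sph_def Ny a_def b_def st_def ct_def sp_def cp_def r_def)
qed

end

theory Submission
  imports Defs
begin

text \<open>
  Parallel transport preserves the Finsler function \<open>F\<close>. Infinitesimally this says that the
  horizontal lifts of vector fields annihilate \<open>F\<close>; hence so do their commutators, that is, every
  curvature endomorphism lies in the Lie algebra of linear isometries of the Minkowski norm \<open>F p\<close>.
  The averaged scalar product is invariant under linear isometries (write it as an integral over
  the unit body, where the linear change of variables applies), so this algebra consists of
  infinitesimal rotations. Two rotations about different axes would force \<open>F p\<close> to be
  constant on spheres, that is \<open>F\<^sup>2\<close> to be quadratic. All tangent spaces are isometric to each
  other by connectedness, so everywhere the algebra is one-dimensional and the rotation axes form a
  distribution that is invariant under parallel transport. Its sections of constant length are
  therefore parallel, and a parallel field is Killing when the torsion is totally antisymmetric.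
\<close>

text \<open>Transport enters only through its first-order behaviour at one point. The parallel
  equation is solved along straight chart segments ending at the base point \<open>x\<close>,
  rescaled to [0,1], where its coefficients are small. This gives linear isometries
  \<open>Q u\<close> from the tangent space over \<open>x + u\<close> to the one over
  \<open>x\<close>, with derivative \<open>Gam\<close> at \<open>u = 0\<close>. That single
  derivative yields the annihilation of \<open>F\<close> by horizontal lifts, the metric
  compatibility of \<open>nabla\<close> and the derivative of the axis field; smooth dependence of
  solutions on parameters never enters.

  The price is that smoothness of the axis field cannot be read off from \<open>Q\<close>, which is
  controlled only at \<open>u = 0\<close>. On a line, however, a vector is determined by its length
  and a sign, so a unit axis field agrees near each point with the transport of its value there.
  Hence it solves the total differential equation \<open>dX = - Gam(_, X)\<close> at every point of
  a chart ball, and its smoothness follows by bootstrapping.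

  Invariance of the average rests on the weight \<open>sqrt (det g)\<close>: under a linear isometry
  it changes by exactly the Jacobian of the change of variables.\<close>

lemma linear_basis_sum:
  fixes L :: "'a::euclidean_space \<Rightarrow> 'b::real_vector"
  assumes "linear L" shows "L y = (\<Sum>b\<in>Basis. (y \<bullet> b) *\<^sub>R L b)"
proof -
  have "L (\<Sum>b\<in>Basis. (y \<bullet> b) *\<^sub>R b) = (\<Sum>b\<in>Basis. (y \<bullet> b) *\<^sub>R L b)"
    by (simp add: linear_sum[OF assms] linear_scale[OF assms])
  then show ?thesis by (simp add: euclidean_representation)
qed

lemma linear_axis_sum:
  fixes L :: "real^'n \<Rightarrow> 'b::real_vector"
  assumes "linear L" shows "L y = (\<Sum>i\<in>UNIV. y $ i *\<^sub>R L (axis i 1))"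
proof -
  have "L (\<Sum>i\<in>UNIV. y $ i *\<^sub>R axis i 1) = (\<Sum>i\<in>UNIV. y $ i *\<^sub>R L (axis i 1))"
    by (simp add: linear_sum[OF assms] linear_scale[OF assms])
  then show ?thesis by (simp add: basis_expansion flip: scalar_mult_eq_scaleR)
qed

lemma frechet_eqI: "(f has_derivative f') (at x) \<Longrightarrow> frechet_derivative f (at x) = f'"
  by (rule frechet_derivative_at[symmetric])

lemma has_derivative_frechet:
  "f differentiable (at x) \<Longrightarrow> (f has_derivative frechet_derivative f (at x)) (at x)"
  using frechet_derivative_works by blast

lemma linear_frechet: "f differentiable (at x) \<Longrightarrow> linear (frechet_derivative f (at x))"
  by (simp add: linear_frechet_derivative)

lemma frechet_basis_sum:
  fixes f :: "'a::euclidean_space \<Rightarrow> 'b::real_normed_vector"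
  assumes "f differentiable (at x)"
  shows "frechet_derivative f (at x) v = (\<Sum>b\<in>Basis. (v \<bullet> b) *\<^sub>R frechet_derivative f (at x) b)"
  by (rule linear_basis_sum[OF linear_frechet[OF assms]])

lemma frechet_cong_open:
  assumes "open S" "x \<in> S" "\<And>y. y \<in> S \<Longrightarrow> f y = g y"
  shows "frechet_derivative f (at x) = frechet_derivative g (at x)"
proof -
  have "(f has_derivative f') (at x) \<longleftrightarrow> (g has_derivative f') (at x)" for f'
    using has_derivative_transform_within_open[OF _ assms(1,2), of f f' UNIV g]
      has_derivative_transform_within_open[OF _ assms(1,2), of g f' UNIV f] assms(3) by auto
  then show ?thesis by (simp add: frechet_derivative_def)
qed

lemma differentiable_cong_open:
  assumes "open S" "x \<in> S" "\<And>y. y \<in> S \<Longrightarrow> f y = g y" "f differentiable (at x)"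
  shows "g differentiable (at x)"
  using has_derivative_transform_within_open[OF _ assms(1,2), of f _ UNIV g] assms(3,4)
  unfolding differentiable_def by blast

lemma frechet_compose:
  assumes "g differentiable (at x)" "f differentiable (at (g x))"
  shows "frechet_derivative (\<lambda>x. f (g x)) (at x) v
    = frechet_derivative f (at (g x)) (frechet_derivative g (at x) v)"
  using fun_cong[OF frechet_derivative_compose[OF assms], of v] by (simp add: o_def)

subsection \<open>Calculus of smooth functions\<close>

lemma Ck_on_cong:
  assumes "open S" "\<And>x. x \<in> S \<Longrightarrow> f x = g x" "Ck_on k S f"
  shows "Ck_on k S g"
  using assms(2,3)
proof (induction k arbitrary: f g)
  case 0
  then show ?case by (simp cong: continuous_on_cong)
next
  case (Suc k)
  have "frechet_derivative f (at x) = frechet_derivative g (at x)" if "x \<in> S" for x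
    using frechet_cong_open[OF assms(1) that] Suc.prems by blast
  then have "Ck_on k S (\<lambda>x. frechet_derivative g (at x) v)" for v
    using Suc.prems(2) Suc.IH[of "\<lambda>x. frechet_derivative f (at x) v"
        "\<lambda>x. frechet_derivative g (at x) v"] by simp
  then show ?case
    using Suc.prems differentiable_cong_open[OF assms(1), of _ f g] by auto
qed

lemma Ck_on_subset: "Ck_on k S f \<Longrightarrow> T \<subseteq> S \<Longrightarrow> Ck_on k T f"
  by (induction k arbitrary: f) (auto intro: continuous_on_subset)

lemma Ck_on_SucD: "Ck_on (Suc k) S f \<Longrightarrow> Ck_on k S f"
proof (induction k arbitrary: f)
  case 0
  then show ?case
    by (auto intro!: continuous_at_imp_continuous_on differentiable_imp_continuous_within)
next
  case (Suc k)
  then show ?case by (metis Ck_on.simps(2))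
qed

lemma Ck_on_const: "Ck_on k S (\<lambda>x. c)"
  by (induction k arbitrary: c) (auto simp: frechet_derivative_const)

lemma Ck_on_linear: "bounded_linear L \<Longrightarrow> Ck_on k S L"
proof (cases k)
  case 0
  then show "bounded_linear L \<Longrightarrow> Ck_on k S L"
    by (simp add: linear_continuous_on)
next
  case (Suc k')
  assume L: "bounded_linear L"
  then have "(L has_derivative L) (at x)" for x by (simp add: bounded_linear_imp_has_derivative)
  then have "frechet_derivative L (at x) = L" "L differentiable (at x)" for x
    by (auto intro: frechet_eqI simp: differentiable_def)
  then show "Ck_on k S L" by (simp add: Suc Ck_on_const)
qed

lemma bounded_bilinear_has_derivative_frechet:
  assumes "bounded_bilinear B" "f differentiable (at x)" "g differentiable (at x)"
  shows "((\<lambda>x. B (f x) (g x)) has_derivative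
    (\<lambda>v. B (f x) (frechet_derivative g (at x) v) + B (frechet_derivative f (at x) v) (g x))) (at x)"
  using bounded_bilinear.FDERIV[OF assms(1) has_derivative_frechet[OF assms(2)]
      has_derivative_frechet[OF assms(3)]] .

lemma Ck_on_add:
  assumes "open S" "Ck_on k S f" "Ck_on k S g"
  shows "Ck_on k S (\<lambda>x. f x + g x)"
  using assms(2,3)
proof (induction k arbitrary: f g)
  case 0
  then show ?case by (simp add: continuous_on_add)
next
  case (Suc k)
  have d: "((\<lambda>x. f x + g x) has_derivative
      (\<lambda>v. frechet_derivative f (at x) v + frechet_derivative g (at x) v)) (at x)" if "x \<in> S" for x
    using Suc.prems that by (intro has_derivative_add has_derivative_frechet) auto
  have "Ck_on k S (\<lambda>x. frechet_derivative (\<lambda>x. f x + g x) (at x) v)" for v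
    by (rule Ck_on_cong[OF assms(1) _ Suc.IH[of "\<lambda>x. frechet_derivative f (at x) v"
            "\<lambda>x. frechet_derivative g (at x) v"]])
      (use Suc.prems frechet_eqI[OF d] in auto)
  then show ?case using d by (auto simp: differentiable_def)
qed

text \<open>The product rule in its bilinear form covers inner products, scalar multiples and
  products of reals at once. Both summands of the derivative contain an undifferentiated factor,
  hence the appeal to \<open>Ck_on_SucD\<close>.\<close>

lemma Ck_on_bilinear:
  assumes "open S" "bounded_bilinear B" "Ck_on k S f" "Ck_on k S g"
  shows "Ck_on k S (\<lambda>x. B (f x) (g x))"
  using assms(3,4)
proof (induction k arbitrary: f g)
  case 0
  then show ?case by (simp add: bounded_bilinear.continuous_on[OF assms(2)])
next
  case (Suc k)
  have d: "((\<lambda>x. B (f x) (g x)) has_derivative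
     (\<lambda>v. B (f x) (frechet_derivative g (at x) v) + B (frechet_derivative f (at x) v) (g x))) (at x)"
    if "x \<in> S" for x
    using Suc.prems that by (intro bounded_bilinear_has_derivative_frechet assms) auto
  have "Ck_on k S (\<lambda>x. frechet_derivative (\<lambda>x. B (f x) (g x)) (at x) v)" for v
    by (rule Ck_on_cong[OF assms(1) _ Ck_on_add[OF assms(1) Suc.IH[of f "\<lambda>x. frechet_derivative g (at x) v"]
            Suc.IH[of "\<lambda>x. frechet_derivative f (at x) v" g]]])
      (use Suc.prems Ck_on_SucD[OF Suc.prems(1)] Ck_on_SucD[OF Suc.prems(2)] frechet_eqI[OF d] in auto)
  then show ?case using d by (auto simp: differentiable_def)
qed

lemma Ck_on_sum:
  assumes "open S" "\<And>i. i \<in> I \<Longrightarrow> Ck_on k S (f i)"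
  shows "Ck_on k S (\<lambda>x. \<Sum>i\<in>I. f i x)"
  using assms(2)
  by (induction I rule: infinite_finite_induct) (auto intro: Ck_on_const Ck_on_add[OF assms(1)])

text \<open>In the chain rule the derivative of \<open>f\<close> is taken in a direction that varies
  with \<open>x\<close>, whereas \<open>Ck_on\<close> speaks of fixed directions. Expanding that
  direction in the basis turns the derivative into a sum of products to which the induction
  hypothesis applies.\<close>

lemma Ck_on_compose:
  assumes "open S" "open T" "g ` S \<subseteq> T" "Ck_on k T f" "Ck_on k S g"
  shows "Ck_on k S (\<lambda>x. f (g x))"
  using assms(4,5)
proof (induction k arbitrary: f)
  case 0
  then show ?case using continuous_on_compose2 assms(3) by (simp add: image_subset_iff) blast
next
  case (Suc k)
  have g: "g differentiable (at x)" and f: "f differentiable (at (g x))" if "x \<in> S" for x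
    using Suc.prems assms(3) that by auto
  have d: "frechet_derivative (\<lambda>x. f (g x)) (at x) v
      = (\<Sum>b\<in>Basis. (frechet_derivative g (at x) v \<bullet> b) *\<^sub>R frechet_derivative f (at (g x)) b)"
    if "x \<in> S" for x v
    using frechet_compose[OF g f] frechet_basis_sum[OF f] that by simp
  have "Ck_on k S (\<lambda>x. frechet_derivative (\<lambda>x. f (g x)) (at x) v)" for v
  proof (rule Ck_on_cong[OF assms(1) d[symmetric]])
    have "Ck_on k S (\<lambda>x. frechet_derivative f (at (g x)) b)" for b
      using Suc.prems Ck_on_SucD[OF Suc.prems(2)] by (intro Suc.IH[of "\<lambda>y. frechet_derivative f (at y) b"]) auto
    moreover have "Ck_on k S (\<lambda>x. frechet_derivative g (at x) v \<bullet> b)" for b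
      using Suc.prems by (intro Ck_on_bilinear[OF assms(1) bounded_bilinear_inner] Ck_on_const) auto
    ultimately show "Ck_on k S (\<lambda>x. \<Sum>b\<in>Basis. (frechet_derivative g (at x) v \<bullet> b) *\<^sub>R frechet_derivative f (at (g x)) b)"
      by (intro Ck_on_sum Ck_on_bilinear[OF assms(1) bounded_bilinear_scaleR] assms(1))
  qed
  moreover have "(\<lambda>x. f (g x)) differentiable (at x)" if "x \<in> S" for x
    using differentiable_chain_at[OF g f] that by (simp add: o_def)
  ultimately show ?case by simp
qed

lemma smooth_on_cong: "open S \<Longrightarrow> (\<And>x. x \<in> S \<Longrightarrow> f x = g x) \<Longrightarrow> smooth_on S f \<Longrightarrow> smooth_on S g"
  unfolding smooth_on_def by (meson Ck_on_cong)

lemma smooth_on_subset: "smooth_on S f \<Longrightarrow> T \<subseteq> S \<Longrightarrow> smooth_on T f"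
  unfolding smooth_on_def by (meson Ck_on_subset)

lemma smooth_on_const: "smooth_on S (\<lambda>x. c)"
  by (simp add: smooth_on_def Ck_on_const)

lemma smooth_on_linear: "bounded_linear L \<Longrightarrow> smooth_on S L"
  by (simp add: smooth_on_def Ck_on_linear)

lemma smooth_on_add: "open S \<Longrightarrow> smooth_on S f \<Longrightarrow> smooth_on S g \<Longrightarrow> smooth_on S (\<lambda>x. f x + g x)"
  by (simp add: smooth_on_def Ck_on_add)

lemma smooth_on_bilinear:
  "open S \<Longrightarrow> bounded_bilinear B \<Longrightarrow> smooth_on S f \<Longrightarrow> smooth_on S g \<Longrightarrow> smooth_on S (\<lambda>x. B (f x) (g x))"
  by (simp add: smooth_on_def Ck_on_bilinear)

lemmas smooth_on_scaleR = smooth_on_bilinear[OF _ bounded_bilinear_scaleR]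

lemma smooth_on_sum:
  "open S \<Longrightarrow> (\<And>i. i \<in> I \<Longrightarrow> smooth_on S (f i)) \<Longrightarrow> smooth_on S (\<lambda>x. \<Sum>i\<in>I. f i x)"
  by (simp add: smooth_on_def Ck_on_sum)

lemma smooth_on_compose:
  assumes "open S" "open T" "g ` S \<subseteq> T" "smooth_on T f" "smooth_on S g"
  shows "smooth_on S (\<lambda>x. f (g x))"
  using assms(4,5) Ck_on_compose[OF assms(1-3), of _ f] by (simp add: smooth_on_def)

lemma smooth_on_vec_nth:
  fixes f :: "'a::euclidean_space \<Rightarrow> real^'n"
  shows "open S \<Longrightarrow> smooth_on S f \<Longrightarrow> smooth_on S (\<lambda>x. f x $ i)"
  by (rule smooth_on_compose[where T = UNIV and f = "\<lambda>y. y $ i"])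
    (auto intro: smooth_on_linear bounded_linear_vec_nth)

lemma smooth_on_frechet: "smooth_on S f \<Longrightarrow> smooth_on S (\<lambda>x. frechet_derivative f (at x) v)"
  unfolding smooth_on_def using Ck_on.simps(2) by blast

lemma smooth_on_differentiable: "smooth_on S f \<Longrightarrow> x \<in> S \<Longrightarrow> f differentiable (at x)"
  unfolding smooth_on_def using Ck_on.simps(2) by blast

lemma smooth_on_continuous: "smooth_on S f \<Longrightarrow> continuous_on S f"
  unfolding smooth_on_def using Ck_on.simps(1) by blast

text \<open>A solution of a linear total differential equation with smooth coefficients is as often
  differentiable as its own derivative, hence smooth.\<close>

lemma smooth_on_bootstrap:
  fixes X :: "'a::euclidean_space \<Rightarrow> real^'n"
  assumes "open S"
    and d: "\<And>x. x \<in> S \<Longrightarrow> (X has_derivative (\<lambda>u. \<Sum>j\<in>UNIV. (X x $ j) *\<^sub>R G x u j)) (at x)"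
    and G: "\<And>u j. smooth_on S (\<lambda>x. G x u j)"
  shows "smooth_on S X"
proof -
  have "Ck_on k S X" for k
  proof (induction k)
    case 0
    then show ?case
      using d by (auto intro!: continuous_at_imp_continuous_on has_derivative_continuous)
  next
    case (Suc k)
    have "Ck_on k S (\<lambda>x. frechet_derivative X (at x) u)" for u
    proof (rule Ck_on_cong[OF assms(1)])
      show "(\<Sum>j\<in>UNIV. (X x $ j) *\<^sub>R G x u j) = frechet_derivative X (at x) u" if "x \<in> S" for x
        using frechet_eqI[OF d[OF that]] by simp
      have "Ck_on k S (\<lambda>x. X x $ j)" for j
        by (rule Ck_on_compose[where T = UNIV and f = "\<lambda>y. y $ j"])
          (auto intro: Ck_on_linear bounded_linear_vec_nth assms(1) Suc)
      then show "Ck_on k S (\<lambda>x. \<Sum>j\<in>UNIV. (X x $ j) *\<^sub>R G x u j)"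
        using G unfolding smooth_on_def
        by (intro Ck_on_sum assms(1) Ck_on_bilinear[OF assms(1) bounded_bilinear_scaleR]) auto
    qed
    then show ?case using d by (auto simp: differentiable_def)
  qed
  then show ?thesis by (simp add: smooth_on_def)
qed

subsection \<open>Symmetry of second derivatives\<close>

lemma differentiable_line:
  assumes "g differentiable (at (y + s *\<^sub>R u))"
  shows "((\<lambda>s. g (y + s *\<^sub>R u)) has_vector_derivative frechet_derivative g (at (y + s *\<^sub>R u)) u) (at s)"
proof -
  have "((\<lambda>s. y + s *\<^sub>R u) has_derivative (\<lambda>r. r *\<^sub>R u)) (at s)"
    by (auto intro!: derivative_eq_intros)
  then have "((\<lambda>s. g (y + s *\<^sub>R u)) has_derivative
      (\<lambda>r. frechet_derivative g (at (y + s *\<^sub>R u)) (r *\<^sub>R u))) (at s)"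
    using has_derivative_frechet[OF assms] has_derivative_compose[of "\<lambda>s. y + s *\<^sub>R u"] by blast
  then show ?thesis
    using linear_frechet[OF assms] by (simp add: has_vector_derivative_def linear_scale)
qed

text \<open>The mean value theorem is applied twice: to
  \<open>s \<mapsto> f (x + s u + h v) - f (x + s u)\<close>, then to the derivative of
  \<open>f\<close> along \<open>u\<close> on the segment in direction \<open>v\<close>.\<close>

lemma second_difference_mvt:
  fixes f :: "'a::euclidean_space \<Rightarrow> real"
  assumes f: "\<forall>y\<in>S. f differentiable (at y)"
    and f': "\<forall>y\<in>S. (\<lambda>y. frechet_derivative f (at y) u) differentiable (at y)"
    and h: "h > 0"
    and S: "\<forall>a\<in>{0..h}. \<forall>b\<in>{0..h}. x + a *\<^sub>R u + b *\<^sub>R v \<in> S"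
  obtains a b where "0 < a" "a < h" "0 < b" "b < h"
    "f (x + h *\<^sub>R u + h *\<^sub>R v) - f (x + h *\<^sub>R u) - f (x + h *\<^sub>R v) + f x
      = h * h * frechet_derivative (\<lambda>y. frechet_derivative f (at y) u) (at (x + a *\<^sub>R u + b *\<^sub>R v)) v"
proof -
  let ?g = "\<lambda>y. frechet_derivative f (at y) u"
  have d1: "((\<lambda>s. f (x + s *\<^sub>R u + h *\<^sub>R v) - f (x + s *\<^sub>R u)) has_field_derivative
      ?g (x + s *\<^sub>R u + h *\<^sub>R v) - ?g (x + s *\<^sub>R u)) (at s)" if "0 \<le> s" "s \<le> h" for s
  proof -
    have "f differentiable (at (x + h *\<^sub>R v + s *\<^sub>R u))" "f differentiable (at (x + s *\<^sub>R u))"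
      using f S[rule_format, of s h] S[rule_format, of s 0] that h by (auto simp: algebra_simps)
    from differentiable_line[OF this(1)] differentiable_line[OF this(2)]
    show ?thesis
      unfolding has_real_derivative_iff_has_vector_derivative
      by (auto intro!: has_vector_derivative_diff simp: algebra_simps)
  qed
  from MVT2[OF h d1] obtain a where a: "0 < a" "a < h"
    and ea: "f (x + h *\<^sub>R u + h *\<^sub>R v) - f (x + h *\<^sub>R u) - (f (x + 0 *\<^sub>R u + h *\<^sub>R v) - f (x + 0 *\<^sub>R u))
      = (h - 0) * (?g (x + a *\<^sub>R u + h *\<^sub>R v) - ?g (x + a *\<^sub>R u))" by auto
  have d2: "((\<lambda>t. ?g (x + a *\<^sub>R u + t *\<^sub>R v)) has_field_derivative
      frechet_derivative ?g (at (x + a *\<^sub>R u + t *\<^sub>R v)) v) (at t)" if "0 \<le> t" "t \<le> h" for t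
    unfolding has_real_derivative_iff_has_vector_derivative
    using differentiable_line[OF f'[rule_format, OF S[rule_format, of a t]]] that a by simp
  from MVT2[OF h d2] obtain b where b: "0 < b" "b < h"
    "?g (x + a *\<^sub>R u + h *\<^sub>R v) - ?g (x + a *\<^sub>R u + 0 *\<^sub>R v)
      = (h - 0) * frechet_derivative ?g (at (x + a *\<^sub>R u + b *\<^sub>R v)) v" by auto
  show thesis
    using that[OF a b(1,2)] ea b(3) by (simp add: algebra_simps)
qed

text \<open>The second difference is symmetric in \<open>u\<close> and \<open>v\<close>. Evaluating
  it in both orders shows that the two mixed derivatives agree at points arbitrarily close to
  \<open>x\<close>, and both are continuous there.\<close>

lemma frechet_second_symmetric:
  fixes f :: "'a::euclidean_space \<Rightarrow> real"
  assumes S: "open S" "x \<in> S" and f: "smooth_on S f"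
  shows "frechet_derivative (\<lambda>y. frechet_derivative f (at y) u) (at x) v
    = frechet_derivative (\<lambda>y. frechet_derivative f (at y) v) (at x) u"
proof -
  define D2 where "D2 u v y = frechet_derivative (\<lambda>y. frechet_derivative f (at y) u) (at y) v" for u v y
  have cont: "isCont (D2 u v) x" for u v
    using smooth_on_continuous[OF smooth_on_frechet[OF smooth_on_frechet[OF f, of u], of v]] S
    by (simp add: D2_def[abs_def] continuous_on_eq_continuous_at)
  have "\<bar>D2 u v x - D2 v u x\<bar> \<le> e" if e: "e > 0" for e
  proof -
    obtain d1 where d1: "d1 > 0" "\<And>y. dist y x < d1 \<Longrightarrow> dist (D2 u v y) (D2 u v x) < e / 2"
      using cont[of u v, unfolded continuous_at_eps_delta, rule_format, of "e / 2"] e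
      by (auto simp: dist_norm)
    obtain d2 where d2: "d2 > 0" "\<And>y. dist y x < d2 \<Longrightarrow> dist (D2 v u y) (D2 v u x) < e / 2"
      using cont[of v u, unfolded continuous_at_eps_delta, rule_format, of "e / 2"] e
      by (auto simp: dist_norm)
    obtain d3 where d3: "d3 > 0" "ball x d3 \<subseteq> S" using S openE by blast
    define d where "d = min d1 (min d2 d3)"
    have d: "d > 0" using d1 d2 d3 by (simp add: d_def)
    \<comment> \<open>With this step size the whole parallelogram spanned by \<open>h u\<close> and
      \<open>h v\<close> stays within distance \<open>d\<close> of \<open>x\<close>; the summand 1
      covers \<open>u = v = 0\<close>.\<close>
    define h where "h = d / (norm u + norm v + 1)"
    have nn: "norm u + norm v + 1 > 0" by (smt (verit) norm_ge_zero)
    have h: "h > 0" using d nn by (simp add: h_def)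
    have hd: "h * (norm u + norm v) < d"
    proof -
      have "h * (norm u + norm v) < h * (norm u + norm v + 1)" using h by simp
      also have "\<dots> = d" using nn by (simp add: h_def)
      finally show ?thesis .
    qed
    have near: "dist (x + a *\<^sub>R u + b *\<^sub>R v) x < d" if "0 \<le> a" "a \<le> h" "0 \<le> b" "b \<le> h" for a b
    proof -
      have "dist (x + a *\<^sub>R u + b *\<^sub>R v) x \<le> a * norm u + b * norm v"
        using norm_triangle_ineq[of "a *\<^sub>R u" "b *\<^sub>R v"] that by (simp add: dist_norm add.assoc)
      also have "\<dots> \<le> h * norm u + h * norm v"
        using that by (intro add_mono mult_right_mono) auto
      finally show ?thesis using hd by (simp add: algebra_simps)
    qed
    have inS: "\<forall>a\<in>{0..h}. \<forall>b\<in>{0..h}. x + a *\<^sub>R u + b *\<^sub>R v \<in> S"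
      using near d3 by (auto simp: d_def subset_iff dist_commute)
    then have inS': "\<forall>a\<in>{0..h}. \<forall>b\<in>{0..h}. x + a *\<^sub>R v + b *\<^sub>R u \<in> S"
      by (metis add.assoc add.commute)
    have fd: "\<forall>y\<in>S. f differentiable (at y)"
      "\<forall>y\<in>S. (\<lambda>y. frechet_derivative f (at y) w) differentiable (at y)" for w
      using smooth_on_differentiable[OF f] smooth_on_differentiable[OF smooth_on_frechet[OF f]] by auto
    obtain a b where ab: "0 < a" "a < h" "0 < b" "b < h"
      "f (x + h *\<^sub>R u + h *\<^sub>R v) - f (x + h *\<^sub>R u) - f (x + h *\<^sub>R v) + f x
        = h * h * D2 u v (x + a *\<^sub>R u + b *\<^sub>R v)"
      using second_difference_mvt[OF fd(1) fd(2) h inS] unfolding D2_def by blast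
    obtain a' b' where ab': "0 < a'" "a' < h" "0 < b'" "b' < h"
      "f (x + h *\<^sub>R v + h *\<^sub>R u) - f (x + h *\<^sub>R v) - f (x + h *\<^sub>R u) + f x
        = h * h * D2 v u (x + a' *\<^sub>R v + b' *\<^sub>R u)"
      using second_difference_mvt[OF fd(1) fd(2) h inS'] unfolding D2_def by blast
    have sw: "x + h *\<^sub>R u + h *\<^sub>R v = x + h *\<^sub>R v + h *\<^sub>R u" by (simp add: algebra_simps)
    have "h * h * D2 u v (x + a *\<^sub>R u + b *\<^sub>R v) = h * h * D2 v u (x + a' *\<^sub>R v + b' *\<^sub>R u)"
      using ab(5) ab'(5) unfolding sw by linarith
    then have "D2 u v (x + a *\<^sub>R u + b *\<^sub>R v) = D2 v u (x + a' *\<^sub>R v + b' *\<^sub>R u)" using h by simp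
    moreover have "dist (D2 u v (x + a *\<^sub>R u + b *\<^sub>R v)) (D2 u v x) < e / 2"
      using near[of a b] ab by (intro d1) (auto simp: d_def)
    moreover have "dist (D2 v u (x + a' *\<^sub>R v + b' *\<^sub>R u)) (D2 v u x) < e / 2"
      using near[of b' a'] ab' by (intro d2) (auto simp: d_def algebra_simps)
    ultimately show ?thesis unfolding dist_real_def by linarith
  qed
  then have "\<bar>D2 u v x - D2 v u x\<bar> \<le> 0" by (rule field_le_epsilon) simp
  then show ?thesis by (simp add: D2_def)
qed

lemma frechet_vec_nth:
  fixes f :: "'a::real_normed_vector \<Rightarrow> real^'n"
  assumes "f differentiable (at x)"
  shows "frechet_derivative (\<lambda>x. f x $ i) (at x) v = frechet_derivative f (at x) v $ i"
    "(\<lambda>x. f x $ i) differentiable (at x)"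
proof -
  have "((\<lambda>x. f x $ i) has_derivative (\<lambda>v. frechet_derivative f (at x) v $ i)) (at x)"
    using bounded_linear.has_derivative[OF bounded_linear_vec_nth has_derivative_frechet[OF assms]] .
  then show "frechet_derivative (\<lambda>x. f x $ i) (at x) v = frechet_derivative f (at x) v $ i"
    "(\<lambda>x. f x $ i) differentiable (at x)"
    by (auto simp: frechet_eqI differentiable_def)
qed

lemma frechet_second_symmetric_vec:
  fixes f :: "'a::euclidean_space \<Rightarrow> real^'n"
  assumes S: "open S" "x \<in> S" and f: "smooth_on S f"
  shows "frechet_derivative (\<lambda>y. frechet_derivative f (at y) u) (at x) v
    = frechet_derivative (\<lambda>y. frechet_derivative f (at y) v) (at x) u"
proof (rule vec_eq_iff[THEN iffD2], rule allI)
  fix i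
  have *: "frechet_derivative (\<lambda>y. frechet_derivative f (at y) u) (at x) v $ i
      = frechet_derivative (\<lambda>y. frechet_derivative (\<lambda>x. f x $ i) (at y) u) (at x) v" for u v
  proof -
    have "frechet_derivative (\<lambda>y. frechet_derivative f (at y) u) (at x) v $ i
      = frechet_derivative (\<lambda>y. frechet_derivative f (at y) u $ i) (at x) v"
      using frechet_vec_nth(1)[OF smooth_on_differentiable[OF smooth_on_frechet[OF f] S(2)]] by simp
    also have "\<dots> = frechet_derivative (\<lambda>y. frechet_derivative (\<lambda>x. f x $ i) (at y) u) (at x) v"
      using frechet_vec_nth(1)[OF smooth_on_differentiable[OF f]]
      by (subst frechet_cong_open[OF S, of "\<lambda>y. frechet_derivative f (at y) u $ i"]) auto
    finally show ?thesis .
  qed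
  show "frechet_derivative (\<lambda>y. frechet_derivative f (at y) u) (at x) v $ i
      = frechet_derivative (\<lambda>y. frechet_derivative f (at y) v) (at x) u $ i"
    unfolding * by (rule frechet_second_symmetric[OF S smooth_on_vec_nth[OF S(1) f]])
qed

subsection \<open>Linear differential equations on the unit interval\<close>

text \<open>Picard iteration. On an interval of length 1 the integral operator contracts the sup
  distance by the factor \<open>k < 1\<close>, so the Banach fixed point theorem gives a solution on
  all of [0,1] in one go.\<close>

lemma linear_integral_equation:
  fixes G :: "real \<Rightarrow> 'a::euclidean_space \<Rightarrow>\<^sub>L 'a"
  assumes G: "continuous_on {0..1} G" and k: "\<And>t. t \<in> {0..1} \<Longrightarrow> norm (G t) \<le> k" "k < 1"
  obtains P where "continuous_on {0..1} P"
    "\<And>t. t \<in> {0..1} \<Longrightarrow> P t = id_blinfun + integral {0..t} (\<lambda>s. G s o\<^sub>L P s)"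
proof -
  have k0: "0 \<le> k" using k(1)[of 0] norm_ge_zero[of "G 0"] by (simp del: norm_ge_zero) 
  \<comment> \<open>Bounded continuous functions live on the whole line; clamping the time to [0,1]
    extends the operator to them without affecting its values on the interval.\<close>
  define c where "c t = max 0 (min 1 t)" for t :: real
  have c: "c t \<in> {0..1}" "t \<in> {0..1} \<Longrightarrow> c t = t" for t by (auto simp: c_def)
  have contc: "continuous_on UNIV c" unfolding c_def by (intro continuous_intros)
  define I where "I f t = id_blinfun + integral {0..c t} (\<lambda>s. G s o\<^sub>L apply_bcontfun f s)"
    for f :: "real \<Rightarrow>\<^sub>C ('a \<Rightarrow>\<^sub>L 'a)" and t
  have contGf: "continuous_on {0..1} (\<lambda>s. G s o\<^sub>L apply_bcontfun f s)" for f
    by (intro bounded_bilinear.continuous_on[OF bounded_bilinear_blinfun_compose] G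
        continuous_on_apply_bcontfun continuous_on_id)
  have contI: "continuous_on {0..1} (\<lambda>t. integral {0..t} (\<lambda>s. G s o\<^sub>L apply_bcontfun f s))" for f
    by (rule indefinite_integral_continuous_1[OF integrable_continuous_real[OF contGf]])
  have I: "I f \<in> bcontfun" for f
  proof -
    have "continuous_on UNIV (\<lambda>t. integral {0..c t} (\<lambda>s. G s o\<^sub>L apply_bcontfun f s))"
      by (rule continuous_on_compose2[OF contI contc]) (use c in auto)
    then have "continuous_on UNIV (I f)" unfolding I_def by (intro continuous_intros)
    moreover have "bounded (range (I f))"
    proof -
      have "compact ((\<lambda>t. id_blinfun + integral {0..t} (\<lambda>s. G s o\<^sub>L apply_bcontfun f s)) ` {0..1})"
        by (intro compact_continuous_image continuous_on_add contI continuous_on_const) auto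
      moreover have "range (I f) \<subseteq> (\<lambda>t. id_blinfun + integral {0..t} (\<lambda>s. G s o\<^sub>L apply_bcontfun f s)) ` {0..1}"
        using c(1) unfolding I_def by blast
      ultimately show ?thesis using bounded_subset compact_imp_bounded by blast
    qed
    ultimately show ?thesis by (simp add: bcontfun_def)
  qed
  define T where "T f = Bcontfun (I f)" for f
  have Tf: "apply_bcontfun (T f) t = I f t" for f t
    by (simp add: T_def Bcontfun_inverse[OF I])
  have "dist (T f) (T g) \<le> k * dist f g" for f g
  proof (rule dist_bound)
    fix t
    have i: "(\<lambda>s. G s o\<^sub>L apply_bcontfun f s) integrable_on {0..c t}" for f
      using integrable_continuous_real[OF continuous_on_subset[OF contGf]] c[of t] by force
    have "apply_bcontfun (T f) t - apply_bcontfun (T g) t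
        = integral {0..c t} (\<lambda>s. (G s o\<^sub>L apply_bcontfun f s) - (G s o\<^sub>L apply_bcontfun g s))"
      by (simp add: Tf I_def integral_diff[OF i i])
    also have "norm \<dots> \<le> (k * dist f g) * (c t - 0)"
    proof (rule integral_bound)
      show "continuous_on {0..c t} (\<lambda>s. (G s o\<^sub>L apply_bcontfun f s) - (G s o\<^sub>L apply_bcontfun g s))"
        using continuous_on_subset[OF contGf, of "{0..c t}"] c(1)[of t]
        by (intro continuous_on_diff) auto
      fix s assume s: "s \<in> {0..c t}"
      have "(G s o\<^sub>L apply_bcontfun f s) - (G s o\<^sub>L apply_bcontfun g s)
          = G s o\<^sub>L (apply_bcontfun f s - apply_bcontfun g s)"
        by (simp add: bounded_bilinear.diff_right[OF bounded_bilinear_blinfun_compose])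
      also have "norm \<dots> \<le> norm (G s) * dist (apply_bcontfun f s) (apply_bcontfun g s)"
        by (simp add: norm_blinfun_compose dist_norm)
      also have "\<dots> \<le> k * dist f g"
        using k(1)[of s] s c(1)[of t] k0 by (intro mult_mono dist_bounded) auto
      finally show "norm ((G s o\<^sub>L apply_bcontfun f s) - (G s o\<^sub>L apply_bcontfun g s)) \<le> k * dist f g" .
    qed (use c(1)[of t] in auto)
    also have "\<dots> \<le> (k * dist f g) * 1"
      using c(1)[of t] k0 by (intro mult_left_mono) auto
    finally show "dist (apply_bcontfun (T f) t) (apply_bcontfun (T g) t) \<le> k * dist f g"
      by (simp add: dist_norm)
  qed
  then obtain f where f: "T f = f"
    using banach_fix_type[of k T] k0 k(2) by blast
  show thesis
  proof
    show "continuous_on {0..1} (apply_bcontfun f)"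
      by (intro continuous_on_apply_bcontfun continuous_on_id)
    show "apply_bcontfun f t = id_blinfun + integral {0..t} (\<lambda>s. G s o\<^sub>L apply_bcontfun f s)"
      if "t \<in> {0..1}" for t
      using Tf[of f t] f c(2)[OF that] by (simp add: I_def)
  qed
qed

text \<open>The last conclusion is the first-order expansion of the solution operator:
  \<open>e\<close> measures how far the coefficient is from the constant \<open>L\<close>, and the
  remainder \<open>2 * k^2\<close> is the coefficient bound \<open>k\<close> times the bound
  \<open>2 * k\<close> for the deviation of \<open>P\<close> from the identity.\<close>

lemma linear_ode_near_identity:
  fixes G :: "real \<Rightarrow> 'a::euclidean_space \<Rightarrow>\<^sub>L 'a"
  assumes G: "continuous_on {0..1} G" and k: "\<And>t. t \<in> {0..1} \<Longrightarrow> norm (G t) \<le> k" "k \<le> 1/2"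
  obtains P where "P 0 = id_blinfun"
    "\<And>t. t \<in> {0..1} \<Longrightarrow> (P has_vector_derivative (G t o\<^sub>L P t)) (at t within {0..1})"
    "\<And>t. t \<in> {0..1} \<Longrightarrow> norm (P t - id_blinfun) \<le> 2 * k"
    "\<And>L e. (\<And>t. t \<in> {0..1} \<Longrightarrow> norm (G t - L) \<le> e) \<Longrightarrow> norm (P 1 - id_blinfun - L) \<le> e + 2 * k\<^sup>2"
proof -
  have k0: "0 \<le> k" using k(1)[of 0] norm_ge_zero[of "G 0"] by (simp del: norm_ge_zero)
  obtain P where P: "continuous_on {0..1} P"
    "\<And>t. t \<in> {0..1} \<Longrightarrow> P t = id_blinfun + integral {0..t} (\<lambda>s. G s o\<^sub>L P s)"
    using linear_integral_equation[OF G k(1) le_less_trans[OF k(2)]] by auto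
  have contGP: "continuous_on {0..1} (\<lambda>s. G s o\<^sub>L P s)"
    by (intro bounded_bilinear.continuous_on[OF bounded_bilinear_blinfun_compose] G P(1))
  \<comment> \<open>The largest deviation \<open>m\<close> from the identity is attained. The
    integral equation gives \<open>m \<le> k * (1 + m)\<close>, and \<open>k \<le> 1/2\<close>
    absorbs the term \<open>k * m\<close>.\<close>
  have "compact ((\<lambda>t. norm (P t - id_blinfun)) ` {0..1::real})"
    by (intro compact_continuous_image continuous_intros P(1)) auto
  then obtain t0 where t0: "t0 \<in> {0..1}" "\<And>t. t \<in> {0..1} \<Longrightarrow> norm (P t - id_blinfun) \<le> norm (P t0 - id_blinfun)"
    using compact_attains_sup[of "(\<lambda>t. norm (P t - id_blinfun)) ` {0..1::real}"] by fastforce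
  let ?m = "norm (P t0 - id_blinfun)"
  have nP: "norm (P s) \<le> 1 + ?m" if "s \<in> {0..1}" for s
  proof -
    have "norm (P s) \<le> norm (id_blinfun :: 'a \<Rightarrow>\<^sub>L 'a) + norm (P s - id_blinfun)"
      using norm_triangle_ineq[of "id_blinfun" "P s - id_blinfun"] by simp
    then show ?thesis using t0(2)[OF that] norm_blinfun_id_le[where 'a='a] by linarith
  qed
  have "?m \<le> (k * (1 + ?m)) * (t0 - 0)"
    unfolding P(2)[OF t0(1), THEN arg_cong[where f="\<lambda>x. x - id_blinfun"], simplified]
  proof (rule integral_bound)
    show "continuous_on {0..t0} (\<lambda>s. G s o\<^sub>L P s)"
      using continuous_on_subset[OF contGP] t0(1) by auto
    show "norm (G s o\<^sub>L P s) \<le> k * (1 + norm (integral {0..t0} (\<lambda>s. G s o\<^sub>L P s)))" if "s \<in> {0..t0}" for s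
    proof -
      have s: "s \<in> {0..1}" using that t0(1) by auto
      have "norm (G s o\<^sub>L P s) \<le> norm (G s) * norm (P s)" by (rule norm_blinfun_compose)
      also have "\<dots> \<le> k * (1 + ?m)" using k(1)[OF s] nP[OF s] k0 by (intro mult_mono) auto
      finally show ?thesis using P(2)[OF t0(1)] by simp
    qed
  qed (use t0 in auto)
  also have "\<dots> \<le> (k * (1 + ?m)) * 1" using t0(1) k0 by (intro mult_left_mono) auto
  finally have "?m \<le> k + k * ?m" by (simp add: algebra_simps)
  moreover have "k * ?m \<le> 1/2 * ?m" using k(2) by (intro mult_right_mono) auto
  ultimately have m: "?m \<le> 2 * k" by linarith
  have bound: "norm (P t - id_blinfun) \<le> 2 * k" if "t \<in> {0..1}" for t
    using t0(2)[OF that] m by linarith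
  show thesis
  proof
    show "P 0 = id_blinfun" using P(2)[of 0] by simp
    show "(P has_vector_derivative (G t o\<^sub>L P t)) (at t within {0..1})" if "t \<in> {0..1}" for t
    proof (rule has_vector_derivative_transform[OF that])
      show "P s = id_blinfun + integral {0..s} (\<lambda>s. G s o\<^sub>L P s)" if "s \<in> {0..1}" for s
        using P(2)[OF that] .
      show "((\<lambda>t. id_blinfun + integral {0..t} (\<lambda>s. G s o\<^sub>L P s)) has_vector_derivative (G t o\<^sub>L P t)) (at t within {0..1})"
        using has_vector_derivative_add[OF has_vector_derivative_const integral_has_vector_derivative[OF contGP that]] by simp
    qed
    show "norm (P t - id_blinfun) \<le> 2 * k" if "t \<in> {0..1}" for t by (rule bound[OF that])
    fix L e assume L: "\<And>t. t \<in> {0..1} \<Longrightarrow> norm (G t - L) \<le> e"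
    have "P 1 - id_blinfun - L = integral {0..1} (\<lambda>s. (G s o\<^sub>L P s) - L)"
      using P(2)[of 1] integral_diff[OF integrable_continuous_real[OF contGP] integrable_const_ivl, of L] by simp
    also have "norm \<dots> \<le> (e + 2 * k\<^sup>2) * (1 - 0)"
    proof (rule integral_bound)
      show "continuous_on {0..1} (\<lambda>s. (G s o\<^sub>L P s) - L)" by (intro continuous_intros contGP)
      fix s :: real assume s: "s \<in> {0..1}"
      have "(G s o\<^sub>L P s) - L = (G s - L) + (G s o\<^sub>L (P s - id_blinfun))"
        by (auto intro!: blinfun_eqI simp: blinfun.bilinear_simps)
      also have "norm \<dots> \<le> norm (G s - L) + norm (G s) * norm (P s - id_blinfun)"
        using norm_triangle_ineq norm_blinfun_compose by (meson add_left_mono order_trans)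
      also have "\<dots> \<le> e + k * (2 * k)"
        using L[OF s] k(1)[OF s] bound[OF s] k0 by (intro add_mono mult_mono) auto
      finally show "norm ((G s o\<^sub>L P s) - L) \<le> e + 2 * k\<^sup>2" by (simp add: power2_eq_square)
    qed auto
    finally show "norm (P 1 - id_blinfun - L) \<le> e + 2 * k\<^sup>2" by simp
  qed
qed

subsection \<open>Charts and transition maps\<close>

text \<open>Jacobian of a change of charts. \<open>tcoord\<close> and \<open>tvec\<close> are the
  cases in which one of the two charts is \<open>chart_at A p\<close>, so all their rules come from
  the cocycle property \<open>tjac_compose\<close>.\<close>

definition tjac :: "'m chart \<Rightarrow> 'm chart \<Rightarrow> 'm \<Rightarrow> real^3 \<Rightarrow> real^3" where
  "tjac c d p = frechet_derivative (cmap d \<circ> cinv c) (at (cmap c p))"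

locale atlas =
  fixes A :: "'m::{t2_space, second_countable_topology} chart set"
  assumes atlas: "smooth_atlas A"
begin

lemma chart: "c \<in> A \<Longrightarrow> is_chart c"
  using atlas by (simp add: smooth_atlas_def)

lemma open_cdom: "c \<in> A \<Longrightarrow> open (cdom c)"
  using chart by (simp add: is_chart_def)

lemma cinv_cmap: "c \<in> A \<Longrightarrow> p \<in> cdom c \<Longrightarrow> cinv c (cmap c p) = p"
  using chart by (auto simp: is_chart_def homeomorphism_def)

lemma cmap_cinv: "x \<in> cmap c ` cdom c \<Longrightarrow> cmap c (cinv c x) = x"
  by (simp add: cinv_def f_inv_into_f)

lemma cinv_in: "x \<in> cmap c ` cdom c \<Longrightarrow> cinv c x \<in> cdom c"
  by (simp add: cinv_def inv_into_into)

lemma continuous_cinv: "c \<in> A \<Longrightarrow> continuous_on (cmap c ` cdom c) (cinv c)"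
  using chart by (auto simp: is_chart_def homeomorphism_def)

lemma continuous_cmap: "c \<in> A \<Longrightarrow> continuous_on (cdom c) (cmap c)"
  using chart by (auto simp: is_chart_def homeomorphism_def)

lemma open_cimage: "c \<in> A \<Longrightarrow> open (cmap c ` cdom c)"
  using chart by (simp add: is_chart_def)

lemma cimage_Int: "c \<in> A \<Longrightarrow> cmap c ` (U \<inter> cdom c) = cmap c ` cdom c \<inter> cinv c -` U"
  by (auto simp: cinv_cmap image_iff)

lemma open_chart_image: "c \<in> A \<Longrightarrow> open U \<Longrightarrow> open (cmap c ` (U \<inter> cdom c))"
  using iffD1[OF continuous_on_open_vimage[OF open_cimage[of c]] continuous_cinv[of c], rule_format, of U]
  by (simp add: cimage_Int Int_commute)

lemma open_chart_image_sub: "c \<in> A \<Longrightarrow> open U \<Longrightarrow> U \<subseteq> cdom c \<Longrightarrow> open (cmap c ` U)"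
  using open_chart_image[of c U] by (simp add: Int_absorb2)

lemma open_cinv_image:
  assumes "c \<in> A" "open B" "B \<subseteq> cmap c ` cdom c"
  shows "open (cinv c ` B)"
proof -
  have "cinv c ` B = cdom c \<inter> cmap c -` B"
    using assms by (auto simp: cinv_in cmap_cinv image_iff subset_iff) (metis cinv_cmap)
  then show ?thesis
    using iffD1[OF continuous_on_open_vimage[OF open_cdom[OF assms(1)]] continuous_cmap[OF assms(1)],
        rule_format, OF assms(2)] by (simp add: Int_commute)
qed

lemma trans_smooth:
  "c \<in> A \<Longrightarrow> d \<in> A \<Longrightarrow> smooth_on (cmap c ` (cdom c \<inter> cdom d)) (cmap d \<circ> cinv c)"
  using atlas by (simp add: smooth_atlas_def)

lemma open_overlap: "c \<in> A \<Longrightarrow> d \<in> A \<Longrightarrow> open (cmap c ` (cdom c \<inter> cdom d))"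
  using open_chart_image[of c "cdom d"] by (simp add: open_cdom Int_commute)

lemma trans_differentiable:
  assumes "c \<in> A" "d \<in> A" "p \<in> cdom c" "p \<in> cdom d"
  shows "(cmap d \<circ> cinv c) differentiable (at (cmap c p))"
  using assms by (intro smooth_on_differentiable[OF trans_smooth]) auto

lemma linear_tjac:
  assumes "c \<in> A" "d \<in> A" "p \<in> cdom c" "p \<in> cdom d"
  shows "linear (tjac c d p)"
  unfolding tjac_def by (rule linear_frechet[OF trans_differentiable[OF assms]])

lemma tjac_compose:
  assumes "c \<in> A" "d \<in> A" "e \<in> A" "p \<in> cdom c" "p \<in> cdom d" "p \<in> cdom e"
  shows "tjac d e p (tjac c d p v) = tjac c e p v"
proof -
  let ?S = "cmap c ` (cdom d \<inter> cdom c)"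
  have S: "open ?S" "cmap c p \<in> ?S" using assms open_chart_image open_cdom by auto
  have "frechet_derivative (cmap e \<circ> cinv c) (at (cmap c p))
      = frechet_derivative (\<lambda>x. (cmap e \<circ> cinv d) ((cmap d \<circ> cinv c) x)) (at (cmap c p))"
    by (rule frechet_cong_open[OF S]) (use assms in \<open>auto simp: cinv_cmap\<close>)
  moreover have "(cmap d \<circ> cinv c) (cmap c p) = cmap d p" using assms by (simp add: cinv_cmap)
  ultimately show ?thesis
    using frechet_compose[of "cmap d \<circ> cinv c" "cmap c p" "cmap e \<circ> cinv d"]
      trans_differentiable[of c d p] trans_differentiable[of d e p] assms
    by (simp add: tjac_def)
qed

lemma tjac_self:
  assumes "c \<in> A" "p \<in> cdom c"
  shows "tjac c c p v = v"
proof -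
  have "frechet_derivative (cmap c \<circ> cinv c) (at (cmap c p)) = frechet_derivative (\<lambda>x. x) (at (cmap c p))"
    by (rule frechet_cong_open[OF open_cimage[OF assms(1)]]) (use assms in \<open>auto simp: cinv_cmap\<close>)
  also have "\<dots> = (\<lambda>x. x)" by (rule frechet_eqI) simp
  finally show ?thesis by (simp add: tjac_def)
qed

lemmas chart_at = chart_at_props[OF atlas]

lemma tcoord_tjac: "tcoord A c p = tjac (chart_at A p) c p"
  by (rule ext) (simp add: tcoord_def tjac_def)

lemma tvec_tjac: "tvec A c p = tjac c (chart_at A p) p"
  by (rule ext) (simp add: tvec_def tjac_def)

lemma linear_tcoord: "c \<in> A \<Longrightarrow> p \<in> cdom c \<Longrightarrow> linear (tcoord A c p)"
  by (simp add: tcoord_tjac linear_tjac chart_at)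

lemma linear_tvec: "c \<in> A \<Longrightarrow> p \<in> cdom c \<Longrightarrow> linear (tvec A c p)"
  by (simp add: tvec_tjac linear_tjac chart_at)

lemma tcoord_tvec:
  "c \<in> A \<Longrightarrow> d \<in> A \<Longrightarrow> p \<in> cdom c \<Longrightarrow> p \<in> cdom d \<Longrightarrow> tcoord A d p (tvec A c p y) = tjac c d p y"
  by (simp add: tcoord_tjac tvec_tjac tjac_compose chart_at)

lemma tcoord_tvec_self: "c \<in> A \<Longrightarrow> p \<in> cdom c \<Longrightarrow> tcoord A c p (tvec A c p y) = y"
  by (simp add: tcoord_tvec tjac_self)

lemma tvec_tcoord: "c \<in> A \<Longrightarrow> p \<in> cdom c \<Longrightarrow> tvec A c p (tcoord A c p v) = v"
  by (simp add: tcoord_tjac tvec_tjac tjac_compose tjac_self chart_at)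

lemma tjac_tcoord:
  "c \<in> A \<Longrightarrow> d \<in> A \<Longrightarrow> p \<in> cdom c \<Longrightarrow> p \<in> cdom d \<Longrightarrow> tjac c d p (tcoord A c p v) = tcoord A d p v"
  by (simp add: tcoord_tjac tjac_compose chart_at)

lemma vf_coord_cmap: "c \<in> A \<Longrightarrow> p \<in> cdom c \<Longrightarrow> vf_coord A c X (cmap c p) = tcoord A c p (X p)"
  by (simp add: vf_coord_def cinv_cmap)

lemma tvec_vf_coord: "c \<in> A \<Longrightarrow> p \<in> cdom c \<Longrightarrow> tvec A c p (vf_coord A c X (cmap c p)) = X p"
  by (simp add: vf_coord_cmap tvec_tcoord)

lemma vf_coord_change:
  assumes "c \<in> A" "d \<in> A" "x \<in> cmap d ` (cdom c \<inter> cdom d)"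
  shows "vf_coord A d X x = frechet_derivative (cmap d \<circ> cinv c) (at ((cmap c \<circ> cinv d) x))
      (vf_coord A c X ((cmap c \<circ> cinv d) x))"
proof -
  obtain p where p: "p \<in> cdom c" "p \<in> cdom d" "x = cmap d p" using assms(3) by blast
  then show ?thesis
    using assms tjac_tcoord[of c d p "X p"] by (simp add: cinv_cmap vf_coord_cmap tjac_def)
qed

text \<open>One chart suffices: the components in another chart are the given ones, composed with a
  transition map and multiplied by the Jacobian of its inverse, both of which are smooth.\<close>

lemma smooth_vf_onI:
  assumes c: "c \<in> A" and U: "open U" "U \<subseteq> cdom c" and X: "smooth_on (cmap c ` U) (vf_coord A c X)"
  shows "smooth_vf_on A U X"
  unfolding smooth_vf_on_def
proof
  fix d assume d: "d \<in> A"
  let ?S = "cmap d ` (U \<inter> cdom d)" and ?t = "cmap c \<circ> cinv d"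
  have oS: "open ?S" by (rule open_chart_image[OF d U(1)])
  have SS: "?S \<subseteq> cmap d ` (cdom d \<inter> cdom c)" using U(2) by auto
  have t: "smooth_on ?S ?t" by (rule smooth_on_subset[OF trans_smooth[OF d c] SS])
  have tS: "?t ` ?S \<subseteq> cmap c ` U" using d U by (auto simp: cinv_cmap)
  have tS': "?t ` ?S \<subseteq> cmap c ` (cdom c \<inter> cdom d)" using d U by (auto simp: cinv_cmap)
  have oU: "open (cmap c ` U)" by (rule open_chart_image_sub[OF c U])
  have X': "smooth_on ?S (\<lambda>x. vf_coord A c X (?t x))"
    by (rule smooth_on_compose[OF oS oU tS X t])
  show "smooth_on ?S (vf_coord A d X)"
  proof (rule smooth_on_cong[OF oS])
    show "(\<Sum>b\<in>Basis. (vf_coord A c X (?t x) \<bullet> b) *\<^sub>R frechet_derivative (cmap d \<circ> cinv c) (at (?t x)) b)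
        = vf_coord A d X x" if x: "x \<in> ?S" for x
    proof -
      have "?t x \<in> cmap c ` (cdom c \<inter> cdom d)" using tS' x by blast
      then have "(cmap d \<circ> cinv c) differentiable (at (?t x))"
        by (rule smooth_on_differentiable[OF trans_smooth[OF c d]])
      moreover have "x \<in> cmap d ` (cdom c \<inter> cdom d)" using x U(2) by blast
      ultimately show ?thesis
        by (simp add: vf_coord_change[OF c d] frechet_basis_sum[symmetric])
    qed
    have "smooth_on ?S (\<lambda>x. frechet_derivative (cmap d \<circ> cinv c) (at (?t x)) b)" for b
      by (rule smooth_on_compose[OF oS open_overlap[OF c d] tS' _ t,
            of "\<lambda>y. frechet_derivative (cmap d \<circ> cinv c) (at y) b"])
         (intro smooth_on_frechet trans_smooth c d)
    then show "smooth_on ?S (\<lambda>x. \<Sum>b\<in>Basis. (vf_coord A c X (?t x) \<bullet> b) *\<^sub>R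
        frechet_derivative (cmap d \<circ> cinv c) (at (?t x)) b)"
      by (intro smooth_on_sum smooth_on_scaleR smooth_on_bilinear[OF _ bounded_bilinear_inner]
          oS smooth_on_const X')
  qed
qed

lemma smooth_vf_onI_coord:
  assumes c: "c \<in> A" and U: "open U" "U \<subseteq> cdom c" and f: "smooth_on (cmap c ` U) f"
  shows "smooth_vf_on A U (\<lambda>q. tvec A c q (f (cmap c q)))"
proof (rule smooth_vf_onI[OF c U])
  show "smooth_on (cmap c ` U) (vf_coord A c (\<lambda>q. tvec A c q (f (cmap c q))))"
    by (rule smooth_on_cong[OF open_chart_image_sub[OF c U] _ f])
      (use c U in \<open>auto simp: vf_coord_cmap tcoord_tvec_self subset_iff\<close>)
qed

lemma smooth_vf_on_const_coord:
  "c \<in> A \<Longrightarrow> smooth_vf_on A (cdom c) (\<lambda>q. tvec A c q y)"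
  using smooth_vf_onI_coord[of c "cdom c" "\<lambda>_. y"] by (simp add: open_cdom smooth_on_const)

lemma smooth_fun_onI:
  assumes c: "c \<in> A" and U: "open U" "U \<subseteq> cdom c" and f: "smooth_on (cmap c ` U) (f \<circ> cinv c)"
  shows "smooth_fun_on A U f"
  unfolding smooth_fun_on_def
proof
  fix d assume d: "d \<in> A"
  let ?S = "cmap d ` (U \<inter> cdom d)" and ?t = "cmap c \<circ> cinv d"
  have oS: "open ?S" by (rule open_chart_image[OF d U(1)])
  have SS: "?S \<subseteq> cmap d ` (cdom d \<inter> cdom c)" using U(2) by auto
  have t: "smooth_on ?S ?t" by (rule smooth_on_subset[OF trans_smooth[OF d c] SS])
  have tS: "?t ` ?S \<subseteq> cmap c ` U" using d U by (auto simp: cinv_cmap)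
  show "smooth_on ?S (f \<circ> cinv d)"
    by (rule smooth_on_cong[OF oS _ smooth_on_compose[OF oS open_chart_image_sub[OF c U] tS f t]])
      (use c d U in \<open>auto simp: cinv_cmap subset_iff\<close>)
qed

lemma smooth_vf_on_subset: "smooth_vf_on A U X \<Longrightarrow> W \<subseteq> U \<Longrightarrow> smooth_vf_on A W X"
  unfolding smooth_vf_on_def by (meson Int_mono image_mono order_refl smooth_on_subset)

lemma smooth_vf_on_coord:
  "smooth_vf_on A U X \<Longrightarrow> c \<in> A \<Longrightarrow> smooth_on (cmap c ` (U \<inter> cdom c)) (vf_coord A c X)"
  by (simp add: smooth_vf_on_def)

lemma vf_coord_differentiable:
  "smooth_vf_on A U X \<Longrightarrow> c \<in> A \<Longrightarrow> p \<in> U \<Longrightarrow> p \<in> cdom c \<Longrightarrow> vf_coord A c X differentiable (at (cmap c p))"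
  by (rule smooth_on_differentiable[OF smooth_vf_on_coord]) auto

lemma smooth_vf_on_add:
  assumes "open U" "smooth_vf_on A U X" "smooth_vf_on A U Y"
  shows "smooth_vf_on A U (\<lambda>q. X q + Y q)"
  unfolding smooth_vf_on_def
proof
  fix c assume c: "c \<in> A"
  have o: "open (cmap c ` (U \<inter> cdom c))" by (rule open_chart_image[OF c assms(1)])
  show "smooth_on (cmap c ` (U \<inter> cdom c)) (vf_coord A c (\<lambda>q. X q + Y q))"
    by (rule smooth_on_cong[OF o _ smooth_on_add[OF o smooth_vf_on_coord[OF assms(2) c]
            smooth_vf_on_coord[OF assms(3) c]]])
      (use c in \<open>auto simp: vf_coord_cmap linear_add[OF linear_tcoord]\<close>)
qed

lemma smooth_vf_on_scaleR:
  assumes "open U" "smooth_fun_on A U f" "smooth_vf_on A U Y"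
  shows "smooth_vf_on A U (\<lambda>q. f q *\<^sub>R Y q)"
  unfolding smooth_vf_on_def
proof
  fix c assume c: "c \<in> A"
  have o: "open (cmap c ` (U \<inter> cdom c))" by (rule open_chart_image[OF c assms(1)])
  have f: "smooth_on (cmap c ` (U \<inter> cdom c)) (f \<circ> cinv c)"
    using assms(2) c by (simp add: smooth_fun_on_def)
  show "smooth_on (cmap c ` (U \<inter> cdom c)) (vf_coord A c (\<lambda>q. f q *\<^sub>R Y q))"
    by (rule smooth_on_cong[OF o _ smooth_on_scaleR[OF o f smooth_vf_on_coord[OF assms(3) c]]])
      (use c in \<open>auto simp: vf_coord_cmap cinv_cmap linear_scale[OF linear_tcoord]\<close>)
qed

lemma dir_deriv_chart:
  assumes c: "c \<in> A" "p \<in> cdom c" and f: "(f \<circ> cinv c) differentiable (at (cmap c p))"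
  shows "dir_deriv A f p v = frechet_derivative (f \<circ> cinv c) (at (cmap c p)) (tcoord A c p v)"
proof -
  let ?c0 = "chart_at A p"
  let ?S = "cmap ?c0 ` (cdom c \<inter> cdom ?c0)"
  have S: "open ?S" "cmap ?c0 p \<in> ?S"
    using open_chart_image[OF chart_at(1) open_cdom[OF c(1)]] c chart_at by auto
  have "frechet_derivative (f \<circ> cinv ?c0) (at (cmap ?c0 p))
      = frechet_derivative (\<lambda>x. (f \<circ> cinv c) ((cmap c \<circ> cinv ?c0) x)) (at (cmap ?c0 p))"
    by (rule frechet_cong_open[OF S]) (use c chart_at in \<open>auto simp: cinv_cmap\<close>)
  moreover have "(cmap c \<circ> cinv ?c0) (cmap ?c0 p) = cmap c p" using chart_at by (simp add: cinv_cmap)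
  ultimately show ?thesis
    using frechet_compose[of "cmap c \<circ> cinv ?c0" "cmap ?c0 p" "f \<circ> cinv c"] f c
      trans_differentiable[OF chart_at(1) c(1) chart_at(2) c(2)]
    by (simp add: dir_deriv_def tcoord_def)
qed

end

subsection \<open>Connections in charts\<close>

locale connection = atlas A for A :: "'m::{t2_space, second_countable_topology} chart set" +
  fixes nabla :: "'m connection"
  assumes conn: "linear_connection A nabla"
begin

text \<open>The connection form as a bilinear map of components, with the direction of
  differentiation first; along a chart curve of velocity \<open>w\<close> the parallel equation
  reads \<open>v' = - Gam w v\<close>.\<close>

definition Gam :: "'m chart \<Rightarrow> 'm \<Rightarrow> real^3 \<Rightarrow> real^3 \<Rightarrow> real^3" where
  "Gam c p u y = (\<Sum>i\<in>UNIV. \<Sum>j\<in>UNIV. (u $ i * y $ j) *\<^sub>R christoffel A nabla c p i j)"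

lemma bilinear_Gam: "bilinear (Gam c p)"
  unfolding bilinear_def Gam_def
  by (auto intro!: linearI simp: sum.distrib scaleR_sum_right algebra_simps)

lemmas conn_at = conn[unfolded linear_connection_def, THEN spec, THEN mp]

lemma nabla_linear:
  assumes "open U" "smooth_vf_on A U Y" "p \<in> U"
  shows "linear (\<lambda>v. nabla p v Y)"
  using conn_at[OF assms(1), THEN conjunct1] assms(2,3) by blast

lemma nabla_add:
  assumes "open U" "smooth_vf_on A U Y" "smooth_vf_on A U Z" "p \<in> U"
  shows "nabla p v (\<lambda>q. Y q + Z q) = nabla p v Y + nabla p v Z"
  using conn_at[OF assms(1), THEN conjunct2, THEN conjunct1] assms(2-4) by blast

lemma nabla_scaleR:
  assumes "open U" "smooth_fun_on A U f" "smooth_vf_on A U Y" "p \<in> U"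
  shows "nabla p v (\<lambda>q. f q *\<^sub>R Y q) = dir_deriv A f p v *\<^sub>R Y p + f p *\<^sub>R nabla p v Y"
  using conn_at[OF assms(1), THEN conjunct2, THEN conjunct2, THEN conjunct1] assms(2-4) by blast

lemma nabla_cong:
  assumes "open U" "smooth_vf_on A U Y" "\<forall>q\<in>U. Y q = Z q" "p \<in> U"
  shows "nabla p v Y = nabla p v Z"
  using conn_at[OF assms(1), THEN conjunct2, THEN conjunct2, THEN conjunct2, THEN conjunct1] assms(2-4)
  by blast

lemma nabla_smooth:
  assumes "open U" "smooth_vf_on A U X" "smooth_vf_on A U Y"
  shows "smooth_vf_on A U (\<lambda>p. nabla p (X p) Y)"
  using conn_at[OF assms(1), THEN conjunct2, THEN conjunct2, THEN conjunct2, THEN conjunct2] assms(2,3)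
  by blast

lemma smooth_coord_field: "c \<in> A \<Longrightarrow> smooth_vf_on A (cdom c) (coord_field A c i)"
  using smooth_vf_on_const_coord[of c "axis i 1"] by (simp add: coord_field_def[abs_def])

lemma vec3_expand: "(y :: real^3) = y$1 *\<^sub>R axis 1 1 + y$2 *\<^sub>R axis 2 1 + y$3 *\<^sub>R axis 3 1"
  by (simp add: vec_eq_iff forall_3 axis_def)

lemma tvec_expand:
  assumes "c \<in> A" "p \<in> cdom c"
  shows "tvec A c p y = y$1 *\<^sub>R coord_field A c 1 p + y$2 *\<^sub>R coord_field A c 2 p + y$3 *\<^sub>R coord_field A c 3 p"
  using arg_cong[OF vec3_expand[of y], of "tvec A c p"] linear_tvec[OF assms]
  by (simp add: linear_add linear_scale coord_field_def)

lemma nabla_coord_field: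
  assumes c: "c \<in> A" "p \<in> cdom c"
  shows "tcoord A c p (nabla p v (coord_field A c j))
    = (\<Sum>i\<in>UNIV. tcoord A c p v $ i *\<^sub>R christoffel A nabla c p i j)"
proof -
  let ?w = "tcoord A c p v"
  have L: "linear (\<lambda>v. nabla p v (coord_field A c j))"
    by (rule nabla_linear[OF open_cdom smooth_coord_field]) (use c in auto)
  have v: "v = ?w$1 *\<^sub>R coord_field A c 1 p + ?w$2 *\<^sub>R coord_field A c 2 p + ?w$3 *\<^sub>R coord_field A c 3 p"
    using tvec_expand[OF c, of ?w] by (simp add: tvec_tcoord[OF c])
  have "nabla p v (coord_field A c j)
      = ?w$1 *\<^sub>R nabla p (coord_field A c 1 p) (coord_field A c j)
        + ?w$2 *\<^sub>R nabla p (coord_field A c 2 p) (coord_field A c j)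
        + ?w$3 *\<^sub>R nabla p (coord_field A c 3 p) (coord_field A c j)"
    by (subst v) (simp add: linear_add[OF L] linear_scale[OF L])
  then show ?thesis
    by (simp add: sum_3 christoffel_def linear_add[OF linear_tcoord[OF c]] linear_scale[OF linear_tcoord[OF c]])
qed

text \<open>The axioms of a connection are used for the expansion of \<open>Y\<close> in the
  coordinate fields: the Leibniz rule on each product gives the derivative of the component plus a
  Christoffel term. The expansion is valid only in the chart, so everything is restricted to
  \<open>U \<inter> cdom c\<close>, where locality of \<open>nabla\<close> identifies the two
  fields.\<close>

lemma nabla_chart:
  assumes U: "open U" "smooth_vf_on A U Y" "p \<in> U" and c: "c \<in> A" "p \<in> cdom c"
  shows "tcoord A c p (nabla p v Y) = frechet_derivative (vf_coord A c Y) (at (cmap c p)) (tcoord A c p v)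
    + Gam c p (tcoord A c p v) (vf_coord A c Y (cmap c p))"
proof -
  define W where "W = U \<inter> cdom c"
  have W: "open W" "W \<subseteq> U" "W \<subseteq> cdom c" "p \<in> W" using U c open_Int[OF U(1) open_cdom[OF c(1)]] by (auto simp: W_def)
  define f where "f j q = vf_coord A c Y (cmap c q) $ j" for j q
  define E where "E j q = f j q *\<^sub>R coord_field A c j q" for j q
  have oW: "open (cmap c ` W)" by (rule open_chart_image_sub[OF c(1) W(1,3)])
  have Yc: "smooth_on (cmap c ` W) (vf_coord A c Y)"
    using smooth_vf_on_coord[OF U(2) c(1)] by (simp add: W_def)
  have fc: "(f j \<circ> cinv c) x = vf_coord A c Y x $ j" if "x \<in> cmap c ` W" for x j
    using that W c by (auto simp: f_def cinv_cmap subset_iff)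
  have fs: "smooth_on (cmap c ` W) (f j \<circ> cinv c)" for j
    by (rule smooth_on_cong[OF oW fc[symmetric] smooth_on_vec_nth[OF oW Yc]])
  have f: "smooth_fun_on A W (f j)" for j
    by (rule smooth_fun_onI[OF c(1) W(1,3) fs])
  have cf: "smooth_vf_on A W (coord_field A c j)" for j
    by (rule smooth_vf_on_subset[OF smooth_coord_field[OF c(1)] W(3)])
  have E: "smooth_vf_on A W (E j)" for j
    using smooth_vf_on_scaleR[OF W(1) f cf] by (simp add: E_def[abs_def])
  have E12: "smooth_vf_on A W (\<lambda>q. E 1 q + E 2 q)" by (rule smooth_vf_on_add[OF W(1) E E])
  have Ysum: "\<forall>q\<in>W. E 1 q + E 2 q + E 3 q = Y q"
    using W c by (auto simp: E_def f_def tvec_expand[symmetric] tvec_vf_coord subset_iff)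
  let ?w = "tcoord A c p v"
  have px: "cmap c p \<in> cmap c ` W" using W by blast
  have df: "dir_deriv A (f j) p v = frechet_derivative (vf_coord A c Y) (at (cmap c p)) ?w $ j" for j
  proof -
    have "dir_deriv A (f j) p v = frechet_derivative (f j \<circ> cinv c) (at (cmap c p)) ?w"
      by (rule dir_deriv_chart[OF c smooth_on_differentiable[OF fs px]])
    also have "\<dots> = frechet_derivative (\<lambda>x. vf_coord A c Y x $ j) (at (cmap c p)) ?w"
      by (subst frechet_cong_open[OF oW px fc]) auto
    also have "\<dots> = frechet_derivative (vf_coord A c Y) (at (cmap c p)) ?w $ j"
      by (rule frechet_vec_nth(1)[OF smooth_on_differentiable[OF Yc px]])
    finally show ?thesis .
  qed
  have En: "tcoord A c p (nabla p v (E j)) = frechet_derivative (vf_coord A c Y) (at (cmap c p)) ?w $ j *\<^sub>R axis j 1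
      + vf_coord A c Y (cmap c p) $ j *\<^sub>R (\<Sum>i\<in>UNIV. ?w $ i *\<^sub>R christoffel A nabla c p i j)" for j
  proof -
    have "nabla p v (E j) = dir_deriv A (f j) p v *\<^sub>R coord_field A c j p + f j p *\<^sub>R nabla p v (coord_field A c j)"
      using nabla_scaleR[OF W(1) f cf W(4)] by (simp add: E_def[abs_def])
    then show ?thesis
      by (simp add: linear_add[OF linear_tcoord[OF c]] linear_scale[OF linear_tcoord[OF c]] df
          nabla_coord_field[OF c] f_def) (simp add: coord_field_def tcoord_tvec_self[OF c])
  qed
  have "nabla p v Y = nabla p v (\<lambda>q. E 1 q + E 2 q + E 3 q)"
    by (rule nabla_cong[OF W(1) _ Ysum W(4), symmetric])
      (intro smooth_vf_on_add[OF W(1)] E)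
  also have "\<dots> = nabla p v (E 1) + nabla p v (E 2) + nabla p v (E 3)"
    using nabla_add[OF W(1) E12 E W(4)] nabla_add[OF W(1) E E W(4)] by simp
  finally have "tcoord A c p (nabla p v Y) = tcoord A c p (nabla p v (E 1))
      + tcoord A c p (nabla p v (E 2)) + tcoord A c p (nabla p v (E 3))"
    by (simp add: linear_add[OF linear_tcoord[OF c]])
  also have "\<dots> = frechet_derivative (vf_coord A c Y) (at (cmap c p)) ?w
    + Gam c p ?w (vf_coord A c Y (cmap c p))"
    unfolding En by (subst (4) vec3_expand) (simp add: Gam_def sum_3 algebra_simps)
  finally show ?thesis .
qed

lemma smooth_christoffel:
  assumes c: "c \<in> A"
  shows "smooth_on (cmap c ` cdom c) (\<lambda>x. christoffel A nabla c (cinv c x) i j)"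
proof -
  have "smooth_vf_on A (cdom c) (\<lambda>p. nabla p (coord_field A c i p) (coord_field A c j))"
    by (rule nabla_smooth[OF open_cdom[OF c] smooth_coord_field[OF c] smooth_coord_field[OF c]])
  from smooth_vf_on_coord[OF this c] show ?thesis
    by (simp add: vf_coord_def[abs_def] christoffel_def)
qed

lemma smooth_Gam:
  assumes c: "c \<in> A" shows "smooth_on (cmap c ` cdom c) (\<lambda>x. Gam c (cinv c x) u y)"
  unfolding Gam_def
  by (intro smooth_on_sum smooth_on_scaleR open_cimage c smooth_on_const smooth_christoffel)

text \<open>The inhomogeneous transformation law of Christoffel symbols. It results from computing
  the covariant derivative of one field, with constant components \<open>y\<close> in
  \<open>c\<close>, in both charts; the second derivative of the transition map appears because this
  field is not constant in \<open>d\<close>.\<close>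

lemma Gam_change:
  assumes c: "c \<in> A" "p \<in> cdom c" and d: "d \<in> A" "p \<in> cdom d"
  shows "tjac c d p (Gam c p u y)
    = frechet_derivative (\<lambda>x. frechet_derivative (cmap d \<circ> cinv c) (at x) y) (at (cmap c p)) u
      + Gam d p (tjac c d p u) (tjac c d p y)"
proof -
  let ?Y = "\<lambda>q. tvec A c q y" and ?v = "tvec A c p u"
  let ?D = "\<lambda>x. frechet_derivative (cmap d \<circ> cinv c) (at x) y"
  have Y: "smooth_vf_on A (cdom c) ?Y" by (rule smooth_vf_on_const_coord[OF c(1)])
  have "frechet_derivative (vf_coord A c ?Y) (at (cmap c p)) = frechet_derivative (\<lambda>_. y) (at (cmap c p))"
    by (rule frechet_cong_open[OF open_cimage[OF c(1)]]) (use c in \<open>auto simp: vf_coord_cmap tcoord_tvec_self\<close>)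
  then have 1: "tcoord A c p (nabla p ?v ?Y) = Gam c p u y"
    using nabla_chart[OF open_cdom[OF c(1)] Y c(2) c, of ?v]
    by (simp add: tcoord_tvec_self[OF c] vf_coord_cmap[OF c] frechet_derivative_const)
  let ?S = "cmap d ` (cdom c \<inter> cdom d)"
  have S: "open ?S" "cmap d p \<in> ?S" using open_chart_image[OF d(1) open_cdom[OF c(1)]] c d by auto
  have "frechet_derivative (vf_coord A d ?Y) (at (cmap d p))
      = frechet_derivative (\<lambda>x. ?D ((cmap c \<circ> cinv d) x)) (at (cmap d p))"
    by (rule frechet_cong_open[OF S]) (use c d in \<open>auto simp: vf_coord_cmap cinv_cmap tcoord_tvec tjac_def\<close>)
  moreover have "(cmap c \<circ> cinv d) (cmap d p) = cmap c p" using d by (simp add: cinv_cmap)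
  moreover have "?D differentiable (at (cmap c p))"
    by (rule smooth_on_differentiable[OF smooth_on_frechet[OF trans_smooth[OF c(1) d(1)]]]) (use c d in auto)
  ultimately have "frechet_derivative (vf_coord A d ?Y) (at (cmap d p)) (tjac c d p u)
      = frechet_derivative ?D (at (cmap c p)) (tjac d c p (tjac c d p u))"
    using frechet_compose[of "cmap c \<circ> cinv d" "cmap d p" ?D "tjac c d p u"]
      trans_differentiable[OF d(1) c(1) d(2) c(2)] by (simp add: tjac_def)
  then have 2: "tcoord A d p (nabla p ?v ?Y)
      = frechet_derivative ?D (at (cmap c p)) u + Gam d p (tjac c d p u) (tjac c d p y)"
    using nabla_chart[OF open_cdom[OF c(1)] Y c(2) d, of ?v] c d
    by (simp add: tcoord_tvec vf_coord_cmap tjac_compose tjac_self)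
  show ?thesis
    using tjac_tcoord[OF c(1) d(1) c(2) d(2), of "nabla p ?v ?Y"] 1 2 by simp
qed

end

subsection \<open>Hessians of functions on a tangent space\<close>

definition hess :: "('a::euclidean_space \<Rightarrow> real) \<Rightarrow> 'a \<Rightarrow> 'a \<Rightarrow> 'a \<Rightarrow> real" where
  "hess E y v w = frechet_derivative (\<lambda>z. frechet_derivative E (at z) w) (at y) v"

lemma hess_symmetric: "open S \<Longrightarrow> y \<in> S \<Longrightarrow> smooth_on S E \<Longrightarrow> hess E y v w = hess E y w v"
  unfolding hess_def by (rule frechet_second_symmetric)

lemma smooth_on_hess: "smooth_on S E \<Longrightarrow> smooth_on S (\<lambda>y. hess E y v w)"
  unfolding hess_def by (intro smooth_on_frechet)

text \<open>Linearity in the outer direction is that of the derivative; linearity in the inner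
  direction is obtained from it by symmetry.\<close>

lemma bilinear_hess:
  fixes E :: "real^'n \<Rightarrow> real"
  assumes S: "open S" "y \<in> S" and E: "smooth_on S E"
  shows "hess E y v w = (\<Sum>i\<in>UNIV. \<Sum>j\<in>UNIV. v $ i * w $ j * hess E y (axis i 1) (axis j 1))"
proof -
  have 1: "hess E y v w = (\<Sum>i\<in>UNIV. v $ i * hess E y (axis i 1) w)" for v w
    unfolding hess_def
    by (subst linear_axis_sum[OF linear_frechet[OF smooth_on_differentiable[OF smooth_on_frechet[OF E] S(2)]]])
      (simp only: real_scaleR_def)
  have 2: "hess E y v w = (\<Sum>j\<in>UNIV. w $ j * hess E y v (axis j 1))" for v w
  proof -
    have "hess E y v w = (\<Sum>j\<in>UNIV. w $ j * hess E y (axis j 1) v)"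
      using hess_symmetric[OF S E, of v w] 1[of w v] by (rule trans)
    also have "\<dots> = (\<Sum>j\<in>UNIV. w $ j * hess E y v (axis j 1))"
      by (intro sum.cong refl arg_cong[where f = "\<lambda>t. w $ j * t" for j] hess_symmetric[OF S E])
    finally show ?thesis .
  qed
  have "hess E y v w = (\<Sum>i\<in>UNIV. v $ i * (\<Sum>j\<in>UNIV. w $ j * hess E y (axis i 1) (axis j 1)))"
    unfolding 1[of v w] by (simp only: 2[of _ w])
  then show ?thesis by (simp add: sum_distrib_left mult.assoc)
qed

lemma hess_linear_change:
  fixes E :: "'a::euclidean_space \<Rightarrow> real"
  assumes E: "smooth_on (-{0}) E" and L: "linear L" "inj L" and y: "y \<noteq> 0"
  shows "hess (\<lambda>z. E (L z)) y v w = hess E (L y) (L v) (L w)"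
proof -
  have L0: "L z \<noteq> 0" if "z \<noteq> 0" for z using L that by (metis linear_0 injD)
  have dL: "L differentiable (at z)" "frechet_derivative L (at z) = L" for z
    using linear_imp_has_derivative[OF L(1), of "at z"] frechet_eqI by (auto simp: differentiable_def)
  have dE: "E differentiable (at (L z))" if "z \<noteq> 0" for z
    using smooth_on_differentiable[OF E] L0[OF that] by simp
  have dE': "(\<lambda>z. frechet_derivative E (at z) u) differentiable (at (L z))" if "z \<noteq> 0" for z u
    using smooth_on_differentiable[OF smooth_on_frechet[OF E]] L0[OF that] by simp
  have "hess (\<lambda>z. E (L z)) y v w
      = frechet_derivative (\<lambda>z. frechet_derivative E (at (L z)) (L w)) (at y) v"
    unfolding hess_def
    by (subst frechet_cong_open[of "-{0}" y "\<lambda>z. frechet_derivative (\<lambda>z. E (L z)) (at z) w"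
          "\<lambda>z. frechet_derivative E (at (L z)) (L w)"])
      (use y frechet_compose[OF dL(1) dE] in \<open>auto simp: dL\<close>)
  also have "\<dots> = hess E (L y) (L v) (L w)"
    unfolding hess_def using frechet_compose[OF dL(1) dE'[OF y]] by (simp add: dL)
  finally show ?thesis .
qed

text \<open>Every matrix on the segment from the identity to \<open>G\<close> is positive definite,
  hence invertible. The determinant starts at 1 and never vanishes along the segment, so by the
  intermediate value theorem it ends positive.\<close>

lemma det_pos_def:
  fixes G :: "real^'n^'n"
  assumes "\<And>v. v \<noteq> 0 \<Longrightarrow> v \<bullet> (G *v v) > 0"
  shows "det G > 0"
proof (rule ccontr)
  assume neg: "\<not> det G > 0"
  define H where "H t = (1 - t) *\<^sub>R mat 1 + t *\<^sub>R G" for t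
  have nz: "det (H t) \<noteq> 0" if "0 \<le> t" "t \<le> 1" for t
  proof -
    have "H t *v v \<noteq> 0" if v: "v \<noteq> 0" for v
    proof -
      have "v \<bullet> (H t *v v) = (1 - t) * (v \<bullet> v) + t * (v \<bullet> (G *v v))"
        by (simp add: H_def matrix_vector_mult_add_rdistrib scaleR_matrix_vector_assoc[symmetric]
            inner_add_right)
      also have "\<dots> > 0"
      proof (cases "t = 0")
        case False
        then have "t * (v \<bullet> (G *v v)) > 0" using assms[OF v] \<open>0 \<le> t\<close> by simp
        moreover have "(1 - t) * (v \<bullet> v) \<ge> 0" using \<open>t \<le> 1\<close> by simp
        ultimately show ?thesis by linarith
      qed (use v in simp)
      finally show ?thesis by auto
    qed
    then have "invertible (H t)"
      unfolding invertible_left_inverse matrix_left_invertible_ker by auto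
    then show ?thesis by (simp add: invertible_det_nz)
  qed
  have cont: "continuous_on {0..1} (\<lambda>t. det (H t))"
    unfolding H_def det_def by (intro continuous_intros)
  have "det (H 0) = 1" "det (H 1) = det G" by (simp_all add: H_def)
  then obtain t where "0 \<le> t" "t \<le> 1" "det (H t) = 0"
    using IVT2'[of "\<lambda>t. det (H t)" 1 0 0] cont neg by auto
  with nz show False by blast
qed

subsection \<open>Change of variables for real-valued integrals\<close>

text \<open>\<open>has_absolute_integral_change_of_variables\<close> concerns vector-valued
  integrands; a real function is embedded as a multiple of the unit vector of \<open>real^1\<close>
  and recovered as its component.\<close>

lemma integral_change_of_variables_real_valued:
  fixes h :: "real^'n::{finite,wellorder} \<Rightarrow> real"
  assumes S: "S \<in> sets lebesgue"
    and d: "\<And>x. x \<in> S \<Longrightarrow> (g has_derivative g' x) (at x within S)"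
    and inj: "inj_on g S"
    and i: "(\<lambda>x. \<bar>det (matrix (g' x))\<bar> * h (g x)) absolutely_integrable_on S"
  shows "h absolutely_integrable_on g ` S"
    "integral (g ` S) h = integral S (\<lambda>x. \<bar>det (matrix (g' x))\<bar> * h (g x))"
proof -
  let ?e = "axis 1 1 :: real^1"
  let ?f = "\<lambda>y. h y *\<^sub>R ?e"
  have bl: "bounded_linear (\<lambda>t. t *\<^sub>R ?e)" by (rule bounded_linear_scaleR_left)
  have eq: "(\<lambda>x. \<bar>det (matrix (g' x))\<bar> *\<^sub>R ?f (g x))
      = (\<lambda>t. t *\<^sub>R ?e) \<circ> (\<lambda>x. \<bar>det (matrix (g' x))\<bar> * h (g x))" by auto
  have 1: "(\<lambda>x. \<bar>det (matrix (g' x))\<bar> *\<^sub>R ?f (g x)) absolutely_integrable_on S"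
    unfolding eq by (rule absolutely_integrable_linear[OF i bl])
  then have *: "?f absolutely_integrable_on g ` S"
    "integral (g ` S) ?f = integral S (\<lambda>x. \<bar>det (matrix (g' x))\<bar> *\<^sub>R ?f (g x))"
    using has_absolute_integral_change_of_variables[OF S d inj, of ?f] by blast+
  have c: "(\<lambda>v. v $ 1) \<circ> ?f = h" by (simp add: fun_eq_iff axis_def)
  show h: "h absolutely_integrable_on g ` S"
    using absolutely_integrable_linear[OF *(1) bounded_linear_vec_nth[of 1]] by (simp add: c)
  have "integral (g ` S) h = integral (g ` S) ?f $ 1"
    using integral_linear[OF _ bounded_linear_vec_nth[of 1], of ?f "g ` S"] *(1) c
    by (simp add: absolutely_integrable_on_def)
  also have "\<dots> = integral S (\<lambda>x. \<bar>det (matrix (g' x))\<bar> *\<^sub>R ?f (g x)) $ 1" by (simp add: *(2))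
  also have "\<dots> = integral S ((\<lambda>v. v $ 1) \<circ> (\<lambda>x. \<bar>det (matrix (g' x))\<bar> *\<^sub>R ?f (g x)))"
    using integral_linear[OF _ bounded_linear_vec_nth[of 1], of "\<lambda>x. \<bar>det (matrix (g' x))\<bar> *\<^sub>R ?f (g x)" S] 1
    by (simp add: absolutely_integrable_on_def)
  finally show "integral (g ` S) h = integral S (\<lambda>x. \<bar>det (matrix (g' x))\<bar> * h (g x))"
    by (simp add: o_def axis_def)
qed

text \<open>Passing from \<open>real^3\<close> to nested pairs preserves volumes of boxes. It
  connects the change of variables, which needs \<open>real^3\<close>, with Fubini, which needs
  products.\<close>

lemma integral_vec3_triple:
  fixes f :: "real \<times> real \<times> real \<Rightarrow> real"
  assumes "f integrable_on cbox (a1, a2, a3) (b1, b2, b3)"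
  shows "integral (cbox (vector [a1, a2, a3]) (vector [b1, b2, b3]) :: (real^3) set)
      (\<lambda>x. f (x $ 1, x $ 2, x $ 3)) = integral (cbox (a1, a2, a3) (b1, b2, b3)) f"
proof -
  define g where "g x = (x $ 1, x $ 2, x $ 3)" for x :: "real^3"
  define h where "h = (\<lambda>(a, b, c). vector [a, b, c] :: real^3)"
  have hg: "h (g x) = x" for x by (simp add: h_def g_def vec_eq_iff forall_3)
  have gh: "g (h x) = x" for x by (simp add: h_def g_def split_beta)
  have hc: "h ` cbox u v = cbox (h u) (h v)" for u v
  proof -
    have "x \<in> cbox (h u) (h v) \<longleftrightarrow> g x \<in> cbox u v" for x
      by (cases u; cases v) (simp add: mem_box_cart h_def g_def forall_3 cbox_Pair_eq)
    then show ?thesis using hg gh by (auto simp: image_iff) metis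
  qed
  have gc: "g ` cbox u v = cbox (g u) (g v)" for u v
    using hc[of "g u" "g v"] hg gh by (metis (no_types, lifting) image_image image_cong image_ident)
  have cont: "measure lborel (g ` cbox u v) = 1 * measure lborel (cbox u v)" for u v
  proof (cases "cbox u v = {}")
    case False
    then have "u $ 1 \<le> v $ 1" "u $ 2 \<le> v $ 2" "u $ 3 \<le> v $ 3"
      by (auto simp: interval_ne_empty_cart)
    moreover have "(\<Prod>i\<in>UNIV. v $ i - u $ i) = (v $ 1 - u $ 1) * ((v $ 2 - u $ 2) * (v $ 3 - u $ 3))"
      unfolding UNIV_3 by simp
    ultimately show ?thesis
      unfolding gc content_cbox_cart[OF False] by (simp add: g_def content_Pair)
  qed simp
  have "((\<lambda>x. f (g x)) has_integral (1 / 1) *\<^sub>R integral (cbox (a1, a2, a3) (b1, b2, b3)) f)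
      (h ` cbox (a1, a2, a3) (b1, b2, b3))"
  proof (rule has_integral_twiddle[OF zero_less_one hg gh _ _ _ cont])
    show "continuous (at x) g" for x unfolding g_def by (intro continuous_intros)
    show "\<exists>w z. g ` cbox u v = cbox w z" for u v using gc by blast
    show "\<exists>w z. h ` cbox u v = cbox w z" for u v using hc by blast
    show "(f has_integral integral (cbox (a1, a2, a3) (b1, b2, b3)) f) (cbox (a1, a2, a3) (b1, b2, b3))"
      by (rule integrable_integral[OF assms])
  qed
  then show ?thesis
    unfolding hc by (simp add: h_def g_def integral_unique)
qed

subsection \<open>The averaged scalar product of a Minkowski norm\<close>

lemma frechet_cmult:
  fixes f :: "'a::real_normed_vector \<Rightarrow> real"
  assumes "f differentiable (at x)"
  shows "frechet_derivative (\<lambda>x. c * f x) (at x) v = c * frechet_derivative f (at x) v"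
  using frechet_eqI[OF has_derivative_mult_right[OF has_derivative_frechet[OF assms]], of c] by simp

lemma hess_cmult:
  assumes S: "open S" "y \<in> S" and E: "smooth_on S E"
  shows "hess (\<lambda>z. c * E z) y v w = c * hess E y v w"
proof -
  have "hess (\<lambda>z. c * E z) y v w = frechet_derivative (\<lambda>z. c * frechet_derivative E (at z) w) (at y) v"
    unfolding hess_def
    by (subst frechet_cong_open[OF S, of _ "\<lambda>z. c * frechet_derivative E (at z) w"])
      (auto simp: frechet_cmult[OF smooth_on_differentiable[OF E]])
  then show ?thesis
    unfolding hess_def by (simp add: frechet_cmult[OF smooth_on_differentiable[OF smooth_on_frechet[OF E] S(2)]])
qed

definition avg_form :: "(real^3 \<Rightarrow> real) \<Rightarrow> real^3 \<Rightarrow> real^3 \<Rightarrow> real" where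
  "avg_form N v w = (\<Sum>i\<in>UNIV. \<Sum>j\<in>UNIV.
     v $ i * w $ j * indicatrix_integral N (\<lambda>y. fund_tensor N y $ i $ j))"

lemma avg_metric_form: "avg_metric F p = avg_form (F p)"
  by (intro ext) (simp add: avg_metric_def avg_form_def)

lemma bilinear_avg_form: "bilinear (avg_form N)"
  unfolding bilinear_def avg_form_def
  by (auto intro!: linearI simp: sum.distrib sum_distrib_left algebra_simps)

locale minkowski =
  fixes N :: "real^3 \<Rightarrow> real"
  assumes nonneg: "0 \<le> N y"
    and hom: "t > 0 \<Longrightarrow> N (t *\<^sub>R y) = t * N y"
    and smooth: "smooth_on (- {0}) N"
    and posdef: "y \<noteq> 0 \<Longrightarrow> v \<noteq> 0 \<Longrightarrow> v \<bullet> (fund_tensor N y *v v) > 0"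
begin

lemma open_nz: "open (- {0} :: (real^3) set)" by auto

lemma smooth_energy: "smooth_on (- {0}) (energy N)"
proof -
  have "energy N = (\<lambda>y. (1/2) * (N y * N y))" by (simp add: energy_def fun_eq_iff power2_eq_square)
  then show ?thesis
    by (simp only:) (intro smooth_on_bilinear[OF open_nz bounded_bilinear_mult] smooth_on_const smooth)
qed

lemma fund_tensor_hess: "fund_tensor N y $ i $ j = hess (energy N) y (axis i 1) (axis j 1)"
  by (simp add: fund_tensor_def hess_def partial_def[abs_def])

lemma fund_tensor_quad: "y \<noteq> 0 \<Longrightarrow> v \<bullet> (fund_tensor N y *v w) = hess (energy N) y v w"
  by (subst bilinear_hess[OF open_nz _ smooth_energy])
    (auto simp: inner_vec_def matrix_vector_mult_def fund_tensor_hess sum_distrib_left algebra_simps)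

lemma energy_hom: "t > 0 \<Longrightarrow> energy N (t *\<^sub>R y) = t\<^sup>2 * energy N y"
  by (simp add: energy_def hom power_mult_distrib)

text \<open>The Hessian of \<open>z \<mapsto> E (t z) = t^2 * E z\<close> is computed in two ways,
  by the linear change of variable and by pulling out the scalar; the factor \<open>t^2\<close>
  cancels.\<close>

lemma hess_hom:
  assumes "t > 0" "y \<noteq> 0"
  shows "hess (energy N) (t *\<^sub>R y) v w = hess (energy N) y v w"
proof -
  have y: "y \<in> - {0}" "t *\<^sub>R y \<in> - {0}" using assms by auto
  have "hess (\<lambda>z. energy N (t *\<^sub>R z)) y v w = hess (energy N) (t *\<^sub>R y) (t *\<^sub>R v) (t *\<^sub>R w)"
    using assms by (intro hess_linear_change smooth_energy) (auto simp: inj_on_def)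
  also have "\<dots> = t\<^sup>2 * hess (energy N) (t *\<^sub>R y) v w"
    by (subst (1 2) bilinear_hess[OF open_nz y(2) smooth_energy])
      (simp add: sum_distrib_left power2_eq_square algebra_simps)
  finally have "hess (\<lambda>z. t\<^sup>2 * energy N z) y v w = t\<^sup>2 * hess (energy N) (t *\<^sub>R y) v w"
    using assms(1) by (simp add: energy_hom)
  then show ?thesis
    using assms(1) by (simp add: hess_cmult[OF open_nz y(1) smooth_energy])
qed

lemma fund_tensor_hom: "t > 0 \<Longrightarrow> y \<noteq> 0 \<Longrightarrow> fund_tensor N (t *\<^sub>R y) = fund_tensor N y"
  by (simp add: vec_eq_iff fund_tensor_hess hess_hom)

text \<open>Only \<open>0 \<le> N\<close> is assumed. Differentiating
  \<open>E (y + s y) = (1 + s)^2 * E y\<close> twice at \<open>s = 0\<close> shows that the Hessian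
  at \<open>y\<close>, evaluated on \<open>y\<close> twice, is \<open>2 * E y = (N y)^2\<close>, and
  positive definiteness makes this positive.\<close>

lemma pos:
  assumes y: "y \<noteq> 0" shows "N y > 0"
proof -
  let ?g = "\<lambda>z. frechet_derivative (energy N) (at z) y"
  have nz: "y + s *\<^sub>R y \<noteq> 0" if "s > -1" for s
  proof -
    have "y + s *\<^sub>R y = (1 + s) *\<^sub>R y" by (simp add: algebra_simps)
    then show ?thesis using y that by simp
  qed
  have 1: "?g (y + s *\<^sub>R y) = 2 * (1 + s) * energy N y" if s: "s > -1" for s
  proof -
    have "((\<lambda>s. energy N (y + s *\<^sub>R y)) has_vector_derivative ?g (y + s *\<^sub>R y)) (at s)"
      by (intro differentiable_line smooth_on_differentiable[OF smooth_energy]) (use nz[OF s] in auto)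
    moreover have "((\<lambda>s. energy N (y + s *\<^sub>R y)) has_vector_derivative 2 * (1 + s) * energy N y) (at s)"
    \<comment> \<open>For \<open>s > -1\<close> the scaling factor \<open>1 + s\<close> is positive,
      so positive homogeneity applies.\<close>
    proof (rule has_vector_derivative_transform_within_open[where S="{-1<..}"])
      show "((\<lambda>s. (1 + s)\<^sup>2 * energy N y) has_vector_derivative 2 * (1 + s) * energy N y) (at s)"
        unfolding has_real_derivative_iff_has_vector_derivative[symmetric]
        by (auto intro!: derivative_eq_intros)
      show "(1 + r)\<^sup>2 * energy N y = energy N (y + r *\<^sub>R y)" if "r \<in> {-1<..}" for r
        using energy_hom[of "1 + r" y] that by (simp add: algebra_simps)
    qed (use s in auto)
    ultimately show ?thesis by (rule vector_derivative_unique_at)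
  qed
  have "((\<lambda>s. ?g (y + s *\<^sub>R y)) has_vector_derivative frechet_derivative ?g (at (y + 0 *\<^sub>R y)) y) (at 0)"
    by (intro differentiable_line smooth_on_differentiable[OF smooth_on_frechet[OF smooth_energy]]) (use y in auto)
  moreover have "((\<lambda>s. ?g (y + s *\<^sub>R y)) has_vector_derivative 2 * energy N y) (at 0)"
  proof (rule has_vector_derivative_transform_within_open[where S="{-1<..}"])
    show "((\<lambda>s. 2 * (1 + s) * energy N y) has_vector_derivative 2 * energy N y) (at 0)"
      unfolding has_real_derivative_iff_has_vector_derivative[symmetric]
      by (auto intro!: derivative_eq_intros)
  qed (use 1 in auto)
  ultimately have "hess (energy N) y y y = 2 * energy N y"
    unfolding hess_def by (simp add: vector_derivative_unique_at)
  then have "(N y)\<^sup>2 > 0" using posdef[OF y y] fund_tensor_quad[OF y, of y y] by (simp add: energy_def)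
  then show ?thesis using nonneg[of y] by (simp add: less_le)
qed

lemma zero: "N 0 = 0"
  using hom[of 2 0] by simp

lemma det_fund_tensor: "y \<noteq> 0 \<Longrightarrow> det (fund_tensor N y) > 0"
  by (rule det_pos_def) (rule posdef)

lemma continuous_fund_tensor: "continuous_on (- {0}) (\<lambda>y. fund_tensor N y $ i $ j)"
  unfolding fund_tensor_hess by (intro smooth_on_continuous smooth_on_hess smooth_energy)

lemma continuous_det: "continuous_on (- {0}) (\<lambda>y. det (fund_tensor N y))"
  unfolding det_def by (intro continuous_intros continuous_fund_tensor)

text \<open>The integrand of the average together with the metric weight of the volume form. It is
  homogeneous of degree 0, which is what allows the integral to be moved from the indicatrix to the
  sphere and to the unit body.\<close>

definition avg_density :: "real^3 \<Rightarrow> real^3 \<Rightarrow> real^3 \<Rightarrow> real" where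
  "avg_density v w y = (v \<bullet> (fund_tensor N y *v w)) * sqrt (det (fund_tensor N y))"

lemma avg_density_sum: "avg_density v w y = (\<Sum>i\<in>UNIV. \<Sum>j\<in>UNIV. v $ i * w $ j *
    (fund_tensor N y $ i $ j * sqrt (det (fund_tensor N y))))"
  by (simp add: avg_density_def inner_vec_def matrix_vector_mult_def sum_distrib_left sum_distrib_right algebra_simps)

lemma continuous_avg_density: "continuous_on (- {0}) (avg_density v w)"
  unfolding avg_density_sum by (intro continuous_intros continuous_fund_tensor continuous_det)

lemma avg_density_hom: "t > 0 \<Longrightarrow> y \<noteq> 0 \<Longrightarrow> avg_density v w (t *\<^sub>R y) = avg_density v w y"
  by (simp add: avg_density_def fund_tensor_hom)

lemma sph_nz: "sph z \<noteq> 0"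
  using norm_sph[of z] by auto

lemma continuous_sph: "continuous_on S sph"
proof -
  have "isCont sph z" for z
    by (cases z) (use sph_has_derivative has_derivative_continuous in blast)
  then show ?thesis by (simp add: continuous_at_imp_continuous_on)
qed

lemma continuous_compose_sph: "continuous_on (- {0}) f \<Longrightarrow> continuous_on S (\<lambda>z. f (sph z))"
  by (rule continuous_on_compose2[OF _ continuous_sph]) (auto simp: sph_nz)

lemma continuous_sph_density: "continuous_on S (\<lambda>z. sin (fst z) / N (sph z) ^ 3)"
proof -
  have "N (sph z) \<noteq> 0" for z using pos[OF sph_nz[of z]] by simp
  then show ?thesis
    by (intro continuous_intros continuous_compose_sph smooth_on_continuous[OF smooth]) auto
qed

lemma ind_param_nz: "ind_param N z \<noteq> 0"
  using pos[OF sph_nz[of z]] sph_nz[of z] by (simp add: ind_param_def)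

text \<open>The pulled back volume form is given by \<open>ind_vol_pullback\<close>, and homogeneity
  of degree 0 moves the fundamental tensor from the indicatrix to the unit sphere.\<close>

lemma indicatrix_integral_sph:
  "indicatrix_integral N (\<lambda>y. fund_tensor N y $ i $ j) = integral (cbox (0, 0) (pi, 2 * pi))
    (\<lambda>z. fund_tensor N (sph z) $ i $ j * sqrt (det (fund_tensor N (sph z))) * (sin (fst z) / N (sph z) ^ 3))"
  unfolding indicatrix_integral_def
proof (rule integral_cong)
  fix z :: "real \<times> real"
  have diff: "y \<noteq> 0 \<Longrightarrow> N differentiable (at y)" for y using smooth_on_differentiable[OF smooth] by simp
  have "fund_tensor N (ind_param N z) = fund_tensor N (sph z)"
    unfolding ind_param_def using pos[OF sph_nz] by (intro fund_tensor_hom sph_nz) auto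
  then show "fund_tensor N (ind_param N z) $ i $ j *
        ind_vol N (ind_param N z)
          (frechet_derivative (ind_param N) (at z) (1, 0))
          (frechet_derivative (ind_param N) (at z) (0, 1)) =
      fund_tensor N (sph z) $ i $ j * sqrt (det (fund_tensor N (sph z))) * (sin (fst z) / N (sph z) ^ 3)"
    using ind_vol_pullback[OF hom pos diff, of "fst z" "snd z"] by simp
qed

lemma avg_form_sph:
  "avg_form N v w = integral (cbox (0, 0) (pi, 2 * pi)) (\<lambda>z. avg_density v w (sph z) * (sin (fst z) / N (sph z) ^ 3))"
proof -
  define k where "k i j z = fund_tensor N (sph z) $ i $ j * sqrt (det (fund_tensor N (sph z)))
      * (sin (fst z) / N (sph z) ^ 3)" for i j z
  let ?B = "cbox (0, 0) (pi, 2 * pi) :: (real \<times> real) set"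
  have "continuous_on ?B (k i j)" for i j
    unfolding k_def
    by (intro continuous_intros continuous_sph_density continuous_compose_sph[of "\<lambda>y. fund_tensor N y $ i $ j"]
        continuous_compose_sph[of "\<lambda>y. det (fund_tensor N y)"] continuous_fund_tensor continuous_det)
  then have ik: "(\<lambda>z. c * k i j z) integrable_on ?B" for c i j
    by (intro integrable_on_mult_right integrable_continuous)
  have "integral ?B (\<lambda>z. avg_density v w (sph z) * (sin (fst z) / N (sph z) ^ 3))
      = integral ?B (\<lambda>z. \<Sum>i\<in>UNIV. \<Sum>j\<in>UNIV. v $ i * w $ j * k i j z)"
    by (rule integral_cong) (simp add: avg_density_sum k_def sum_distrib_right sum_divide_distrib mult.assoc)
  also have "\<dots> = (\<Sum>i\<in>UNIV. \<Sum>j\<in>UNIV. v $ i * w $ j * integral ?B (k i j))"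
    by (simp add: integral_sum integrable_sum ik)
  finally show ?thesis by (simp add: avg_form_def indicatrix_integral_sph k_def[abs_def])
qed

lemma avg_form_symmetric: "avg_form N v w = avg_form N w v"
proof -
  have "avg_density v w (sph z) = avg_density w v (sph z)" for z
    unfolding avg_density_def fund_tensor_quad[OF sph_nz] by (simp add: hess_symmetric[OF open_nz _ smooth_energy] sph_nz)
  then show ?thesis by (simp add: avg_form_sph)
qed

lemma avg_form_pos:
  assumes v: "v \<noteq> 0" shows "avg_form N v v > 0"
proof -
  let ?B = "cbox (0, 0) (pi, 2 * pi) :: (real \<times> real) set"
  let ?k = "\<lambda>z. avg_density v v (sph z) * (sin (fst z) / N (sph z) ^ 3)"
  have c: "continuous_on ?B ?k"
    by (intro continuous_intros continuous_sph_density continuous_compose_sph continuous_avg_density)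
  have avg_density: "avg_density v v (sph z) > 0" for z
    unfolding avg_density_def using posdef[OF sph_nz v] det_fund_tensor[OF sph_nz] by simp
  have k: "0 \<le> ?k z" if "z \<in> ?B" for z
    using that avg_density[of z] pos[OF sph_nz[of z]] by (cases z) (auto simp: cbox_Pair_eq sin_ge_zero intro!: mult_nonneg_nonneg divide_nonneg_nonneg)
  have "integral ?B ?k \<ge> 0" by (rule integral_nonneg[OF integrable_continuous[OF c] k])
  moreover have "integral ?B ?k \<noteq> 0"
  proof
    assume 0: "integral ?B ?k = 0"
    \<comment> \<open>A vanishing integral of a continuous nonnegative function forces zeros
      everywhere. The point is taken on the equator, where the factor \<open>sin\<close> is 1; at
      the poles the integrand does vanish.\<close>
    have "?k (pi / 2, pi) = 0"
    proof (rule has_integral_0_cbox_imp_0[OF c])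
      show "(?k has_integral 0) ?B" using integrable_integral[OF integrable_continuous[OF c]] 0 by simp
      show "box (0, 0) (pi, 2 * pi) \<noteq> ({} :: (real \<times> real) set)"
        by (simp add: box_ne_empty Basis_prod_def)
      show "0 \<le> ?k x" if "x \<in> box (0, 0) (pi, 2 * pi)" for x
        using k that box_subset_cbox by blast
    qed (simp add: cbox_Pair_eq)
    moreover have "?k (pi / 2, pi) > 0"
      using avg_density[of "(pi / 2, pi)"] pos[OF sph_nz[of "(pi / 2, pi)"]] by simp
    ultimately show False by linarith
  qed
  ultimately show ?thesis by (simp add: avg_form_sph)
qed

end

section \<open>Polar coordinates on the unit body\<close>

context minkowski begin

text \<open>The origin is excluded because \<open>N\<close> is smooth only away from it; the set
  remains open, and linear isometries map bodies onto bodies.\<close>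

definition body :: "(real^3) set" where "body = {y. y \<noteq> 0 \<and> N y < 1}"

text \<open>Polar coordinates adapted to \<open>N\<close>: the radius is the value of
  \<open>N\<close>, so that the body corresponds to a box up to a null set.\<close>

definition polar :: "real^3 \<Rightarrow> real^3" where "polar x = x $ 1 *\<^sub>R ind_param N (x $ 2, x $ 3)"

lemma open_body: "open body"
proof -
  have "open ((- {0}) \<inter> N -` {..<1})"
    using iffD1[OF continuous_on_open_vimage[OF open_nz] smooth_on_continuous[OF smooth], rule_format, of "{..<1}"]
    by (simp add: Int_commute)
  moreover have "(- {0}) \<inter> N -` {..<1} = body" by (auto simp: body_def)
  ultimately show ?thesis by simp
qed

lemma N_ind_param: "N (ind_param N z) = 1"
  using pos[OF sph_nz[of z]] by (simp add: ind_param_def hom)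

text \<open>The determinant with rows \<open>y\<close>, \<open>a\<close>, \<open>b\<close>; on the
  indicatrix, \<open>ind_vol\<close> is this determinant times the metric weight.\<close>

definition det3 :: "real^3 \<Rightarrow> real^3 \<Rightarrow> real^3 \<Rightarrow> real" where
  "det3 y a b = y$1 * (a$2 * b$3 - a$3 * b$2) - y$2 * (a$1 * b$3 - a$3 * b$1) + y$3 * (a$1 * b$2 - a$2 * b$1)"

lemma ind_param_differentiable: "ind_param N differentiable (at z)"
proof -
  obtain d where d: "(sph has_derivative d) (at z)" using sph_has_derivative[of "fst z" "snd z"] by auto
  then have s: "sph differentiable (at z)" by (auto simp: differentiable_def)
  then have "(\<lambda>z. N (sph z)) differentiable (at z)"
    using differentiable_chain_at[of sph z N] smooth_on_differentiable[OF smooth, of "sph z"] sph_nz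
    by (simp add: o_def)
  then have "(\<lambda>z. 1 / N (sph z)) differentiable (at z)"
    using pos[OF sph_nz[of z]] by (intro differentiable_divide) auto
  then have "(\<lambda>z. (1 / N (sph z)) *\<^sub>R sph z) differentiable (at z)"
    using s by (intro differentiable_scaleR)
  then show ?thesis by (simp add: ind_param_def[abs_def])
qed

text \<open>No new computation of the Jacobian is made: the nonzero factor
  \<open>sqrt (det g)\<close> is cancelled from \<open>ind_vol_pullback\<close>.\<close>

lemma det3_ind_param:
  "det3 (ind_param N (a, b)) (frechet_derivative (ind_param N) (at (a, b)) (1, 0))
    (frechet_derivative (ind_param N) (at (a, b)) (0, 1)) = sin a / N (sph (a, b)) ^ 3"
proof -
  let ?y = "ind_param N (a, b)"
  have "y \<noteq> 0 \<Longrightarrow> N differentiable (at y)" for y using smooth_on_differentiable[OF smooth] by simp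
  note pb = ind_vol_pullback[OF hom pos this, of a b]
  have "ind_vol N ?y u v = sqrt (det (fund_tensor N ?y)) * det3 ?y u v" for u v
    by (simp add: ind_vol_def det3_def N_ind_param)
  moreover have "sqrt (det (fund_tensor N ?y)) \<noteq> 0" using det_fund_tensor[OF ind_param_nz[of "(a, b)"]] by simp
  ultimately show ?thesis using pb mult_left_cancel by metis
qed

definition polar_deriv :: "real^3 \<Rightarrow> real^3 \<Rightarrow> real^3" where
  "polar_deriv x e = e $ 1 *\<^sub>R ind_param N (x $ 2, x $ 3)
    + x $ 1 *\<^sub>R frechet_derivative (ind_param N) (at (x $ 2, x $ 3)) (e $ 2, e $ 3)"

lemma polar_has_derivative: "(polar has_derivative polar_deriv x) (at x within S)"
proof -
  have p: "((\<lambda>x. (x $ 2, x $ 3)) has_derivative (\<lambda>e. (e $ 2, e $ 3))) (at x within S)"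
    by (intro has_derivative_Pair bounded_linear_imp_has_derivative bounded_linear_vec_nth)
  have q: "((\<lambda>x. ind_param N (x $ 2, x $ 3)) has_derivative
      (\<lambda>e. frechet_derivative (ind_param N) (at (x $ 2, x $ 3)) (e $ 2, e $ 3))) (at x within S)"
    by (rule has_derivative_compose[OF p has_derivative_frechet[OF ind_param_differentiable]])
  have "((\<lambda>x. x $ 1 *\<^sub>R ind_param N (x $ 2, x $ 3)) has_derivative
      (\<lambda>e. x $ 1 *\<^sub>R frechet_derivative (ind_param N) (at (x $ 2, x $ 3)) (e $ 2, e $ 3)
        + e $ 1 *\<^sub>R ind_param N (x $ 2, x $ 3))) (at x within S)"
    by (rule has_derivative_scaleR[OF bounded_linear_imp_has_derivative[OF bounded_linear_vec_nth] q])
  then show ?thesis by (simp add: polar_def[abs_def] polar_deriv_def[abs_def] add.commute)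
qed

lemma det_polar_deriv: "det (matrix (polar_deriv x)) = (x $ 1)\<^sup>2 * (sin (x $ 2) / N (sph (x $ 2, x $ 3)) ^ 3)"
proof -
  let ?z = "(x $ 2, x $ 3)"
  let ?D = "frechet_derivative (ind_param N) (at ?z)"
  have "?D (0, 0) = 0"
    using linear_0[OF linear_frechet[OF ind_param_differentiable]] by (metis zero_prod_def)
  then have "polar_deriv x (axis 1 1) = ind_param N ?z" "polar_deriv x (axis 2 1) = x $ 1 *\<^sub>R ?D (1, 0)"
    "polar_deriv x (axis 3 1) = x $ 1 *\<^sub>R ?D (0, 1)"
    by (simp_all add: polar_deriv_def axis_def)
  then have "det (matrix (polar_deriv x)) = (x $ 1)\<^sup>2 * det3 (ind_param N ?z) (?D (1, 0)) (?D (0, 1))"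
    by (simp add: det_3 matrix_def det3_def power2_eq_square algebra_simps)
  then show ?thesis by (simp add: det3_ind_param)
qed

definition polar_box :: "(real^3) set" where "polar_box = box (vector [0, 0, 0]) (vector [1, pi, 2 * pi])"

lemma mem_polar_box: "x \<in> polar_box \<longleftrightarrow> 0 < x$1 \<and> x$1 < 1 \<and> 0 < x$2 \<and> x$2 < pi \<and> 0 < x$3 \<and> x$3 < 2 * pi"
  by (auto simp: polar_box_def mem_box_cart forall_3)

lemma N_polar: "0 < x $ 1 \<Longrightarrow> N (polar x) = x $ 1"
  by (simp add: polar_def hom N_ind_param)

lemma sph_inj:
  assumes "sph (a, b) = sph (a', b')" "0 < a" "a < pi" "0 < b" "b < 2 * pi" "0 < a'" "a' < pi" "0 < b'" "b' < 2 * pi"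
  shows "a = a'" "b = b'"
proof -
  have e: "sin a * cos b = sin a' * cos b'" "sin a * sin b = sin a' * sin b'" "cos a = cos a'"
    using assms(1) by (auto simp: sph_def vec_eq_iff forall_3)
  show a: "a = a'" using e(3) assms cos_inj_pi[of a a'] by auto
  have "sin a > 0" using assms by (intro sin_gt_zero)
  then have "cos b = cos b'" "sin b = sin b'" using e a by auto
  then have "cos (b - b') = 1" using sin_cos_squared_add[of b'] by (simp add: cos_diff power2_eq_square)
  then obtain n :: int where n: "b - b' = real_of_int n * 2 * pi" using cos_one_2pi_int by blast
  have "\<bar>b - b'\<bar> < 2 * pi" using assms by linarith
  then have "\<bar>real_of_int n\<bar> < 1" unfolding n by (simp add: abs_mult)
  then have "n = 0" by linarith
  then show "b = b'" using n by simp
qed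

lemma sph_of_ind_param: "sph z = (1 / norm (ind_param N z)) *\<^sub>R ind_param N z"
proof -
  have "norm (ind_param N z) = 1 / N (sph z)"
    using pos[OF sph_nz[of z]] by (simp add: ind_param_def norm_sph)
  then show ?thesis using pos[OF sph_nz[of z]] by (simp add: ind_param_def)
qed

text \<open>\<open>N\<close> recovers the radius, and normalising a point of the indicatrix recovers
  the point of the sphere and with it the two angles.\<close>

lemma inj_on_polar: "inj_on polar polar_box"
proof (rule inj_onI)
  fix x y assume x: "x \<in> polar_box" and y: "y \<in> polar_box" and e: "polar x = polar y"
  have r: "x $ 1 = y $ 1" using N_polar[of x] N_polar[of y] e x y by (simp add: mem_polar_box)
  then have "ind_param N (x $ 2, x $ 3) = ind_param N (y $ 2, y $ 3)"
    using e x by (simp add: polar_def mem_polar_box)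
  then have "sph (x $ 2, x $ 3) = sph (y $ 2, y $ 3)" by (metis sph_of_ind_param)
  from sph_inj[OF this] x y r show "x = y" by (simp add: mem_polar_box vec_eq_iff forall_3)
qed

lemma polar_image_subset: "polar ` polar_box \<subseteq> body"
proof
  fix y assume "y \<in> polar ` polar_box"
  then obtain x where x: "x \<in> polar_box" "y = polar x" by blast
  then have "N y = x $ 1" "x $ 1 \<in> {0<..<1}" using N_polar[of x] by (auto simp: mem_polar_box)
  then show "y \<in> body" using zero by (auto simp: body_def)
qed

text \<open>The open box misses the poles and the half plane of longitude 0, all contained in the
  null set \<open>y $ 2 = 0\<close>.\<close>

lemma body_diff_polar: "body - polar ` polar_box \<subseteq> {y. y $ 2 = 0}"
proof
  fix y assume y: "y \<in> body - polar ` polar_box"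
  show "y \<in> {y. y $ 2 = 0}"
  proof (rule ccontr)
    assume y2: "y \<notin> {y. y $ 2 = 0}"
    have y0: "y \<noteq> 0" "N y < 1" using y by (auto simp: body_def)
    let ?u = "(1 / norm y) *\<^sub>R y"
    have "norm ?u = 1" using y0 by simp
    then have "?u \<in> sph ` cbox (0, 0) (pi, 2 * pi)" unfolding sph_image by blast
    then obtain a b where ab: "(a, b) \<in> cbox (0, 0) (pi, 2 * pi)" "sph (a, b) = ?u"
      by (metis imageE surj_pair)
    have "sin a * sin b = y $ 2 / norm y"
      using arg_cong[OF ab(2), of "\<lambda>v. v $ 2"] by (simp add: sph_def)
    then have nz: "sin a \<noteq> 0" "sin b \<noteq> 0" using y2 y0 by auto
    have "a \<noteq> 0" "a \<noteq> pi" "b \<noteq> 0" "b \<noteq> 2 * pi" using nz by auto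
    then have rng: "0 < a" "a < pi" "0 < b" "b < 2 * pi"
      using ab(1) by (auto simp: cbox_Pair_eq)
    define x :: "real^3" where "x = vector [N y, a, b]"
    have "x \<in> polar_box" using rng pos[OF y0(1)] y0(2) by (simp add: x_def mem_polar_box)
    moreover have "polar x = y"
      using pos[OF y0(1)] y0 by (simp add: polar_def x_def ind_param_def ab(2) hom)
    ultimately show False using y by blast
  qed
qed

text \<open>Homogeneity of degree 0 makes the transformed integrand a product of \<open>r^2\<close>
  and a function of the angles; the radial integral contributes the factor 1/3.\<close>

lemma polar_integral:
  assumes h: "continuous_on (- {0}) h" and hh: "\<And>t y. t > 0 \<Longrightarrow> y \<noteq> 0 \<Longrightarrow> h (t *\<^sub>R y) = h y"
  shows "h absolutely_integrable_on body"
    "integral body h = (1/3) * integral (cbox (0, 0) (pi, 2 * pi)) (\<lambda>z. h (sph z) * (sin (fst z) / N (sph z) ^ 3))"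
proof -
  let ?k = "\<lambda>z. h (sph z) * (sin (fst z) / N (sph z) ^ 3)"
  let ?f = "\<lambda>(r, z). r\<^sup>2 * ?k z" and ?c = "\<lambda>x. (x $ 1, x $ 2, x $ 3)"
  let ?C = "cbox (vector [0, 0, 0]) (vector [1, pi, 2 * pi]) :: (real^3) set"
  have ck: "continuous_on S ?k" for S
    by (intro continuous_intros continuous_sph_density continuous_compose_sph h)
  have cf: "continuous_on S ?f" for S
    unfolding split_beta by (intro continuous_intros continuous_on_compose2[OF ck[of UNIV]]) auto
  have cfc: "continuous_on ?C (\<lambda>x. ?f (?c x))"
    by (rule continuous_on_compose2[OF cf[of UNIV]]) (auto intro!: continuous_intros)
  have eq: "\<bar>det (matrix (polar_deriv x))\<bar> * h (polar x) = ?f (?c x)" if "x \<in> polar_box" for x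
  proof -
    let ?z = "(x $ 2, x $ 3)"
    have "h (polar x) = h ((x $ 1 * (1 / N (sph ?z))) *\<^sub>R sph ?z)"
      by (simp add: polar_def ind_param_def)
    also have "\<dots> = h (sph ?z)"
      using that pos[OF sph_nz[of ?z]] by (intro hh sph_nz) (simp add: mem_polar_box)
    finally have "h (polar x) = h (sph ?z)" .
    moreover have "det (matrix (polar_deriv x)) \<ge> 0"
      unfolding det_polar_deriv using that pos[OF sph_nz[of ?z]]
      by (intro mult_nonneg_nonneg divide_nonneg_nonneg) (auto simp: mem_polar_box intro: sin_ge_zero)
    ultimately show ?thesis by (simp only: abs_of_nonneg) (simp add: det_polar_deriv)
  qed
  have "(\<lambda>x. ?f (?c x)) absolutely_integrable_on polar_box"
    unfolding polar_box_def absolutely_integrable_on_open_interval by (rule absolutely_integrable_continuous[OF cfc])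
  then have ai: "(\<lambda>x. \<bar>det (matrix (polar_deriv x))\<bar> * h (polar x)) absolutely_integrable_on polar_box"
    by (rule absolutely_integrable_spike[OF _ negligible_empty]) (use eq in auto)
  have S: "polar_box \<in> sets lebesgue" by (simp add: polar_box_def)
  note cov = integral_change_of_variables_real_valued[OF S polar_has_derivative inj_on_polar ai]
  have "negligible {y :: real^3. y $ 2 = 0}"
    using negligible_hyperplane[of "axis 2 1 :: real^3" 0] by (simp add: inner_axis' axis_eq_0_iff)
  then have neg: "negligible (body - polar ` polar_box)" by (rule negligible_subset[OF _ body_diff_polar])
  have neg': "negligible {x \<in> polar ` polar_box - body. h x \<noteq> 0}"
    by (rule negligible_subset[OF negligible_empty]) (use polar_image_subset in auto)
  have neg'': "negligible {x \<in> body - polar ` polar_box. h x \<noteq> 0}"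
    by (rule negligible_subset[OF neg]) auto
  show "h absolutely_integrable_on body"
    using absolutely_integrable_spike_set_eq[OF neg' neg''] cov(1) by blast
  have "integral body h = integral (polar ` polar_box) h"
    using integral_spike_set[OF neg' neg''] by simp
  also have "\<dots> = integral polar_box (\<lambda>x. ?f (?c x))"
    unfolding cov(2) by (rule integral_cong) (rule eq)
  also have "\<dots> = integral ?C (\<lambda>x. ?f (?c x))"
    by (simp add: polar_box_def integral_open_interval)
  also have "\<dots> = integral (cbox (0, 0, 0) (1, pi, 2 * pi)) ?f"
    by (rule integral_vec3_triple[OF integrable_continuous[OF cf]])
  also have "\<dots> = integral (cbox 0 1) (\<lambda>r. integral (cbox (0, 0) (pi, 2 * pi)) (\<lambda>z. r\<^sup>2 * ?k z))"
    by (subst integral_prod_continuous[OF cf]) simp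
  also have "\<dots> = integral {0..1} (\<lambda>r. r\<^sup>2 * integral (cbox (0, 0) (pi, 2 * pi)) ?k)"
    by (simp only: integral_mult_right cbox_interval)
  also have "\<dots> = integral {0..1} (\<lambda>r :: real. r\<^sup>2) * integral (cbox (0, 0) (pi, 2 * pi)) ?k"
    by (rule integral_mult_left)
  also have "integral {0..1} (\<lambda>r :: real. r\<^sup>2) = 1/3"
  proof -
    have "((\<lambda>r :: real. r\<^sup>2) has_integral (1 ^ 3 / 3 - 0 ^ 3 / 3)) {0..1}"
      by (rule fundamental_theorem_of_calculus)
        (auto intro!: derivative_eq_intros simp: has_real_derivative_iff_has_vector_derivative[symmetric])
    then show ?thesis by (simp add: integral_unique)
  qed
  finally show "integral body h = (1/3) * integral (cbox (0, 0) (pi, 2 * pi)) ?k" .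
qed

text \<open>This form of the average involves neither angles nor a surface, so a linear map can be
  substituted directly.\<close>

lemma avg_form_body:
  "avg_density v w absolutely_integrable_on body" "avg_form N v w = 3 * integral body (avg_density v w)"
proof -
  note p = polar_integral[OF continuous_avg_density, of v w]
  show "avg_density v w absolutely_integrable_on body" by (rule p(1)) (rule avg_density_hom)
  have "integral body (avg_density v w) = (1/3) * avg_form N v w"
    unfolding avg_form_sph by (rule p(2)) (rule avg_density_hom)
  then show "avg_form N v w = 3 * integral body (avg_density v w)" by simp
qed

end

subsection \<open>Invariance under linear isometries\<close>

text \<open>With \<open>M\<close> the matrix of \<open>L\<close>, the fundamental tensors are
  related by \<open>g = transpose M ** g' ** M\<close>. Hence \<open>sqrt (det g)\<close> is
  \<open>\<bar>det M\<bar>\<close> times \<open>sqrt (det g')\<close>, which is the Jacobian factor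
  for the substitution that carries one body onto the other.\<close>

lemma avg_form_isometry:
  assumes N: "minkowski N" "minkowski N'" and L: "linear L" "inj L"
    and iso: "\<And>v. N' (L v) = N v"
  shows "avg_form N' (L v) (L w) = avg_form N v w"
proof -
  interpret N: minkowski N by fact
  interpret N': minkowski N' by fact
  let ?M = "matrix L"
  have L0: "L y = 0 \<longleftrightarrow> y = 0" for y using L by (metis injD linear_0)
  have Mv: "?M *v a = L a" for a
    by (rule matrix_works) (use L linear_matrix_vector_mul_eq in blast)
  have surj: "surj L" using L linear_injective_imp_surjective by blast
  have "energy N = (\<lambda>z. energy N' (L z))" by (simp add: energy_def fun_eq_iff iso)
  then have h: "hess (energy N) y a b = hess (energy N') (L y) (L a) (L b)" if "y \<noteq> 0" for y a b
    using hess_linear_change[OF N'.smooth_energy L that] by simp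
  have f: "fund_tensor N y = transpose ?M ** fund_tensor N' (L y) ** ?M" if y: "y \<noteq> 0" for y
  proof -
    have "a \<bullet> (fund_tensor N y *v b) = a \<bullet> ((transpose ?M ** fund_tensor N' (L y) ** ?M) *v b)" for a b
    proof -
      have "a \<bullet> (fund_tensor N y *v b) = (?M *v a) \<bullet> (fund_tensor N' (L y) *v (?M *v b))"
        using h[OF y, of a b] y by (simp add: N.fund_tensor_quad N'.fund_tensor_quad L0 Mv)
      moreover have "a \<bullet> (transpose ?M *v u) = (?M *v a) \<bullet> u" for u
        by (metis dot_lmul_matrix vector_transpose_matrix)
      ultimately show ?thesis by (simp add: matrix_vector_mul_assoc[symmetric])
    qed
    then have "fund_tensor N y *v b = (transpose ?M ** fund_tensor N' (L y) ** ?M) *v b" for b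
      using vector_eq_ldot by blast
    then show ?thesis by (simp add: matrix_eq)
  qed
  have g: "\<bar>det ?M\<bar> * N'.avg_density (L v) (L w) (L y) = N.avg_density v w y" if "y \<noteq> 0" for y
  proof -
    have "det (fund_tensor N y) = (det ?M)\<^sup>2 * det (fund_tensor N' (L y))"
      by (simp add: f[OF that] det_mul power2_eq_square)
    then have "sqrt (det (fund_tensor N y)) = \<bar>det ?M\<bar> * sqrt (det (fund_tensor N' (L y)))"
      by (simp add: real_sqrt_mult)
    then show ?thesis
      using h[OF that] that by (simp add: N.avg_density_def N'.avg_density_def N.fund_tensor_quad N'.fund_tensor_quad L0)
  qed
  have B: "L ` N.body = N'.body"
  proof
    show "N'.body \<subseteq> L ` N.body"
    proof
      fix y assume y: "y \<in> N'.body"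
      obtain x where "y = L x" using surj by (metis surjD)
      then show "y \<in> L ` N.body" using y L0 iso by (auto simp: N.body_def N'.body_def)
    qed
  qed (auto simp: N.body_def N'.body_def L0 iso)
  have ai: "(\<lambda>y. \<bar>det ?M\<bar> * N'.avg_density (L v) (L w) (L y)) absolutely_integrable_on N.body"
    by (rule absolutely_integrable_spike[OF N.avg_form_body(1)[of v w] negligible_empty])
      (auto simp: g N.body_def)
  have "integral N'.body (N'.avg_density (L v) (L w)) = integral N.body (\<lambda>y. \<bar>det ?M\<bar> * N'.avg_density (L v) (L w) (L y))"
    unfolding B[symmetric]
    by (rule integral_change_of_variables_real_valued(2)[OF _ linear_imp_has_derivative[OF L(1)] _ ai])
      (use N.open_body L in \<open>auto intro: inj_on_subset\<close>)
  also have "\<dots> = integral N.body (N.avg_density v w)"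
    by (rule integral_cong) (simp add: g N.body_def)
  finally show ?thesis by (simp add: N.avg_form_body(2) N'.avg_form_body(2))
qed

text \<open>The inverse \<open>K\<close> is carried along explicitly, which makes symmetry and
  composition immediate and conjugation of endomorphisms easy to write.\<close>

definition isometry :: "(real^3 \<Rightarrow> real) \<Rightarrow> (real^3 \<Rightarrow> real) \<Rightarrow> (real^3 \<Rightarrow> real^3) \<Rightarrow> (real^3 \<Rightarrow> real^3) \<Rightarrow> bool" where
  "isometry N N' L K \<longleftrightarrow> linear L \<and> linear K \<and> (\<forall>v. K (L v) = v) \<and> (\<forall>v. L (K v) = v) \<and> (\<forall>v. N' (L v) = N v)"

subsection \<open>Parallel transport along straight segments of a chart\<close>

locale finsler_connection = connection A nabla
  for A :: "'m::{t2_space, second_countable_topology} chart set" and nabla :: "'m connection" +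
  fixes F :: "'m \<Rightarrow> real^3 \<Rightarrow> real"
  assumes finsler: "finsler_metric A F" and compat: "compatible A F nabla"
begin

text \<open>In the chart \<open>chart_at A p\<close> the map \<open>tvec\<close> is the identity at
  \<open>p\<close>, so the local expression of the Finsler metric over \<open>p\<close> is
  \<open>F p\<close> itself.\<close>

lemma minkowski_F: "minkowski (F p)"
proof -
  let ?c = "chart_at A p" and ?x = "cmap (chart_at A p) p"
  have c: "?c \<in> A" "p \<in> cdom ?c" by (rule chart_at)+
  then have x: "?x \<in> cmap ?c ` cdom ?c" by blast
  have eq: "(\<lambda>u. finsler_coord A F ?c (?x, u)) = F p"
    using c tcoord_chart_at(2)[OF atlas, of p] by (simp add: finsler_coord_def cinv_cmap fun_eq_iff)
  have F: "smooth_on ((cmap ?c ` cdom ?c) \<times> (- {0})) (finsler_coord A F ?c)"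
    "\<And>y v. y \<noteq> 0 \<Longrightarrow> v \<noteq> 0 \<Longrightarrow>
        v \<bullet> (fund_tensor (\<lambda>u. finsler_coord A F ?c (?x, u)) y *v v) > 0"
    using finsler c x by (auto simp: finsler_metric_def)
  have g: "smooth_on (- {0}) (\<lambda>u. (?x, u) :: (real^3) \<times> (real^3))"
  proof -
    have "smooth_on (- {0}) (\<lambda>u. (?x, 0) + (0, u) :: (real^3) \<times> (real^3))"
      by (intro smooth_on_add smooth_on_const smooth_on_linear bounded_linear_intros) auto
    then show ?thesis by simp
  qed
  have "open ((cmap ?c ` cdom ?c) \<times> (- {0 :: real^3}))"
    using open_cimage[OF c(1)] by (intro open_Times) auto
  then have "smooth_on (- {0}) (\<lambda>u. finsler_coord A F ?c (?x, u))"
    by (intro smooth_on_compose[OF _ _ _ F(1) g]) (use x in auto)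
  then show ?thesis
    using finsler F(2) unfolding eq by unfold_locales (auto simp: finsler_metric_def)
qed

text \<open>The parallel equation is given in the single chart \<open>c\<close>, whereas
  \<open>parallel_along\<close> demands it in every chart of the atlas that the curve meets;
  \<open>Gam_change\<close> supplies the passage between them.\<close>

lemma transport_segment:
  assumes c: "c \<in> A" and seg: "\<And>t. t \<in> {0..1} \<Longrightarrow> z + t *\<^sub>R w \<in> cmap c ` cdom c"
    and v: "\<And>t. t \<in> {0..1} \<Longrightarrow>
      (v has_vector_derivative - Gam c (cinv c (z + t *\<^sub>R w)) w (v t)) (at t within {0..1})"
  shows "F (cinv c (z + w)) (tvec A c (cinv c (z + w)) (v 1)) = F (cinv c z) (tvec A c (cinv c z) (v 0))"
proof -
  define l where "l t = z + t *\<^sub>R w" for t :: real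
  \<comment> \<open>Compatibility is stated for curves smooth on an open set around the interval;
    the straight line stays in the chart on this open neighbourhood of [0,1].\<close>
  define S where "S = l -` (cmap c ` cdom c)"
  define s where "s t = cinv c (l t)" for t
  define V where "V t = tvec A c (s t) (v t)" for t
  have cl: "continuous_on T l" for T unfolding l_def by (intro continuous_intros)
  have ol: "open (l -` T)" if "open T" for T
    using open_vimage[OF that] cl by blast
  have oS: "open S" unfolding S_def by (rule ol[OF open_cimage[OF c]])
  have S: "{0..1} \<subseteq> S" using seg by (auto simp: S_def l_def)
  have sc: "s t \<in> cdom c" "cmap c (s t) = l t" if "t \<in> S" for t
    using that by (auto simp: s_def S_def cinv_in cmap_cinv)
  have sm: "smooth_on T l" if "open T" for T
    unfolding l_def using that
    by (intro smooth_on_add smooth_on_const smooth_on_linear bounded_linear_intros)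
  have "smooth_curve_on A S s"
    unfolding smooth_curve_on_def
  proof (intro conjI ballI)
    show "continuous_on S s"
      unfolding s_def by (rule continuous_on_compose2[OF continuous_cinv[OF c] cl]) (auto simp: S_def)
    fix d assume d: "d \<in> A"
    let ?T = "cmap c ` (cdom c \<inter> cdom d)"
    have eq: "S \<inter> s -` cdom d = l -` ?T"
    proof (intro equalityI subsetI)
      fix t assume t: "t \<in> S \<inter> s -` cdom d"
      then have "l t = cmap c (s t)" "s t \<in> cdom c \<inter> cdom d" using sc by auto
      then show "t \<in> l -` ?T" by blast
    qed (auto simp: S_def s_def cinv_cmap c)
    have oT: "open (l -` ?T)" by (rule ol[OF open_overlap[OF c d]])
    show "smooth_on (S \<inter> s -` cdom d) (cmap d \<circ> s)"
      unfolding eq using smooth_on_compose[OF oT open_overlap[OF c d] _ trans_smooth[OF c d] sm[OF oT]]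
      by (simp add: o_def s_def)
  qed
  moreover have "parallel_along A nabla 0 1 s V"
    unfolding parallel_along_def
  proof (intro ballI impI)
    fix t :: real and d assume t: "t \<in> {0..1}" and d: "d \<in> A" and std: "s t \<in> cdom d"
    let ?T = "cmap c ` (cdom c \<inter> cdom d)" and ?tau = "cmap d \<circ> cinv c"
    \<comment> \<open>\<open>J\<close> is the Jacobian of the transition map and \<open>H\<close>
      its derivative, that is the second derivative. The components in \<open>d\<close> are
      \<open>J (l r) (v r)\<close>, differentiated below as a sum of products over the
      basis.\<close>
    define J where "J x = frechet_derivative ?tau (at x)" for x
    define H where "H y = frechet_derivative (\<lambda>x. J x y) (at (l t))" for y
    have tS: "t \<in> S" using t S by blast
    have lt: "l t \<in> ?T" using sc[OF tS] std by force
    have oT: "open ?T" by (rule open_overlap[OF c d])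
    note tau = trans_smooth[OF c d]
    have Jd: "(\<lambda>x. J x y) differentiable (at (l t))" for y
      unfolding J_def by (rule smooth_on_differentiable[OF smooth_on_frechet[OF tau] lt])
    have Hsym: "H y u = H u y" for y u
      unfolding H_def J_def by (rule frechet_second_symmetric_vec[OF oT lt tau])
    have coord: "tcoord A d (s r) (V r) = J (l r) (v r)" if "r \<in> l -` ?T" for r
    proof -
      have r: "r \<in> S" using that by (auto simp: S_def)
      have "s r \<in> cdom d" using that by (auto simp: s_def cinv_cmap c)
      then show ?thesis
        using sc[OF r] c d by (simp add: V_def tcoord_tvec tjac_def J_def)
    qed
    have Jt: "J (l t) = tjac c d (s t)" using sc[OF tS] by (simp add: tjac_def J_def)
    have expand: "J (l r) (v r) = (\<Sum>b\<in>Basis. (v r \<bullet> b) *\<^sub>R J (l r) b)" if "r \<in> l -` ?T" for r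
      unfolding J_def by (rule frechet_basis_sum[OF smooth_on_differentiable[OF tau]]) (use that in auto)
    let ?v' = "- Gam c (s t) w (v t)"
    have dv: "(v has_vector_derivative ?v') (at t within {0..1})" using v[OF t] by (simp add: s_def l_def)
    have dJ: "((\<lambda>r. J (l r) b) has_vector_derivative H b w) (at t within {0..1})" for b
      using differentiable_line[of "\<lambda>x. J x b" z t w] Jd[of b] has_vector_derivative_at_within
      by (simp add: H_def l_def)
    have "((\<lambda>r. \<Sum>b\<in>Basis. (v r \<bullet> b) *\<^sub>R J (l r) b) has_vector_derivative
        (\<Sum>b\<in>Basis. (v t \<bullet> b) *\<^sub>R H b w + (?v' \<bullet> b) *\<^sub>R J (l t) b)) (at t within {0..1})"
      using bounded_linear.has_vector_derivative[OF bounded_linear_inner_left dv] dJ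
      by (intro has_vector_derivative_sum has_vector_derivative_scaleR)
        (simp_all add: has_real_derivative_iff_has_vector_derivative)
    also have "(\<Sum>b\<in>Basis. (v t \<bullet> b) *\<^sub>R H b w + (?v' \<bullet> b) *\<^sub>R J (l t) b) = H w (v t) + J (l t) ?v'"
    proof -
      have "H w (v t) = (\<Sum>b\<in>Basis. (v t \<bullet> b) *\<^sub>R H b w)"
        using frechet_basis_sum[OF Jd[of w], of "v t"] by (simp add: H_def[symmetric] Hsym[of w])
      moreover have "J (l t) ?v' = (\<Sum>b\<in>Basis. (?v' \<bullet> b) *\<^sub>R J (l t) b)"
        unfolding J_def by (rule frechet_basis_sum[OF smooth_on_differentiable[OF tau lt]])
      ultimately show ?thesis by (simp only: sum.distrib)
    qed
    finally have D: "((\<lambda>r. \<Sum>b\<in>Basis. (v r \<bullet> b) *\<^sub>R J (l r) b) has_vector_derivative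
        H w (v t) + J (l t) ?v') (at t within {0..1})" .
    obtain e where e: "e > 0" "ball t e \<subseteq> l -` ?T"
      using ol[OF oT] lt by (meson openE vimageI)
    have 1: "((\<lambda>r. tcoord A d (s r) (V r)) has_vector_derivative H w (v t) + J (l t) ?v') (at t within {0..1})"
    proof (rule has_vector_derivative_transform_within[OF D e(1) t])
      fix r assume "r \<in> {0..1}" "dist r t < e"
      then have "r \<in> l -` ?T" using e(2) by (auto simp: dist_commute subset_iff)
      then show "(\<Sum>b\<in>Basis. (v r \<bullet> b) *\<^sub>R J (l r) b) = tcoord A d (s r) (V r)"
        using coord expand by simp
    qed
    have "((\<lambda>r. ?tau (z + r *\<^sub>R w)) has_vector_derivative J (l t) w) (at t)"
      unfolding J_def l_def
      by (rule differentiable_line) (use smooth_on_differentiable[OF tau lt] in \<open>simp only: l_def\<close>)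
    then have 2: "vector_derivative (cmap d \<circ> s) (at t) = J (l t) w"
      by (intro vector_derivative_at) (simp add: o_def s_def l_def)
    have 3: "J (l t) (Gam c (s t) w (v t)) = H (v t) w + Gam d (s t) (J (l t) w) (J (l t) (v t))"
      using Gam_change[OF c sc(1)[OF tS] d std, of w "v t"] sc(2)[OF tS]
      unfolding Jt unfolding H_def J_def by simp
    have "linear (J (l t))" unfolding Jt by (rule linear_tjac[OF c d sc(1)[OF tS] std])
    then have "J (l t) ?v' = - J (l t) (Gam c (s t) w (v t))" by (simp add: linear_neg)
    \<comment> \<open>The term produced by differentiating the Jacobian along the curve cancels the
      inhomogeneous term in the transformation law of the Christoffel symbols.\<close>
    then have 4: "H w (v t) + J (l t) ?v' = - Gam d (s t) (J (l t) w) (J (l t) (v t))"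
      using 3 Hsym[of w "v t"] by simp
    have 5: "tcoord A d (s t) (V t) = J (l t) (v t)" by (rule coord) (use lt in auto)
    show "((\<lambda>r. tcoord A d (s r) (V r)) has_vector_derivative
        - (\<Sum>i\<in>UNIV. \<Sum>j\<in>UNIV.
             (vector_derivative (cmap d \<circ> s) (at t) $ i * tcoord A d (s t) (V t) $ j)
               *\<^sub>R christoffel A nabla d (s t) i j)) (at t within {0..1})"
      using 1[unfolded 4] unfolding 2 5 Gam_def .
  qed
  ultimately have "F (s 1) (V 1) = F (s 0) (V 0)"
    using compat[unfolded compatible_def, rule_format, of S 0 1 s V] oS S by auto
  then show ?thesis by (simp add: V_def s_def l_def)
qed

end

text \<open>For small \<open>u\<close> the map \<open>Q u\<close> differs from the identity by at
  most half the norm, hence is injective and, in finite dimension, bijective. To first order the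
  inverse of \<open>id + B u\<close> is \<open>id - B u\<close>.\<close>

lemma near_identity_inverse:
  fixes Q :: "'a::euclidean_space \<Rightarrow> 'a \<Rightarrow> 'a"
  assumes B: "bilinear B" and d: "d > 0" and Q: "\<And>u. norm u < d \<Longrightarrow> linear (Q u)"
    and est: "\<And>e. e > 0 \<Longrightarrow> \<exists>d'>0. \<forall>u. norm u < d' \<longrightarrow> (\<forall>y. norm (Q u y - y - B u y) \<le> e * norm u * norm y)"
  obtains d' P where "d' > 0" "d' \<le> d"
    "\<And>u. norm u < d' \<Longrightarrow> linear (P u)"
    "\<And>u y. norm u < d' \<Longrightarrow> Q u (P u y) = y" "\<And>u y. norm u < d' \<Longrightarrow> P u (Q u y) = y"
    "\<And>y. ((\<lambda>u. Q u y) has_derivative (\<lambda>u. B u y)) (at 0)"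
    "\<And>y. ((\<lambda>u. P u y) has_derivative (\<lambda>u. - B u y)) (at 0)"
    "\<And>y. Q 0 y = y" "\<And>y. P 0 y = y"
proof -
  obtain C where C: "C > 0" "\<And>u y. norm (B u y) \<le> C * norm u * norm y"
    using bilinear_bounded_pos[OF B] by (metis mult.assoc)
  obtain d1 where d1: "d1 > 0" "\<And>u y. norm u < d1 \<Longrightarrow> norm (Q u y - y - B u y) \<le> 1 * norm u * norm y"
    using est[of 1] by auto
  \<comment> \<open>\<open>C\<close> bounds \<open>B\<close>, and the additional 1 accounts for the
    remainder with \<open>e = 1\<close>; the last bound makes \<open>(C + 1) * norm u\<close> at
    most 1/2.\<close>
  define d' where "d' = min d (min d1 (1 / (2 * (C + 1))))"
  have d': "d' > 0" "d' \<le> d" using d d1 C by (auto simp: d'_def)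
  have Qy: "norm (Q u y - y) \<le> (C + 1) * norm u * norm y" if "norm u < d'" for u y
  proof -
    have "norm (Q u y - y) \<le> norm (Q u y - y - B u y) + norm (B u y)"
      using norm_triangle_ineq[of "Q u y - y - B u y" "B u y"] by simp
    also have "\<dots> \<le> 1 * norm u * norm y + C * norm u * norm y"
      using d1(2)[of u y] C(2)[of u y] that by (intro add_mono) (auto simp: d'_def)
    finally show ?thesis by (simp add: algebra_simps)
  qed
  have half: "(C + 1) * norm u \<le> 1 / 2" if "norm u < d'" for u :: 'a
  proof -
    have "norm u \<le> 1 / (2 * (C + 1))" using that by (simp add: d'_def)
    then have "(C + 1) * norm u \<le> (C + 1) * (1 / (2 * (C + 1)))"
      using C by (intro mult_left_mono) auto
    also have "\<dots> = 1 / 2"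
    proof -
      have "C + 1 \<noteq> 0" using C by simp
      then show ?thesis by (simp add: divide_simps)
    qed
    finally show ?thesis .
  qed
  have Qhalf: "norm (Q u y - y) \<le> 1 / 2 * norm y" if "norm u < d'" for u y
    using Qy[OF that, of y] mult_right_mono[OF half[OF that], of "norm y"] by simp
  have "inj (Q u)" if u: "norm u < d'" for u
  proof -
    have l: "linear (Q u)" using Q u d' by simp
    have "y = 0" if "Q u y = 0" for y using Qhalf[OF u, of y] that by simp
    then show ?thesis using linear_injective_0[OF l] by blast
  qed
  then have "\<exists>P. linear P \<and> (\<forall>y. P (Q u y) = y) \<and> (\<forall>y. Q u (P y) = y)" if "norm u < d'" for u
    using linear_injective_isomorphism[of "Q u"] Q[of u] that d' by auto
  then have "\<exists>P. \<forall>u. norm u < d' \<longrightarrow> linear (P u) \<and> (\<forall>y. P u (Q u y) = y) \<and> (\<forall>y. Q u (P u y) = y)"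
    using choice[of "\<lambda>u P. norm u < d' \<longrightarrow> linear P \<and> (\<forall>y. P (Q u y) = y) \<and> (\<forall>y. Q u (P y) = y)"] by blast
  then obtain P where P: "\<And>u. norm u < d' \<Longrightarrow> linear (P u)"
    "\<And>u y. norm u < d' \<Longrightarrow> Q u (P u y) = y" "\<And>u y. norm u < d' \<Longrightarrow> P u (Q u y) = y" by blast
  have Q0: "Q 0 y = y" for y
    using d1(2)[of 0 y] d1(1) by (simp add: bilinear_lzero[OF B])
  have P0: "P 0 y = y" for y using P(3)[of 0 y] d'(1) by (simp add: Q0)
  have blB: "bounded_linear (\<lambda>u. B u y)" for y
    using B by (simp add: bilinear_def linear_conv_bounded_linear)
  have dQ: "((\<lambda>u. Q u y) has_derivative (\<lambda>u. B u y)) (at 0)" for y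
    unfolding has_derivative_at_alt
  proof (intro conjI blB allI impI)
    fix e :: real assume e: "e > 0"
    then have "e / (norm y + 1) > 0" by (simp add: add_nonneg_pos)
    from est[OF this] obtain d2 where d2: "d2 > 0"
      "\<And>u. norm u < d2 \<Longrightarrow> norm (Q u y - y - B u y) \<le> e / (norm y + 1) * norm u * norm y" by blast
    have "norm (Q u y - Q 0 y - B (u - 0) y) \<le> e * norm (u - 0)" if "norm (u - 0) < d2" for u
    proof -
      have "norm (Q u y - y - B u y) \<le> (e * norm u) * (norm y / (norm y + 1))" using d2(2)[of u] that by simp
      also have "\<dots> \<le> (e * norm u) * 1"
        using e by (intro mult_left_mono) (auto simp: divide_le_eq add_nonneg_pos)
      finally show ?thesis by (simp add: Q0)
    qed
    with d2(1) show "\<exists>d>0. \<forall>u. norm (u - 0) < d \<longrightarrow> norm (Q u y - Q 0 y - B (u - 0) y) \<le> e * norm (u - 0)"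
      by blast
  qed
  have dP: "((\<lambda>u. P u y) has_derivative (\<lambda>u. - B u y)) (at 0)" for y
    unfolding has_derivative_at_alt
  proof (intro conjI bounded_linear_minus blB allI impI)
    fix e :: real assume e: "e > 0"
    define n where "n = norm y + 1"
    have n: "n > 0" "norm y \<le> n" by (auto simp: n_def add_nonneg_pos)
    have "e / (4 * n) > 0" using e n by simp
    from est[OF this] obtain d2 where d2: "d2 > 0"
      "\<And>u z. norm u < d2 \<Longrightarrow> norm (Q u z - z - B u z) \<le> e / (4 * n) * norm u * norm z" by blast
    \<comment> \<open>Two errors of at most \<open>e / 2 * norm u\<close> are allowed: the remainder
      of \<open>Q\<close>, controlled by \<open>d2\<close>, and the quadratic term from replacing
      \<open>z\<close> by \<open>y\<close> inside \<open>B u\<close>, controlled by the last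
      bound.\<close>
    define d3 where "d3 = min d' (min d2 (e / (4 * C * (C + 1) * n)))"
    have d3: "d3 > 0" using d' d2 e n C by (simp add: d3_def)
    have "norm (P u y - P 0 y - (- B (u - 0) y)) \<le> e * norm (u - 0)" if u3: "norm (u - 0) < d3" for u
    proof -
      have u: "norm u < d'" "norm u < d2" "norm u \<le> e / (4 * C * (C + 1) * n)" using u3 by (auto simp: d3_def)
      define z where "z = P u y"
      have Qz: "Q u z = y" by (simp add: z_def P(2)[OF u(1)])
      have "norm z \<le> norm y + norm (y - z)" by (metis norm_minus_commute norm_triangle_sub)
      then have z: "norm z \<le> 2 * n" using Qhalf[OF u(1), of z] n by (simp add: Qz)
      have zy: "norm (z - y) \<le> (C + 1) * norm u * (2 * n)"
      proof -
        have "norm (z - y) \<le> (C + 1) * norm u * norm z"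
          using Qy[OF u(1), of z] by (simp add: Qz norm_minus_commute)
        also have "\<dots> \<le> (C + 1) * norm u * (2 * n)" using z C by (intro mult_left_mono) auto
        finally show ?thesis .
      qed
      have "z - y + B u y = - (Q u z - z - B u z) - B u (z - y)"
        by (simp add: Qz bilinear_rsub[OF B])
      also have "norm \<dots> \<le> norm (Q u z - z - B u z) + norm (B u (z - y))"
        by (metis norm_minus_cancel norm_triangle_ineq4)
      also have "\<dots> \<le> e / (4 * n) * norm u * (2 * n) + C * norm u * ((C + 1) * norm u * (2 * n))"
      proof (rule add_mono)
        show "norm (Q u z - z - B u z) \<le> e / (4 * n) * norm u * (2 * n)"
          using d2(2)[OF u(2), of z] mult_left_mono[OF z, of "e / (4 * n) * norm u"] e n by simp
        show "norm (B u (z - y)) \<le> C * norm u * ((C + 1) * norm u * (2 * n))"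
          using C(1) by (intro order_trans[OF C(2)] mult_left_mono[OF zy]) auto
      qed
      also have "\<dots> = norm u * (e / 2 + norm u * (2 * C * (C + 1) * n))"
        using n by (simp add: field_simps)
      also have "\<dots> \<le> norm u * (e / 2 + e / (4 * C * (C + 1) * n) * (2 * C * (C + 1) * n))"
        using u(3) n C by (intro mult_left_mono add_left_mono mult_right_mono) auto
      also have "e / (4 * C * (C + 1) * n) * (2 * C * (C + 1) * n) = e / 2"
      proof -
        have "C + 1 \<noteq> 0" "C \<noteq> 0" "n \<noteq> 0" using C n by auto
        then show ?thesis by (simp add: divide_simps)
      qed
      finally show ?thesis by (simp add: z_def P0 mult.commute)
    qed
    with d3 show "\<exists>d>0. \<forall>u. norm (u - 0) < d \<longrightarrow> norm (P u y - P 0 y - (- B (u - 0) y)) \<le> e * norm (u - 0)"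
      by blast
  qed
  show thesis by (rule that[OF d' P dQ dP Q0 P0])
qed

context connection begin

text \<open>Continuity of the nine Christoffel columns at \<open>p\<close> makes the bilinear map
  continuous in the operator sense; each pair of indices contributes at most
  \<open>e / 9\<close>.\<close>

lemma Gam_near:
  assumes c: "c \<in> A" "p \<in> cdom c" and e: "e > 0"
  obtains d where "d > 0" "\<And>x. dist x (cmap c p) < d \<Longrightarrow> x \<in> cmap c ` cdom c"
    "\<And>x u y. dist x (cmap c p) < d \<Longrightarrow> norm (Gam c (cinv c x) u y - Gam c p u y) \<le> e * norm u * norm y"
proof -
  let ?x0 = "cmap c p"
  define ch where "ch i j x = christoffel A nabla c (cinv c x) i j" for i j x
  have x0: "?x0 \<in> cmap c ` cdom c" using c by blast
  have ev: "eventually (\<lambda>x. dist (ch i j x) (ch i j ?x0) < e / 9) (nhds ?x0)" for i j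
  proof -
    have "isCont (ch i j) ?x0"
      using smooth_on_continuous[OF smooth_christoffel[OF c(1), of i j]] c(2) open_cimage[OF c(1)]
      by (simp add: ch_def[abs_def] continuous_on_eq_continuous_at)
    then have "(ch i j \<longlongrightarrow> ch i j ?x0) (nhds ?x0)"
      by (simp add: isCont_def tendsto_at_iff_tendsto_nhds)
    then show ?thesis using e by (intro tendstoD) auto
  qed
  have "eventually (\<lambda>x. \<forall>i j. dist (ch i j x) (ch i j ?x0) < e / 9) (nhds ?x0)"
    by (intro eventually_all_finite ev)
  moreover have "eventually (\<lambda>x. x \<in> cmap c ` cdom c) (nhds ?x0)"
    by (rule eventually_nhds_in_open[OF open_cimage[OF c(1)] x0])
  ultimately have "eventually (\<lambda>x. x \<in> cmap c ` cdom c \<and> (\<forall>i j. dist (ch i j x) (ch i j ?x0) < e / 9)) (nhds ?x0)"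
    by eventually_elim simp
  then obtain d where d: "d > 0" "\<And>x. dist x ?x0 < d \<Longrightarrow> x \<in> cmap c ` cdom c"
    "\<And>x i j. dist x ?x0 < d \<Longrightarrow> dist (ch i j x) (ch i j ?x0) < e / 9"
    unfolding eventually_nhds_metric by blast
  have "norm (Gam c (cinv c x) u y - Gam c p u y) \<le> e * norm u * norm y" if x: "dist x ?x0 < d" for x u y
  proof -
    have "Gam c (cinv c x) u y - Gam c p u y
        = (\<Sum>i\<in>UNIV. \<Sum>j\<in>UNIV. (u $ i * y $ j) *\<^sub>R (ch i j x - ch i j ?x0))"
      by (simp add: Gam_def ch_def cinv_cmap[OF c] sum_subtractf[symmetric] scaleR_diff_right)
    also have "norm \<dots> \<le> (\<Sum>i\<in>(UNIV :: 3 set). \<Sum>j\<in>(UNIV :: 3 set). norm u * norm y * (e / 9))"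
    proof (intro sum_norm_le)
      fix i j
      show "norm ((u $ i * y $ j) *\<^sub>R (ch i j x - ch i j ?x0)) \<le> norm u * norm y * (e / 9)"
        using d(3)[OF x, of i j] component_le_norm_cart[of u i] component_le_norm_cart[of y j]
        by (simp only: norm_scaleR abs_mult dist_norm) (intro mult_mono, auto)
    qed
    also have "\<dots> = e * norm u * norm y" by simp
    finally show ?thesis .
  qed
  with d that show thesis by blast
qed

end

section \<open>Transport to the centre of a chart ball, to first order\<close>

context finsler_connection begin

text \<open>\<open>Q u\<close> is the time-one solution operator along the segment from
  \<open>x0 + u\<close> back to \<open>x0\<close>. The velocity is \<open>- u\<close>, which turns
  the coefficient \<open>- Gam\<close> of the parallel equation into \<open>+ Gam\<close> in
  direction \<open>u\<close>.\<close>

lemma transport_back: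
  assumes c: "c \<in> A" "p \<in> cdom c"
  obtains d Q where "d > 0"
    "\<And>u. norm u < d \<Longrightarrow> cmap c p + u \<in> cmap c ` cdom c"
    "\<And>u. norm u < d \<Longrightarrow> linear (Q u)"
    "\<And>u y. norm u < d \<Longrightarrow> F p (tvec A c p (Q u y))
        = F (cinv c (cmap c p + u)) (tvec A c (cinv c (cmap c p + u)) y)"
    "\<And>e. e > 0 \<Longrightarrow> \<exists>d'>0. \<forall>u. norm u < d' \<longrightarrow>
        (\<forall>y. norm (Q u y - y - Gam c p u y) \<le> e * norm u * norm y)"
proof -
  let ?x0 = "cmap c p"
  obtain C where C: "C > 0" "\<And>u y. norm (Gam c p u y) \<le> C * norm u * norm y"
    using bilinear_bounded_pos[OF bilinear_Gam] by (metis mult.assoc)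
  obtain d1 where d1: "d1 > 0" "\<And>x. dist x ?x0 < d1 \<Longrightarrow> x \<in> cmap c ` cdom c"
    "\<And>x u y. dist x ?x0 < d1 \<Longrightarrow> norm (Gam c (cinv c x) u y - Gam c p u y) \<le> 1 * norm u * norm y"
    using Gam_near[OF c, of 1] by (metis zero_less_one)
  \<comment> \<open>On this ball the coefficients are bounded by
    \<open>(C + 1) * norm u \<le> 1/2\<close>, as \<open>linear_ode_near_identity\<close>
    requires.\<close>
  define d where "d = min d1 (1 / (2 * (C + 1)))"
  have d: "d > 0" using d1 C by (simp add: d_def)
  define g where "g x u = Blinfun (Gam c (cinv c x) u)" for x u
  have blG: "bounded_linear (Gam c q u)" for q u
    using bilinear_Gam by (simp add: bilinear_def linear_conv_bounded_linear)
  have g: "blinfun_apply (g x u) y = Gam c (cinv c x) u y" for x u y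
    by (simp add: g_def bounded_linear_Blinfun_apply[OF blG])
  have g0: "blinfun_apply (g ?x0 u) y = Gam c p u y" for u y by (simp add: g cinv_cmap[OF c])
  \<comment> \<open>All properties wanted of the transport operator are collected so that it can be
    chosen for each \<open>u\<close>. Quantifying over \<open>e\<close> inside makes the choice
    independent of the accuracy demanded later.\<close>
  define R where "R u q \<longleftrightarrow>
      (\<forall>y. F p (tvec A c p (blinfun_apply q y)) = F (cinv c (?x0 + u)) (tvec A c (cinv c (?x0 + u)) y)) \<and>
      (\<forall>e. (\<forall>x. dist x ?x0 \<le> norm u \<longrightarrow> norm (g x u - g ?x0 u) \<le> e)
        \<longrightarrow> norm (q - id_blinfun - g ?x0 u) \<le> e + 2 * ((C + 1) * norm u)\<^sup>2)"
    for u and q :: "(real^3) \<Rightarrow>\<^sub>L (real^3)"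
  have "\<exists>q. R u q" if u: "norm u < d" for u
  proof -
    let ?k = "(C + 1) * norm u"
    have half: "?k \<le> 1 / 2"
    proof -
      have "norm u \<le> 1 / (2 * (C + 1))" using u by (simp add: d_def)
      then have "(C + 1) * norm u \<le> (C + 1) * (1 / (2 * (C + 1)))"
        using C by (intro mult_left_mono) auto
      also have "\<dots> = 1 / 2"
      proof -
        have "C + 1 \<noteq> 0" using C by simp
        then show ?thesis by (simp add: divide_simps)
      qed
      finally show ?thesis .
    qed
    define l where "l t = (?x0 + u) + t *\<^sub>R (- u)" for t :: real
    have l: "dist (l t) ?x0 \<le> norm u" if "t \<in> {0..1}" for t
    proof -
      have "l t - ?x0 = (1 - t) *\<^sub>R u" by (simp add: l_def algebra_simps)
      then show ?thesis using that mult_right_mono[of "\<bar>1 - t\<bar>" 1 "norm u"] by (simp add: dist_norm)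
    qed
    then have ld: "dist (l t) ?x0 < d1" if "t \<in> {0..1}" for t
      using l[OF that] u by (simp add: d_def)
    have lim: "l t \<in> cmap c ` cdom c" if "t \<in> {0..1}" for t by (rule d1(2)[OF ld[OF that]])
    define G where "G t = g (l t) u" for t
    have contG: "continuous_on {0..1} G"
    proof (rule continuous_on_blinfun_componentwise)
      fix b :: "real^3"
      have "continuous_on {0..1} (\<lambda>t. Gam c (cinv c (l t)) u b)"
        by (rule continuous_on_compose2[OF smooth_on_continuous[OF smooth_Gam[OF c(1)]]])
          (use lim in \<open>auto simp: l_def intro!: continuous_intros\<close>)
      then show "continuous_on {0..1} (\<lambda>t. blinfun_apply (G t) b)" by (simp add: G_def g)
    qed
    have k: "norm (G t) \<le> ?k" if "t \<in> {0..1}" for t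
    proof (rule norm_blinfun_bound)
      fix y
      have "norm (Gam c (cinv c (l t)) u y)
          \<le> norm (Gam c p u y) + norm (Gam c (cinv c (l t)) u y - Gam c p u y)" by (rule norm_triangle_sub)
      also have "\<dots> \<le> C * norm u * norm y + 1 * norm u * norm y"
        by (intro add_mono C(2) d1(3) ld that)
      finally show "norm (blinfun_apply (G t) y) \<le> ?k * norm y" by (simp add: G_def g algebra_simps)
    qed (use C in simp)
    obtain P where P: "P 0 = id_blinfun"
      "\<And>t. t \<in> {0..1} \<Longrightarrow> (P has_vector_derivative (G t o\<^sub>L P t)) (at t within {0..1})"
      "\<And>L e. (\<And>t. t \<in> {0..1} \<Longrightarrow> norm (G t - L) \<le> e) \<Longrightarrow> norm (P 1 - id_blinfun - L) \<le> e + 2 * ?k\<^sup>2"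
      using linear_ode_near_identity[OF contG k half] by metis
    have "F p (tvec A c p (blinfun_apply (P 1) y)) = F (cinv c (?x0 + u)) (tvec A c (cinv c (?x0 + u)) y)" for y
    proof -
      have "((\<lambda>t. blinfun_apply (P t) y) has_vector_derivative
          - Gam c (cinv c ((?x0 + u) + t *\<^sub>R (- u))) (- u) (blinfun_apply (P t) y)) (at t within {0..1})"
        if "t \<in> {0..1}" for t
        using bounded_linear.has_vector_derivative[OF blinfun.bounded_linear_left P(2)[OF that], of y]
        by (simp add: G_def g l_def bilinear_lneg[OF bilinear_Gam])
      moreover have "(?x0 + u) + t *\<^sub>R (- u) \<in> cmap c ` cdom c" if "t \<in> {0..1}" for t
        using lim[OF that] by (simp add: l_def)
      ultimately show ?thesis
        using transport_segment[OF c(1), of "?x0 + u" "- u" "\<lambda>t. blinfun_apply (P t) y"]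
        by (simp add: P(1) cinv_cmap[OF c])
    qed
    then have "R u (P 1)" unfolding R_def using P(3)[of "g ?x0 u"] l by (auto simp: G_def)
    then show ?thesis by blast
  qed
  then obtain q where q: "\<And>u. norm u < d \<Longrightarrow> R u (q u)" by metis
  show thesis
  proof
    show "d > 0" by (rule d)
    show "?x0 + u \<in> cmap c ` cdom c" if "norm u < d" for u
      using d1(2)[of "?x0 + u"] that by (simp add: d_def dist_norm)
    show "linear (blinfun_apply (q u))" for u
      by (simp add: bounded_linear.linear blinfun.bounded_linear_right)
    show "F p (tvec A c p (blinfun_apply (q u) y)) = F (cinv c (?x0 + u)) (tvec A c (cinv c (?x0 + u)) y)"
      if "norm u < d" for u y using q[OF that] by (simp add: R_def)
    fix e :: real assume e: "e > 0"
    obtain d2 where d2: "d2 > 0"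
      "\<And>x u y. dist x ?x0 < d2 \<Longrightarrow> norm (Gam c (cinv c x) u y - Gam c p u y) \<le> e / 2 * norm u * norm y"
      using Gam_near[OF c, of "e / 2"] e by (metis half_gt_zero)
    \<comment> \<open>Half of the error comes from the variation of the Christoffel symbols within
      \<open>d2\<close>; the last bound makes the quadratic remainder of the solution operator at
      most \<open>e / 2 * norm u\<close>.\<close>
    define d3 where "d3 = min d (min d2 (e / (4 * (C + 1)\<^sup>2)))"
    have d3: "d3 > 0" using d d2 e C by (simp add: d3_def)
    have "norm (blinfun_apply (q u) y - y - Gam c p u y) \<le> e * norm u * norm y" if u3: "norm u < d3" for u y
    proof -
      have u: "norm u < d" "norm u < d2" "norm u \<le> e / (4 * (C + 1)\<^sup>2)" using u3 by (auto simp: d3_def)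
      have "norm (g x u - g ?x0 u) \<le> e / 2 * norm u" if "dist x ?x0 \<le> norm u" for x
      proof (rule norm_blinfun_bound)
        show "norm (blinfun_apply (g x u - g ?x0 u) y) \<le> e / 2 * norm u * norm y" for y
          using d2(2)[of x u y] that u by (simp add: blinfun.diff_left g cinv_cmap[OF c])
      qed (use e in simp)
      then have "norm (q u - id_blinfun - g ?x0 u) \<le> e / 2 * norm u + 2 * ((C + 1) * norm u)\<^sup>2"
        using q[OF u(1)] by (simp add: R_def)
      also have "\<dots> = norm u * (e / 2 + norm u * (2 * (C + 1)\<^sup>2))"
        by (simp add: power2_eq_square algebra_simps)
      also have "\<dots> \<le> norm u * (e / 2 + e / (4 * (C + 1)\<^sup>2) * (2 * (C + 1)\<^sup>2))"
        using u(3) by (intro mult_left_mono add_left_mono mult_right_mono) auto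
      also have "e / (4 * (C + 1)\<^sup>2) * (2 * (C + 1)\<^sup>2) = e / 2"
      proof -
        have "(C + 1)\<^sup>2 \<noteq> 0" using C by simp
        then show ?thesis by (simp add: divide_simps)
      qed
      finally have n: "norm (q u - id_blinfun - g ?x0 u) \<le> e * norm u" by (simp add: mult.commute)
      have "blinfun_apply (q u) y - y - Gam c p u y = blinfun_apply (q u - id_blinfun - g ?x0 u) y"
        by (simp add: blinfun.diff_left g0)
      also have "norm \<dots> \<le> norm (q u - id_blinfun - g ?x0 u) * norm y" by (rule norm_blinfun)
      also have "\<dots> \<le> e * norm u * norm y" by (rule mult_right_mono[OF n]) simp
      finally show ?thesis .
    qed
    with d3 show "\<exists>d'>0. \<forall>u. norm u < d' \<longrightarrow>
        (\<forall>y. norm (blinfun_apply (q u) y - y - Gam c p u y) \<le> e * norm u * norm y)" by blast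
  qed
qed

text \<open>\<open>Q u\<close> transports the tangent space over \<open>x + u\<close> back to the one over \<open>x\<close>, and \<open>P u\<close> is its
  inverse. Only their dependence on \<open>u\<close> to first order at \<open>u = 0\<close> is needed.\<close>

definition transport_family :: "'m chart \<Rightarrow> 'm \<Rightarrow> real \<Rightarrow> (real^3 \<Rightarrow> real^3 \<Rightarrow> real^3)
    \<Rightarrow> (real^3 \<Rightarrow> real^3 \<Rightarrow> real^3) \<Rightarrow> bool" where
  "transport_family c p d Q P \<longleftrightarrow> d > 0 \<and>
    (\<forall>u. norm u < d \<longrightarrow> cmap c p + u \<in> cmap c ` cdom c \<and>
      isometry (F p) (F (cinv c (cmap c p + u)))
        (\<lambda>v. tvec A c (cinv c (cmap c p + u)) (P u (tcoord A c p v)))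
        (\<lambda>v. tvec A c p (Q u (tcoord A c (cinv c (cmap c p + u)) v))) \<and>
      linear (Q u)) \<and>
    (\<forall>y. ((\<lambda>u. Q u y) has_derivative (\<lambda>u. Gam c p u y)) (at 0)) \<and>
    (\<forall>y. ((\<lambda>u. P u y) has_derivative (\<lambda>u. - Gam c p u y)) (at 0)) \<and>
    (\<forall>y. Q 0 y = y) \<and> (\<forall>y. P 0 y = y)"

lemma transport_familyD:
  assumes "transport_family c p d Q P"
  shows "d > 0"
    "\<And>u. norm u < d \<Longrightarrow> cmap c p + u \<in> cmap c ` cdom c"
    "\<And>u. norm u < d \<Longrightarrow> isometry (F p) (F (cinv c (cmap c p + u)))
        (\<lambda>v. tvec A c (cinv c (cmap c p + u)) (P u (tcoord A c p v)))
        (\<lambda>v. tvec A c p (Q u (tcoord A c (cinv c (cmap c p + u)) v)))"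
    "\<And>u. norm u < d \<Longrightarrow> linear (Q u)"
    "\<And>y. ((\<lambda>u. Q u y) has_derivative (\<lambda>u. Gam c p u y)) (at 0)"
    "\<And>y. ((\<lambda>u. P u y) has_derivative (\<lambda>u. - Gam c p u y)) (at 0)"
    "\<And>y. Q 0 y = y" "\<And>y. P 0 y = y"
  using assms by (simp_all add: transport_family_def)

lemma transport_family_exists:
  assumes c: "c \<in> A" "p \<in> cdom c"
  shows "\<exists>d Q P. transport_family c p d Q P"
proof -
  let ?x = "cmap c p"
  obtain d' Q where Q': "d' > 0"
    "\<And>u. norm u < d' \<Longrightarrow> ?x + u \<in> cmap c ` cdom c"
    "\<And>u. norm u < d' \<Longrightarrow> linear (Q u)"
    "\<And>u y. norm u < d' \<Longrightarrow> F p (tvec A c p (Q u y))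
        = F (cinv c (?x + u)) (tvec A c (cinv c (?x + u)) y)"
    "\<And>e. e > 0 \<Longrightarrow> \<exists>d>0. \<forall>u. norm u < d \<longrightarrow>
        (\<forall>y. norm (Q u y - y - Gam c p u y) \<le> e * norm u * norm y)"
    using transport_back[OF c] by blast
  obtain d P where P: "d > 0" "d \<le> d'"
    "\<And>u. norm u < d \<Longrightarrow> linear (P u)"
    "\<And>u y. norm u < d \<Longrightarrow> Q u (P u y) = y" "\<And>u y. norm u < d \<Longrightarrow> P u (Q u y) = y"
    "\<And>y. ((\<lambda>u. Q u y) has_derivative (\<lambda>u. Gam c p u y)) (at 0)"
    "\<And>y. ((\<lambda>u. P u y) has_derivative (\<lambda>u. - Gam c p u y)) (at 0)"
    "\<And>y. Q 0 y = y" "\<And>y. P 0 y = y"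
    using near_identity_inverse[OF bilinear_Gam Q'(1,3,5)] by blast
  have Q: "?x + u \<in> cmap c ` cdom c" "linear (Q u)"
    "F p (tvec A c p (Q u y)) = F (cinv c (?x + u)) (tvec A c (cinv c (?x + u)) y)"
    if "norm u < d" for u y
    using Q'(2,3,4)[of u] that P(2) by simp_all
  have iso: "isometry (F p) (F (cinv c (?x + u)))
        (\<lambda>v. tvec A c (cinv c (?x + u)) (P u (tcoord A c p v)))
        (\<lambda>v. tvec A c p (Q u (tcoord A c (cinv c (?x + u)) v)))" if u: "norm u < d" for u
  proof -
    let ?q = "cinv c (?x + u)"
    have q: "?q \<in> cdom c" by (rule cinv_in[OF Q(1)[OF u]])
    have "linear (\<lambda>v. tvec A c ?q (P u (tcoord A c p v)))"
      using linear_compose[OF linear_compose[OF linear_tcoord[OF c] P(3)[OF u]] linear_tvec[OF c(1) q]]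
      by (simp add: o_def)
    moreover have "linear (\<lambda>v. tvec A c p (Q u (tcoord A c ?q v)))"
      using linear_compose[OF linear_compose[OF linear_tcoord[OF c(1) q] Q(2)[OF u]] linear_tvec[OF c]]
      by (simp add: o_def)
    moreover have "F ?q (tvec A c ?q (P u (tcoord A c p v))) = F p v" for v
      using Q(3)[OF u, of "P u (tcoord A c p v)"] by (simp add: P(4)[OF u] tvec_tcoord[OF c])
    ultimately show ?thesis
      by (simp add: isometry_def tcoord_tvec_self[OF c] tcoord_tvec_self[OF c(1) q] tvec_tcoord[OF c]
          tvec_tcoord[OF c(1) q] P(4,5)[OF u])
  qed
  have "transport_family c p d Q P"
    unfolding transport_family_def using P(1,6-9) Q(1,2) iso by blast
  then show ?thesis by blast
qed

end

text \<open>Product rule for a derivative taken in a moving direction \<open>h z\<close>. The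
  direction is expanded in the basis because second derivatives are available only for fixed inner
  directions.\<close>

lemma frechet_dir_has_derivative:
  assumes T: "open T" "z \<in> T" and f: "smooth_on T f" and h: "(h has_derivative h') (at z)"
  shows "((\<lambda>z. frechet_derivative f (at z) (h z)) has_derivative
    (\<lambda>v. frechet_derivative (\<lambda>x. frechet_derivative f (at x) (h z)) (at z) v
      + frechet_derivative f (at z) (h' v))) (at z)"
proof -
  let ?D = "\<lambda>b z. frechet_derivative f (at z) b"
  have exp: "?D w z = (\<Sum>b\<in>Basis. (w \<bullet> b) *\<^sub>R ?D b z)" if "z \<in> T" for w z
    by (rule frechet_basis_sum[OF smooth_on_differentiable[OF f that]])
  have dD: "(?D b has_derivative frechet_derivative (?D b) (at z)) (at z)" for b
    by (rule has_derivative_frechet[OF smooth_on_differentiable[OF smooth_on_frechet[OF f] T(2)]])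
  have D2: "frechet_derivative (?D w) (at z) v = (\<Sum>b\<in>Basis. (w \<bullet> b) *\<^sub>R frechet_derivative (?D b) (at z) v)" for w v
  proof -
    have "((\<lambda>z. \<Sum>b\<in>Basis. (w \<bullet> b) *\<^sub>R ?D b z) has_derivative
        (\<lambda>v. \<Sum>b\<in>Basis. (w \<bullet> b) *\<^sub>R frechet_derivative (?D b) (at z) v)) (at z)"
      by (intro has_derivative_sum has_derivative_scaleR_right dD)
    from frechet_eqI[OF this] show ?thesis
      using frechet_cong_open[OF T, of "?D w" "\<lambda>z. \<Sum>b\<in>Basis. (w \<bullet> b) *\<^sub>R ?D b z"] exp by simp
  qed
  have hb: "((\<lambda>z. h z \<bullet> b) has_derivative (\<lambda>v. h' v \<bullet> b)) (at z)" for b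
    using bounded_linear.has_derivative[OF bounded_linear_inner_left h] .
  have "((\<lambda>z. \<Sum>b\<in>Basis. (h z \<bullet> b) *\<^sub>R ?D b z) has_derivative
      (\<lambda>v. \<Sum>b\<in>Basis. (h z \<bullet> b) *\<^sub>R frechet_derivative (?D b) (at z) v + (h' v \<bullet> b) *\<^sub>R ?D b z)) (at z)"
    by (intro has_derivative_sum has_derivative_scaleR hb dD)
  moreover have "(\<Sum>b\<in>Basis. (h z \<bullet> b) *\<^sub>R frechet_derivative (?D b) (at z) v + (h' v \<bullet> b) *\<^sub>R ?D b z)
      = frechet_derivative (?D (h z)) (at z) v + ?D (h' v) z" for v
    unfolding D2[of "h z"] exp[OF T(2), of "h' v"] by (simp only: sum.distrib)
  ultimately have "((\<lambda>z. \<Sum>b\<in>Basis. (h z \<bullet> b) *\<^sub>R ?D b z) has_derivative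
      (\<lambda>v. frechet_derivative (?D (h z)) (at z) v + ?D (h' v) z)) (at z)"
    by simp
  then show ?thesis
    by (rule has_derivative_transform_within_open[OF _ T]) (rule exp[symmetric])
qed

section \<open>Curvature in chart components\<close>

context connection begin

definition dGam :: "'m chart \<Rightarrow> real^3 \<Rightarrow> real^3 \<Rightarrow> real^3 \<Rightarrow> real^3 \<Rightarrow> real^3" where
  "dGam c x v u y = frechet_derivative (\<lambda>x. Gam c (cinv c x) u y) (at x) v"

lemma Gam_has_derivative:
  assumes c: "c \<in> A" and x: "xi z \<in> cmap c ` cdom c"
    and xi: "(xi has_derivative xi') (at z)" and a: "(a has_derivative a') (at z)"
    and b: "(b has_derivative b') (at z)"
  shows "((\<lambda>z. Gam c (cinv c (xi z)) (a z) (b z)) has_derivative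
    (\<lambda>v. dGam c (xi z) (xi' v) (a z) (b z) + Gam c (cinv c (xi z)) (a' v) (b z)
      + Gam c (cinv c (xi z)) (a z) (b' v))) (at z)"
proof -
  define ch where "ch i j x = christoffel A nabla c (cinv c x) i j" for i j x
  define ch' where "ch' i j = frechet_derivative (ch i j) (at (xi z))" for i j
  have G: "Gam c (cinv c x) u y = (\<Sum>i\<in>UNIV. \<Sum>j\<in>UNIV. (u $ i * y $ j) *\<^sub>R ch i j x)" for x u y
    by (simp add: Gam_def ch_def)
  have d: "(ch i j has_derivative ch' i j) (at (xi z))" for i j
    unfolding ch'_def ch_def
    by (rule has_derivative_frechet[OF smooth_on_differentiable[OF smooth_christoffel[OF c] x]])
  have dG: "dGam c (xi z) v u y = (\<Sum>i\<in>UNIV. \<Sum>j\<in>UNIV. (u $ i * y $ j) *\<^sub>R ch' i j v)" for v u y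
  proof -
    have "((\<lambda>x. \<Sum>i\<in>UNIV. \<Sum>j\<in>UNIV. (u $ i * y $ j) *\<^sub>R ch i j x) has_derivative
        (\<lambda>v. \<Sum>i\<in>UNIV. \<Sum>j\<in>UNIV. (u $ i * y $ j) *\<^sub>R ch' i j v)) (at (xi z))"
      by (intro has_derivative_sum has_derivative_scaleR_right d)
    from frechet_eqI[OF this] show ?thesis by (simp add: dGam_def G)
  qed
  note an = bounded_linear.has_derivative[OF bounded_linear_vec_nth a]
  note bn = bounded_linear.has_derivative[OF bounded_linear_vec_nth b]
  have "((\<lambda>z. \<Sum>i\<in>UNIV. \<Sum>j\<in>UNIV. (a z $ i * b z $ j) *\<^sub>R ch i j (xi z)) has_derivative
      (\<lambda>v. \<Sum>i\<in>UNIV. \<Sum>j\<in>UNIV. (a z $ i * b z $ j) *\<^sub>R ch' i j (xi' v)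
        + (a z $ i * b' v $ j + a' v $ i * b z $ j) *\<^sub>R ch i j (xi z))) (at z)"
    by (intro has_derivative_sum has_derivative_scaleR has_derivative_mult an bn
        has_derivative_compose[OF xi d])
  then show ?thesis
    unfolding G dG
    by (rule has_derivative_eq_rhs) (simp add: sum.distrib algebra_simps fun_eq_iff)
qed

definition Riem :: "'m chart \<Rightarrow> 'm \<Rightarrow> real^3 \<Rightarrow> real^3 \<Rightarrow> real^3 \<Rightarrow> real^3" where
  "Riem c p u w y = dGam c (cmap c p) u w y - dGam c (cmap c p) w u y
    + Gam c p u (Gam c p w y) - Gam c p w (Gam c p u y)"

lemma linear_Riem:
  assumes c: "c \<in> A" "p \<in> cdom c" shows "linear (Riem c p u w)"
proof -
  have 1: "linear (dGam c (cmap c p) v u)" for v u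
  proof -
    have "Gam c (cinv c x) u y = (\<Sum>j\<in>UNIV. y $ j *\<^sub>R Gam c (cinv c x) u (axis j 1))" for x y
      using bilinear_Gam by (intro linear_axis_sum) (simp add: bilinear_def)
    note e = this
    have "cmap c p \<in> cmap c ` cdom c" using c by blast
    note d = has_derivative_frechet[OF smooth_on_differentiable[OF smooth_Gam[OF c(1)] this]]
    have "((\<lambda>x. \<Sum>j\<in>UNIV. y $ j *\<^sub>R Gam c (cinv c x) u (axis j 1)) has_derivative
        (\<lambda>v. \<Sum>j\<in>UNIV. y $ j *\<^sub>R dGam c (cmap c p) v u (axis j 1))) (at (cmap c p))" for y
      unfolding dGam_def by (intro has_derivative_sum has_derivative_scaleR_right d)
    from frechet_eqI[OF this]
    have "dGam c (cmap c p) v u y = (\<Sum>j\<in>UNIV. y $ j *\<^sub>R dGam c (cmap c p) v u (axis j 1))" for y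
      by (subst dGam_def) (simp add: e[symmetric])
    note D = this
    show ?thesis
    proof (rule linearI)
      show "dGam c (cmap c p) v u (y + z) = dGam c (cmap c p) v u y + dGam c (cmap c p) v u z" for y z
        unfolding D[of "y + z"] D[of y] D[of z] by (simp only: vector_add_component scaleR_add_left sum.distrib)
      show "dGam c (cmap c p) v u (r *\<^sub>R y) = r *\<^sub>R dGam c (cmap c p) v u y" for r y
        unfolding D[of "r *\<^sub>R y"] D[of y]
        by (simp only: vector_scaleR_component scaleR_sum_right scaleR_scaleR real_scaleR_def)
    qed
  qed
  have 2: "linear (Gam c p v)" for v using bilinear_Gam by (simp add: bilinear_def)
  show ?thesis
    unfolding Riem_def[abs_def]
    by (intro linear_compose_sub linear_compose_add 1 linear_compose[OF 2 2, unfolded o_def])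
qed

text \<open>After antisymmetrisation the second derivatives of \<open>Z\<close> cancel by symmetry,
  the mixed terms containing one derivative of \<open>Z\<close> and one \<open>Gam\<close> cancel in
  pairs, and the derivatives of \<open>X\<close> and \<open>Y\<close> combine to the bracket term.
  What remains depends only on the values at \<open>p\<close>.\<close>

lemma curvature_chart:
  assumes U: "open U" "p \<in> U" and X: "smooth_vf_on A U X" and Y: "smooth_vf_on A U Y"
    and Z: "smooth_vf_on A U Z"
  shows "curvature A nabla X Y Z p = Riem (chart_at A p) p (X p) (Y p) (Z p)"
proof -
  let ?c = "chart_at A p"
  let ?x = "cmap ?c p" and ?T = "cmap ?c ` (U \<inter> cdom ?c)"
  have c: "?c \<in> A" "p \<in> cdom ?c" by (rule chart_at)+
  have T: "open ?T" "?x \<in> ?T" using open_chart_image[OF c(1) U(1)] U(2) c(2) by auto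
  have x: "?x \<in> cmap ?c ` cdom ?c" using c by blast
  have tc: "tcoord A ?c p v = v" for v by (rule tcoord_chart_at(1)[OF atlas])
  let ?Zc = "vf_coord A ?c Z"
  have at_x: "vf_coord A ?c V ?x = V p" for V by (simp add: vf_coord_cmap[OF c] tc)
  have Zs: "smooth_on ?T ?Zc" by (rule smooth_vf_on_coord[OF Z c(1)])
  have dZ: "(?Zc has_derivative frechet_derivative ?Zc (at ?x)) (at ?x)"
    by (rule has_derivative_frechet[OF smooth_on_differentiable[OF Zs T(2)]])
  have linZ: "linear (frechet_derivative ?Zc (at ?x))"
    by (rule linear_frechet[OF smooth_on_differentiable[OF Zs T(2)]])
  have second: "nabla p v (\<lambda>q. nabla q (V q) Z)
      = frechet_derivative (\<lambda>x. frechet_derivative ?Zc (at x) (V p)) (at ?x) v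
        + frechet_derivative ?Zc (at ?x) (frechet_derivative (vf_coord A ?c V) (at ?x) v)
        + (dGam ?c ?x v (V p) (Z p) + Gam ?c p (frechet_derivative (vf_coord A ?c V) (at ?x) v) (Z p)
        + Gam ?c p (V p) (frechet_derivative ?Zc (at ?x) v))
        + Gam ?c p v (frechet_derivative ?Zc (at ?x) (V p) + Gam ?c p (V p) (Z p))"
    if V: "smooth_vf_on A U V" for V v
  proof -
    let ?Vc = "vf_coord A ?c V" and ?W = "\<lambda>q. nabla q (V q) Z"
    have dV: "(?Vc has_derivative frechet_derivative ?Vc (at ?x)) (at ?x)"
      by (rule has_derivative_frechet[OF smooth_on_differentiable[OF smooth_vf_on_coord[OF V c(1)] T(2)]])
    have W: "smooth_vf_on A U ?W" by (rule nabla_smooth[OF U(1) V Z])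
    have Wc: "vf_coord A ?c ?W y = frechet_derivative ?Zc (at y) (?Vc y) + Gam ?c (cinv ?c y) (?Vc y) (?Zc y)"
      if "y \<in> ?T" for y
    proof -
      obtain q where q: "q \<in> U" "q \<in> cdom ?c" "y = cmap ?c q" using \<open>y \<in> ?T\<close> by blast
      then show ?thesis
        using nabla_chart[OF U(1) Z q(1) c(1) q(2), of "V q"]
        by (simp add: vf_coord_cmap[OF c(1) q(2)] cinv_cmap[OF c(1) q(2)])
    qed
    have "((\<lambda>y. frechet_derivative ?Zc (at y) (?Vc y) + Gam ?c (cinv ?c y) (?Vc y) (?Zc y)) has_derivative
        (\<lambda>v. (frechet_derivative (\<lambda>x. frechet_derivative ?Zc (at x) (?Vc ?x)) (at ?x) v
          + frechet_derivative ?Zc (at ?x) (frechet_derivative ?Vc (at ?x) v))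
        + (dGam ?c ?x v (?Vc ?x) (?Zc ?x) + Gam ?c (cinv ?c ?x) (frechet_derivative ?Vc (at ?x) v) (?Zc ?x)
          + Gam ?c (cinv ?c ?x) (?Vc ?x) (frechet_derivative ?Zc (at ?x) v)))) (at ?x)"
      by (intro has_derivative_add frechet_dir_has_derivative[OF T Zs dV]
          Gam_has_derivative[OF c(1) x has_derivative_ident dV dZ])
    from frechet_eqI[OF this] frechet_cong_open[OF T, of "vf_coord A ?c ?W"] Wc
    have D: "frechet_derivative (vf_coord A ?c ?W) (at ?x) v
        = frechet_derivative (\<lambda>x. frechet_derivative ?Zc (at x) (V p)) (at ?x) v
        + frechet_derivative ?Zc (at ?x) (frechet_derivative ?Vc (at ?x) v)
        + (dGam ?c ?x v (V p) (Z p) + Gam ?c p (frechet_derivative ?Vc (at ?x) v) (Z p)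
        + Gam ?c p (V p) (frechet_derivative ?Zc (at ?x) v))"
      by (simp add: at_x cinv_cmap[OF c])
    have "vf_coord A ?c ?W ?x = frechet_derivative ?Zc (at ?x) (V p) + Gam ?c p (V p) (Z p)"
      using Wc[OF T(2)] by (simp only: at_x cinv_cmap[OF c])
    then show ?thesis using nabla_chart[OF U(1) W U(2) c, of v] D by (simp only: tc)
  qed
  have br: "nabla p v Z = frechet_derivative ?Zc (at ?x) v + Gam ?c p v (Z p)" for v
    using nabla_chart[OF U(1) Z U(2) c, of v] by (simp only: tc at_x)
  have lb: "lie_bracket A X Y p = frechet_derivative (vf_coord A ?c Y) (at ?x) (X p)
      - frechet_derivative (vf_coord A ?c X) (at ?x) (Y p)"
    by (simp add: lie_bracket_def Let_def)
  show ?thesis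
    unfolding curvature_def second[OF X] second[OF Y] br lb Riem_def
    using frechet_second_symmetric_vec[OF T Zs, of "Y p" "X p"]
    by (simp add: linear_diff[OF linZ] bilinear_lsub[OF bilinear_Gam] bilinear_radd[OF bilinear_Gam])
qed

end

section \<open>Horizontal derivatives of the Finsler function\<close>

context finsler_connection begin

abbreviation Fc :: "'m chart \<Rightarrow> (real^3) \<times> (real^3) \<Rightarrow> real" where "Fc c \<equiv> finsler_coord A F c"

lemma smooth_Fc: "c \<in> A \<Longrightarrow> smooth_on ((cmap c ` cdom c) \<times> (- {0})) (Fc c)"
  using finsler by (simp add: finsler_metric_def)

lemma open_slit: "c \<in> A \<Longrightarrow> open ((cmap c ` cdom c) \<times> (- {0 :: real^3}))"
  using open_cimage by (intro open_Times) auto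

text \<open>\<open>F\<close> is constant along \<open>u \<mapsto> (x + u, P u y)\<close>, the
  transport of the vector with components \<open>y\<close> to nearby points. The derivative of this
  map at \<open>u = 0\<close> is the horizontal lift of \<open>u\<close>.\<close>

lemma horizontal:
  assumes c: "c \<in> A" "p \<in> cdom c" and y: "y \<noteq> 0"
  shows "frechet_derivative (Fc c) (at (cmap c p, y)) (u, - Gam c p u y) = 0"
proof -
  let ?x = "cmap c p"
  obtain d Q P where tf: "transport_family c p d Q P"
    using transport_family_exists[OF c] by blast
  note Q = transport_familyD[OF tf]
  have z: "(?x, y) \<in> (cmap c ` cdom c) \<times> (- {0})" using c y by blast
  have diff: "Fc c differentiable (at (?x, y))"
    by (rule smooth_on_differentiable[OF smooth_Fc[OF c(1)] z])
  let ?D = "frechet_derivative (Fc c) (at (?x, y))"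
  have g: "((\<lambda>u. (?x + u, P u y)) has_derivative (\<lambda>u. (u, - Gam c p u y))) (at 0)"
    by (intro has_derivative_Pair Q(6)) (auto intro!: derivative_eq_intros)
  have "(Fc c has_derivative ?D) (at (?x + 0, P 0 y))"
    using has_derivative_frechet[OF diff] by (simp add: Q(8))
  from has_derivative_compose[OF g this]
  have 1: "((\<lambda>u. Fc c (?x + u, P u y)) has_derivative (\<lambda>u. ?D (u, - Gam c p u y))) (at 0)" .
  have "((\<lambda>u. Fc c (?x + u, P u y)) has_derivative (\<lambda>u. 0)) (at 0)"
  proof (rule has_derivative_transform_within_open[OF has_derivative_const])
    show "F p (tvec A c p y) = Fc c (?x + u, P u y)" if "u \<in> ball 0 d" for u
      using Q(3)[of u] that by (simp add: finsler_coord_def isometry_def) (metis tcoord_tvec_self[OF c])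
  qed (use Q(1) in auto)
  from has_derivative_unique[OF 1 this] show ?thesis by (simp add: fun_eq_iff)
qed

text \<open>The horizontal vector fields annihilate the Finsler function, hence so do their
  commutators, which are vertical and given by the curvature.\<close>

lemma Riem_kills:
  assumes c: "c \<in> A" "p \<in> cdom c" and y: "y \<noteq> 0"
  shows "frechet_derivative (Fc c) (at (cmap c p, y)) (0, Riem c p u w y) = 0"
proof -
  let ?x = "cmap c p" and ?T = "(cmap c ` cdom c) \<times> (- {0 :: real^3})"
  let ?z = "(?x, y)"
  have T: "open ?T" "?z \<in> ?T" using open_slit[OF c(1)] c y by auto
  have x: "?x \<in> cmap c ` cdom c" using c by blast
  note s = smooth_Fc[OF c(1)]
  define H where "H u z = (u, - Gam c (cinv c (fst z)) u (snd z))" for u and z :: "(real^3) \<times> (real^3)"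
  define H' where "H' u v = (0 :: real^3, - (dGam c ?x (fst v) u y + Gam c p u (snd v)))" for u and v :: "(real^3) \<times> (real^3)"
  have Hz: "H u ?z = (u, - Gam c p u y)" for u by (simp add: H_def cinv_cmap[OF c])
  have dH: "(H u has_derivative H' u) (at ?z)" for u
  proof -
    have "((\<lambda>z. Gam c (cinv c (fst z)) u (snd z)) has_derivative
        (\<lambda>v. dGam c (fst ?z) (fst v) u (snd ?z) + Gam c (cinv c (fst ?z)) 0 (snd ?z)
          + Gam c (cinv c (fst ?z)) u (snd v))) (at ?z)"
      by (rule Gam_has_derivative[OF c(1), of fst ?z fst "\<lambda>_. u" "\<lambda>_. 0" snd snd])
        (use x in \<open>auto intro!: derivative_eq_intros\<close>)
    then have "((\<lambda>z. Gam c (cinv c (fst z)) u (snd z)) has_derivative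
        (\<lambda>v. dGam c ?x (fst v) u y + Gam c p u (snd v))) (at ?z)"
      by (simp add: cinv_cmap[OF c] bilinear_lzero[OF bilinear_Gam])
    then show ?thesis
      unfolding H_def[abs_def] H'_def[abs_def] by (intro has_derivative_Pair has_derivative_minus) auto
  qed
  have zero: "frechet_derivative (Fc c) (at z) (H u z) = 0" if "z \<in> ?T" for z u
  proof -
    obtain q where q: "q \<in> cdom c" "fst z = cmap c q" "snd z \<noteq> 0" using \<open>z \<in> ?T\<close> by (cases z) auto
    then have z: "z = (cmap c q, snd z)" by (simp add: prod_eq_iff)
    show ?thesis
      using horizontal[OF c(1) q(1,3), of u] q unfolding H_def by (metis c(1) cinv_cmap z)
  qed
  \<comment> \<open>The vanishing of the horizontal derivatives holds on an open set and may be
    differentiated once more. Taking \<open>v\<close> horizontal and exchanging the two fields, the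
    Hessian terms agree and only the commutator survives.\<close>
  have K: "hess (Fc c) ?z v (H u ?z) + frechet_derivative (Fc c) (at ?z) (H' u v) = 0" for u v
  proof -
    have "((\<lambda>z. frechet_derivative (Fc c) (at z) (H u z)) has_derivative (\<lambda>_. 0)) (at ?z)"
      by (rule has_derivative_transform_within_open[OF has_derivative_const T]) (simp add: zero)
    from fun_cong[OF has_derivative_unique[OF frechet_dir_has_derivative[OF T s dH] this], of v]
    show ?thesis by (simp add: hess_def)
  qed
  have L: "linear (frechet_derivative (Fc c) (at ?z))"
    by (rule linear_frechet[OF smooth_on_differentiable[OF s T(2)]])
  have "frechet_derivative (Fc c) (at ?z) (H' u (H w ?z)) = frechet_derivative (Fc c) (at ?z) (H' w (H u ?z))"
    using K[of "H w ?z" u] K[of "H u ?z" w] hess_symmetric[OF T s, of "H u ?z" "H w ?z"] by simp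
  then have "frechet_derivative (Fc c) (at ?z) (H' u (H w ?z) - H' w (H u ?z)) = 0"
    by (simp add: linear_diff[OF L])
  moreover have "H' u (H w ?z) - H' w (H u ?z) = (0, Riem c p u w y)"
    by (simp add: Hz H'_def Riem_def bilinear_rneg[OF bilinear_Gam])
  ultimately show ?thesis by simp
qed

end

subsection \<open>Infinitesimal isometries of a Minkowski norm\<close>

text \<open>The Lie algebra of the group of linear isometries of \<open>N\<close>, described by the
  linear vector fields tangent to the level sets of \<open>N\<close>.\<close>

definition iso_alg :: "(real^3 \<Rightarrow> real) \<Rightarrow> (real^3 \<Rightarrow> real^3) set" where
  "iso_alg N = {B. linear B \<and> (\<forall>y. y \<noteq> 0 \<longrightarrow> frechet_derivative N (at y) (B y) = 0)}"

text \<open>As the common kernel of the whole algebra the axis needs no choice of a generating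
  rotation, so its invariance under isometries is a matter of conjugation.\<close>

definition axis_space :: "(real^3 \<Rightarrow> real) \<Rightarrow> (real^3) set" where
  "axis_space N = {v. \<forall>B \<in> iso_alg N. B v = 0}"

lemma isometry_sym: "isometry N N' L K \<Longrightarrow> isometry N' N K L"
  unfolding isometry_def by metis

lemma isometry_trans:
  "isometry N N' L K \<Longrightarrow> isometry N' N'' L' K' \<Longrightarrow> isometry N N'' (\<lambda>v. L' (L v)) (\<lambda>v. K (K' v))"
  unfolding isometry_def using linear_compose[of L L'] linear_compose[of K' K] by (simp add: o_def)

lemma isometry_inj: "isometry N N' L K \<Longrightarrow> inj L"
  unfolding isometry_def by (metis injI)

lemma isometry_iso_alg:
  assumes iso: "isometry N N' L K" and N: "minkowski N" "minkowski N'" and B: "B \<in> iso_alg N"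
  shows "(\<lambda>v. L (B (K v))) \<in> iso_alg N'"
proof -
  interpret N: minkowski N by fact
  interpret N': minkowski N' by fact
  have L: "linear L" "linear K" and inv: "\<And>v. K (L v) = v" "\<And>v. L (K v) = v" "\<And>v. N' (L v) = N v"
    using iso by (auto simp: isometry_def)
  have lB: "linear B" using B by (simp add: iso_alg_def)
  have "frechet_derivative N' (at y) (L (B (K y))) = 0" if y: "y \<noteq> 0" for y
  proof -
    have Ky: "K y \<noteq> 0" using y inv(2) linear_0[OF L(1)] by metis
    have dL: "L differentiable (at z)" "frechet_derivative L (at z) = L" for z
      using linear_imp_has_derivative[OF L(1), of "at z"] frechet_eqI by (auto simp: differentiable_def)
    have dN: "N' differentiable (at (L (K y)))"
      using smooth_on_differentiable[OF N'.smooth] y by (simp add: inv)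
    have "frechet_derivative N (at (K y)) (B (K y))
        = frechet_derivative (\<lambda>v. N' (L v)) (at (K y)) (B (K y))" by (simp add: inv(3))
    also have "\<dots> = frechet_derivative N' (at y) (L (B (K y)))"
      using frechet_compose[OF dL(1) dN] by (simp add: dL(2) inv(2))
    finally show ?thesis using B Ky by (simp add: iso_alg_def)
  qed
  moreover have "linear (\<lambda>v. L (B (K v)))"
    using linear_compose[OF linear_compose[OF L(2) lB] L(1)] by (simp add: o_def)
  ultimately show ?thesis by (simp add: iso_alg_def)
qed

lemma isometry_axis_space:
  assumes iso: "isometry N N' L K" and N: "minkowski N" "minkowski N'"
  shows "L v \<in> axis_space N' \<longleftrightarrow> v \<in> axis_space N"
proof -
  have imp: "L v \<in> axis_space N'" if "isometry N N' L K" "minkowski N" "minkowski N'" "v \<in> axis_space N" for N N' L K v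
    unfolding axis_space_def
  proof (intro CollectI ballI)
    fix B assume "B \<in> iso_alg N'"
    from isometry_iso_alg[OF isometry_sym[OF that(1)] that(3,2) this]
    have "(\<lambda>v. K (B (L v))) \<in> iso_alg N" .
    moreover have "\<forall>B \<in> iso_alg N. B v = 0" using that(4) by (simp add: axis_space_def)
    ultimately have "K (B (L v)) = 0" by (rule bspec[rotated])
    then show "B (L v) = 0" using that(1) unfolding isometry_def by (metis linear_0)
  qed
  show ?thesis
    using imp[OF iso N] imp[OF isometry_sym[OF iso] N(2,1), of "L v"] iso by (auto simp: isometry_def)
qed

lemma isometry_avg_form:
  assumes "isometry N N' L K" "minkowski N" "minkowski N'"
  shows "avg_form N' (L v) (L w) = avg_form N v w"
  using avg_form_isometry[OF assms(2,3) _ isometry_inj[OF assms(1)]] assms(1) by (simp add: isometry_def)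

text \<open>The components of \<open>b\<close> are the three independent entries of the skew matrix
  of \<open>T\<close>.\<close>

lemma cross3_of_skew:
  fixes T :: "real^3 \<Rightarrow> real^3"
  assumes T: "linear T" and skew: "\<And>v w. v \<bullet> T w + T v \<bullet> w = 0"
  shows "\<exists>b. \<forall>w. T w = cross3 b w"
proof -
  let ?m = "\<lambda>i j. T (axis j 1) $ i"
  have m: "?m i j = - ?m j i" for i j
    using skew[of "axis i 1" "axis j 1"] by (simp add: inner_axis inner_axis')
  have d: "?m i i = 0" for i using m[of i i] by simp
  let ?b = "vector [?m 3 2, ?m 1 3, ?m 2 1] :: real^3"
  have "T w = cross3 ?b w" for w
  proof -
    have "w = w $ 1 *\<^sub>R axis 1 1 + w $ 2 *\<^sub>R axis 2 1 + w $ 3 *\<^sub>R axis 3 1"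
      by (simp add: vec_eq_iff forall_3 axis_def)
    from arg_cong[OF this, of T]
    have "T w = w $ 1 *\<^sub>R T (axis 1 1) + w $ 2 *\<^sub>R T (axis 2 1) + w $ 3 *\<^sub>R T (axis 3 1)"
      by (simp only: linear_add[OF T] linear_scale[OF T])
    then show ?thesis
      using m[of 1 2] m[of 2 3] m[of 3 1] d[of 1] d[of 2] d[of 3]
      by (simp add: cross3_def vec_eq_iff forall_3)
  qed
  then show ?thesis by blast
qed

section \<open>Infinitesimal isometries as rotations of the averaged scalar product\<close>

context minkowski begin

lemma differentiable_N: "y \<noteq> 0 \<Longrightarrow> N differentiable (at y)"
  using smooth_on_differentiable[OF smooth] by simp

lemma euler:
  assumes y: "y \<noteq> 0" shows "frechet_derivative N (at y) y = N y"
proof -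
  have "((\<lambda>s. N (y + s *\<^sub>R y)) has_vector_derivative frechet_derivative N (at (y + 0 *\<^sub>R y)) y) (at 0)"
    by (rule differentiable_line) (use differentiable_N[OF y] in simp)
  moreover have "((\<lambda>s. N (y + s *\<^sub>R y)) has_vector_derivative N y) (at 0)"
  proof (rule has_vector_derivative_transform_within_open[where S="{-1<..}"])
    show "((\<lambda>s. (1 + s) * N y) has_vector_derivative N y) (at 0)"
      unfolding has_real_derivative_iff_has_vector_derivative[symmetric]
      by (auto intro!: derivative_eq_intros)
    show "(1 + r) * N y = N (y + r *\<^sub>R y)" if "r \<in> {-1<..}" for r
      using hom[of "1 + r" y] that by (simp add: algebra_simps)
  qed auto
  ultimately show ?thesis by (simp add: vector_derivative_unique_at)
qed

lemma bounded_bilinear_avg: "bounded_bilinear (avg_form N)"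
  using bilinear_avg_form bilinear_conv_bounded_bilinear by blast

text \<open>\<open>q s\<close> plays the role of the exponential of \<open>s B\<close>, obtained as
  the time-one solution operator for the constant coefficient \<open>s B\<close>. Along a solution
  \<open>N\<close> is constant because its derivative is that of \<open>N\<close> in the direction
  \<open>B y\<close>. The quadratic estimate identifies \<open>B\<close> as the derivative at
  \<open>s = 0\<close>.\<close>

lemma iso_alg_flow:
  assumes B: "B \<in> iso_alg N"
  obtains d q C where "d > 0" "\<And>s. \<bar>s\<bar> < d \<Longrightarrow> linear (q s)" "\<And>s. \<bar>s\<bar> < d \<Longrightarrow> inj (q s)"
    "\<And>s v. \<bar>s\<bar> < d \<Longrightarrow> N (q s v) = N v"
    "\<And>s v. \<bar>s\<bar> < d \<Longrightarrow> norm (q s v - v - s *\<^sub>R B v) \<le> C * s\<^sup>2 * norm v"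
proof -
  have lB: "linear B" and DB: "\<And>y. y \<noteq> 0 \<Longrightarrow> frechet_derivative N (at y) (B y) = 0"
    using B by (auto simp: iso_alg_def)
  define b where "b = Blinfun B"
  have b: "blinfun_apply b v = B v" for v
    using lB by (simp add: b_def bounded_linear_Blinfun_apply linear_conv_bounded_linear)
  define K where "K = norm b + 1"
  have K: "K > 0" "norm b \<le> K" by (auto simp: K_def add_nonneg_pos)
  \<comment> \<open>Then the solution operator stays within 1/2 of the identity, so a nonzero vector
    never reaches the origin, where \<open>N\<close> is not assumed differentiable.\<close>
  define d where "d = 1 / (4 * K)"
  have d: "d > 0" using K by (simp add: d_def)
  have "\<exists>q. inj (blinfun_apply q) \<and> (\<forall>v. N (blinfun_apply q v) = N v) \<and>
      norm (q - id_blinfun - s *\<^sub>R b) \<le> 2 * K\<^sup>2 * s\<^sup>2" if s: "\<bar>s\<bar> < d" for s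
  proof -
    let ?k = "K * \<bar>s\<bar>"
    have k4: "?k \<le> 1 / 4"
    proof -
      have "?k \<le> K * d" using s K by (intro mult_left_mono) auto
      then show ?thesis using K by (simp add: d_def)
    qed
    then have k2: "?k \<le> 1 / 2" by simp
    have nk: "norm (s *\<^sub>R b) \<le> ?k"
      using mult_right_mono[OF K(2), of "\<bar>s\<bar>"] by (simp add: mult.commute)
    obtain P where P: "P 0 = id_blinfun"
      "\<And>t. t \<in> {0..1} \<Longrightarrow> (P has_vector_derivative (s *\<^sub>R b o\<^sub>L P t)) (at t within {0..1})"
      "\<And>t. t \<in> {0..1} \<Longrightarrow> norm (P t - id_blinfun) \<le> 2 * ?k"
      "\<And>L e. (\<And>t. t \<in> {0..1::real} \<Longrightarrow> norm (s *\<^sub>R b - L) \<le> e) \<Longrightarrow> norm (P 1 - id_blinfun - L) \<le> e + 2 * ?k\<^sup>2"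
      using linear_ode_near_identity[OF continuous_on_const[of "{0..1}" "s *\<^sub>R b"] nk k2] by metis
    have near: "norm (blinfun_apply (P t) v - v) \<le> 1 / 2 * norm v" if "t \<in> {0..1}" for t v
    proof -
      have "norm (blinfun_apply (P t - id_blinfun) v) \<le> norm (P t - id_blinfun) * norm v" by (rule norm_blinfun)
      also have "\<dots> \<le> 1 / 2 * norm v" using P(3)[OF that] k4 by (intro mult_right_mono) auto
      finally show ?thesis by (simp add: blinfun.diff_left)
    qed
    have nz: "blinfun_apply (P t) v \<noteq> 0" if "t \<in> {0..1}" "v \<noteq> 0" for t v
      using near[OF that(1), of v] that(2) by auto
    have "inj (blinfun_apply (P 1))"
    proof (rule injI)
      fix v w assume "blinfun_apply (P 1) v = blinfun_apply (P 1) w"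
      then have "blinfun_apply (P 1) (v - w) = 0" by (simp add: blinfun.diff_right)
      then show "v = w" using nz[of 1 "v - w"] by auto
    qed
    moreover have "N (blinfun_apply (P 1) v) = N v" for v
    proof (cases "v = 0")
      case True then show ?thesis by (simp add: blinfun.zero_right)
    next
      case False
      have "((\<lambda>t. N (blinfun_apply (P t) v)) has_derivative (\<lambda>h. 0)) (at t within {0..1})"
        if t: "t \<in> {0..1}" for t
      proof -
        let ?y = "blinfun_apply (P t) v"
        have "((\<lambda>t. blinfun_apply (P t) v) has_vector_derivative s *\<^sub>R B ?y) (at t within {0..1})"
          using bounded_linear.has_vector_derivative[OF blinfun.bounded_linear_left P(2)[OF t], of v]
          by (simp add: b blinfun.scaleR_left)
        then have "((\<lambda>t. blinfun_apply (P t) v) has_derivative (\<lambda>h. h *\<^sub>R s *\<^sub>R B ?y)) (at t within {0..1})"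
          by (simp add: has_vector_derivative_def)
        from has_derivative_compose[OF this has_derivative_frechet[OF differentiable_N[OF nz[OF t False]]]]
        show ?thesis
          using linear_frechet[OF differentiable_N[OF nz[OF t False]]] DB[OF nz[OF t False]]
          by (simp add: linear_scale)
      qed
      from has_derivative_zero_constant[OF _ this]
      obtain c where "\<forall>t\<in>{0..1}. N (blinfun_apply (P t) v) = c" by auto
      then have "N (blinfun_apply (P 1) v) = N (blinfun_apply (P 0) v)" by simp
      then show ?thesis by (simp add: P(1))
    qed
    moreover have "norm (P 1 - id_blinfun - s *\<^sub>R b) \<le> 2 * K\<^sup>2 * s\<^sup>2"
      using P(4)[of "s *\<^sub>R b" 0] by (simp add: power_mult_distrib)
    ultimately show ?thesis by blast
  qed
  then obtain q where q: "\<And>s. \<bar>s\<bar> < d \<Longrightarrow> inj (blinfun_apply (q s))"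
    "\<And>s v. \<bar>s\<bar> < d \<Longrightarrow> N (blinfun_apply (q s) v) = N v"
    "\<And>s. \<bar>s\<bar> < d \<Longrightarrow> norm (q s - id_blinfun - s *\<^sub>R b) \<le> 2 * K\<^sup>2 * s\<^sup>2" by metis
  show thesis
  proof (rule that[OF d, of "\<lambda>s. blinfun_apply (q s)" "2 * K\<^sup>2"])
    show "linear (blinfun_apply (q s))" for s
      by (simp add: bounded_linear.linear blinfun.bounded_linear_right)
    show "norm (blinfun_apply (q s) v - v - s *\<^sub>R B v) \<le> 2 * K\<^sup>2 * s\<^sup>2 * norm v" if "\<bar>s\<bar> < d" for s v
    proof -
      have "blinfun_apply (q s) v - v - s *\<^sub>R B v = blinfun_apply (q s - id_blinfun - s *\<^sub>R b) v"
        by (simp add: blinfun.diff_left blinfun.scaleR_left b)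
      also have "norm \<dots> \<le> norm (q s - id_blinfun - s *\<^sub>R b) * norm v" by (rule norm_blinfun)
      also have "\<dots> \<le> 2 * K\<^sup>2 * s\<^sup>2 * norm v" by (rule mult_right_mono[OF q(3)[OF that]]) simp
      finally show ?thesis .
    qed
  qed (use q in auto)
qed

text \<open>The averaged form is invariant under the isometries \<open>q s\<close>; the identity is
  the derivative of this invariance at \<open>s = 0\<close>.\<close>

lemma iso_alg_skew:
  assumes B: "B \<in> iso_alg N"
  shows "avg_form N v (B w) + avg_form N (B v) w = 0"
proof -
  obtain d q C where q: "d > 0" "\<And>s. \<bar>s\<bar> < d \<Longrightarrow> linear (q s)" "\<And>s. \<bar>s\<bar> < d \<Longrightarrow> inj (q s)"
    "\<And>s v. \<bar>s\<bar> < d \<Longrightarrow> N (q s v) = N v"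
    "\<And>s v. \<bar>s\<bar> < d \<Longrightarrow> norm (q s v - v - s *\<^sub>R B v) \<le> C * s\<^sup>2 * norm v"
    using iso_alg_flow[OF B] by metis
  have q0: "q 0 v = v" for v using q(5)[of 0 v] q(1) by simp
  have dq: "((\<lambda>s. q s v) has_derivative (\<lambda>s. s *\<^sub>R B v)) (at 0)" for v
    unfolding has_derivative_at_alt
  proof (intro conjI allI impI)
    show "bounded_linear (\<lambda>s. s *\<^sub>R B v)" by (rule bounded_linear_scaleR_left)
    fix e :: real assume e: "e > 0"
    define M where "M = \<bar>C\<bar> * norm v + 1"
    have M: "M > 0" "C * norm v \<le> M"
      using mult_right_mono[OF abs_ge_self[of C] norm_ge_zero[of v]] by (auto simp: M_def add_nonneg_pos)
    have "norm (q s v - q 0 v - (s - 0) *\<^sub>R B v) \<le> e * norm (s - 0)" if "norm (s - 0) < min d (e / M)" for s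
    proof -
      have s: "\<bar>s\<bar> < d" "\<bar>s\<bar> \<le> e / M" using that by auto
      have "norm (q s v - v - s *\<^sub>R B v) \<le> C * s\<^sup>2 * norm v" by (rule q(5)[OF s(1)])
      also have "\<dots> = (C * norm v) * (\<bar>s\<bar> * \<bar>s\<bar>)" by (simp add: power2_eq_square)
      also have "\<dots> \<le> M * (\<bar>s\<bar> * \<bar>s\<bar>)" using M by (intro mult_right_mono) auto
      also have "\<dots> \<le> M * (e / M * \<bar>s\<bar>)" using M s by (intro mult_left_mono mult_right_mono) auto
      also have "\<dots> = e * \<bar>s\<bar>" using M by simp
      finally show ?thesis by (simp add: q0)
    qed
    moreover have "min d (e / M) > 0" using q(1) e M by simp
    ultimately show "\<exists>d>0. \<forall>s. norm (s - 0) < d \<longrightarrow> norm (q s v - q 0 v - (s - 0) *\<^sub>R B v) \<le> e * norm (s - 0)"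
      by blast
  qed
  have 1: "((\<lambda>s. avg_form N (q s v) (q s w)) has_derivative
      (\<lambda>s. avg_form N (q 0 v) (s *\<^sub>R B w) + avg_form N (s *\<^sub>R B v) (q 0 w))) (at 0)"
    by (rule bounded_bilinear.FDERIV[OF bounded_bilinear_avg dq dq])
  have 2: "((\<lambda>s. avg_form N (q s v) (q s w)) has_derivative (\<lambda>s. 0)) (at 0)"
  proof (rule has_derivative_transform_within_open[OF has_derivative_const])
    have mN: "minkowski N" by unfold_locales
    show "avg_form N v w = avg_form N (q s v) (q s w)" if "s \<in> ball 0 d" for s
      using avg_form_isometry[OF mN mN q(2) q(3) q(4), of s v w] that by simp
  qed (use q(1) in auto)
  from fun_cong[OF has_derivative_unique[OF 1 2], of 1] show ?thesis by (simp add: q0)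
qed

text \<open>Index lowering by the averaged form. It turns an endomorphism skew for that form into
  one skew for the standard inner product, where it is a cross product with a fixed vector.\<close>

definition flat_map :: "real^3 \<Rightarrow> real^3" where "flat_map w = (\<chi> i. avg_form N (axis i 1) w)"

lemma inner_flat_map: "v \<bullet> flat_map w = avg_form N v w"
proof -
  have "linear (\<lambda>v. avg_form N v w)" using bilinear_avg_form by (simp add: bilinear_def)
  from linear_axis_sum[OF this, of v] show ?thesis by (simp add: flat_map_def inner_vec_def)
qed

lemma linear_flat_map: "linear flat_map"
  unfolding flat_map_def using bilinear_avg_form
  by (intro linearI) (simp_all add: vec_eq_iff bilinear_radd bilinear_rmul)

lemma flat_map_eq_0: "flat_map w = 0 \<longleftrightarrow> w = 0"
  using inner_flat_map[of w w] avg_form_pos[of w] linear_0[OF linear_flat_map] by fastforce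

lemma inj_flat_map: "inj flat_map"
  using linear_injective_0[OF linear_flat_map] flat_map_eq_0 by blast

lemma iso_alg_cross:
  assumes B: "B \<in> iso_alg N"
  obtains b where "\<And>w. flat_map (B w) = cross3 b w"
proof -
  have "linear (\<lambda>w. flat_map (B w))"
    using linear_compose[OF _ linear_flat_map, of B] B by (simp add: iso_alg_def o_def)
  moreover have "v \<bullet> flat_map (B w) + flat_map (B v) \<bullet> w = 0" for v w
    using iso_alg_skew[OF B, of v w] avg_form_symmetric[of w "B v"]
    by (simp add: inner_flat_map inner_commute[of _ w])
  ultimately show thesis using cross3_of_skew[of "\<lambda>w. flat_map (B w)"] that by blast
qed

text \<open>Away from the plane spanned by the two rotation axes, the two infinitesimal rotations
  span the orthogonal complement of \<open>y\<close>, so that \<open>N\<close> is constant along spheres of the averaged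
  scalar product.\<close>

lemma two_rotations_kill:
  assumes B: "B1 \<in> iso_alg N" "B2 \<in> iso_alg N"
    and b: "\<And>w. flat_map (B1 w) = cross3 b1 w" "\<And>w. flat_map (B2 w) = cross3 b2 w"
    and n: "cross3 b1 b2 \<bullet> y \<noteq> 0"
    and x: "avg_form N y x = 0"
  shows "frechet_derivative N (at y) x = 0"
proof -
  have y: "y \<noteq> 0" using n by auto
  obtain k where k: "linear k" "\<And>v. k (flat_map v) = v" "\<And>v. flat_map (k v) = v"
    using linear_injective_isomorphism[OF linear_flat_map inj_flat_map] by blast
  \<comment> \<open>The differential of \<open>N\<close> in lowered coordinates; there the two
    infinitesimal isometries send \<open>y\<close> to \<open>cross3 b1 y\<close> and
    \<open>cross3 b2 y\<close>.\<close>
  define D where "D z = frechet_derivative N (at y) (k z)" for z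
  have lD: "linear D"
    unfolding D_def using linear_compose[OF k(1) linear_frechet[OF differentiable_N[OF y]]] by (simp add: o_def)
  define l where "l = (\<chi> i. D (axis i 1))"
  have l: "D z = l \<bullet> z" for z
    using linear_axis_sum[OF lD, of z] by (simp add: l_def inner_vec_def mult.commute)
  have "D (cross3 b1 y) = 0" "D (cross3 b2 y) = 0"
    using B y by (simp_all add: D_def b[symmetric] k iso_alg_def)
  then have l0: "l \<bullet> cross3 b1 y = 0" "l \<bullet> cross3 b2 y = 0" by (simp_all add: l)
  \<comment> \<open>This vector is orthogonal to \<open>b1\<close> and \<open>b2\<close>, hence
    parallel to \<open>cross3 b1 b2\<close>, and it is orthogonal to \<open>y\<close>. As
    \<open>y\<close> is not orthogonal to \<open>cross3 b1 b2\<close>, it must vanish, so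
    \<open>l\<close> is a multiple of \<open>y\<close>.\<close>
  let ?m = "cross3 y l"
  have "b1 \<bullet> ?m = l \<bullet> cross3 b1 y" "b2 \<bullet> ?m = l \<bullet> cross3 b2 y"
    by (simp_all add: cross3_simps)
  then have m0: "b1 \<bullet> ?m = 0" "b2 \<bullet> ?m = 0" using l0 by simp_all
  have ym: "y \<bullet> ?m = 0" by (rule dot_cross_self)
  have "cross3 (cross3 b1 b2) m = (b1 \<bullet> m) *\<^sub>R b2 - (b2 \<bullet> m) *\<^sub>R b1" for m
    by (simp add: cross3_simps forall_3)
  then have nm: "cross3 (cross3 b1 b2) ?m = 0" using m0 by simp
  have "cross3 y (cross3 n m) = (y \<bullet> m) *\<^sub>R n - (n \<bullet> y) *\<^sub>R m" for n m :: "real^3"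
    by (simp add: cross3_simps forall_3)
  from this[of "cross3 b1 b2" ?m] have "(cross3 b1 b2 \<bullet> y) *\<^sub>R ?m = 0" using nm ym by simp
  then have "?m = 0" using n by simp
  moreover have "cross3 y (cross3 y l) = (y \<bullet> l) *\<^sub>R y - (y \<bullet> y) *\<^sub>R l"
    by (simp add: cross3_simps forall_3)
  ultimately have "(y \<bullet> y) *\<^sub>R l = (y \<bullet> l) *\<^sub>R y" by simp
  then have "(y \<bullet> y) * (l \<bullet> flat_map x) = (y \<bullet> l) * (y \<bullet> flat_map x)"
    by (metis inner_scaleR_left)
  then have "l \<bullet> flat_map x = 0" using x y by (simp add: inner_flat_map)
  then show ?thesis using l[of "flat_map x"] by (simp add: D_def k)
qed

text \<open>The differential of \<open>N\<close> vanishes on the complement of \<open>y\<close> with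
  respect to the averaged form, and the Euler relation gives its value on \<open>y\<close>. Together
  they determine it completely and make the quotient of \<open>N^2\<close> by the averaged form
  locally constant.\<close>

lemma two_rotations_quadratic:
  assumes B: "B1 \<in> iso_alg N" "B2 \<in> iso_alg N"
    and b: "\<And>w. flat_map (B1 w) = cross3 b1 w" "\<And>w. flat_map (B2 w) = cross3 b2 w"
    and n: "cross3 b1 b2 \<noteq> 0"
  shows "\<exists>Q. bilinear Q \<and> (\<forall>v. (N v)\<^sup>2 = Q v v)"
proof -
  let ?g = "avg_form N" and ?n = "cross3 b1 b2"
  \<comment> \<open>The argument is the component of \<open>x\<close> orthogonal to
    \<open>y\<close>, multiplied by \<open>?g y y\<close> to avoid a division.\<close>
  define D where "D x y = frechet_derivative N (at y) (?g y y *\<^sub>R x - ?g y x *\<^sub>R y)" for x y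
  have D1: "D x y = ?g y y * frechet_derivative N (at y) x - ?g y x * N y" if "y \<noteq> 0" for x y
    using linear_frechet[OF differentiable_N[OF that]] euler[OF that]
    by (simp add: D_def linear_diff linear_scale)
  have D0: "D x y = 0" if "?n \<bullet> y \<noteq> 0" for x y
    unfolding D_def
    by (rule two_rotations_kill[OF B b that])
      (simp add: bilinear_rsub[OF bilinear_avg_form] bilinear_rmul[OF bilinear_avg_form])
  have Dz: "D x y = 0" if y: "y \<noteq> 0" for x y
  proof (cases "?n \<bullet> y = 0")
    case True
    \<comment> \<open>Points of the plane orthogonal to \<open>?n\<close> are limits of the points
      \<open>y + s ?n\<close> off the plane, where the claim is known.\<close>
    have cont: "continuous_on (- {0}) (\<lambda>y. ?g y y * frechet_derivative N (at y) x - ?g y x * N y)"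
      by (intro continuous_intros bounded_bilinear.continuous_on[OF bounded_bilinear_avg]
          smooth_on_continuous[OF smooth_on_frechet[OF smooth]] smooth_on_continuous[OF smooth])
    have cont: "continuous_on (- {0}) (D x)"
      by (rule continuous_on_eq[OF cont]) (simp add: D1)
    then have "isCont (D x) y" using y open_nz by (simp add: continuous_on_eq_continuous_at)
    moreover have "((\<lambda>s. y + s *\<^sub>R ?n) \<longlongrightarrow> y + 0 *\<^sub>R ?n) (at_right 0)"
      by (intro tendsto_intros)
    ultimately have lim: "((\<lambda>s. D x (y + s *\<^sub>R ?n)) \<longlongrightarrow> D x y) (at_right 0)"
      by (intro isCont_tendsto_compose[of y "D x"]) auto
    have "eventually (\<lambda>s. D x (y + s *\<^sub>R ?n) = 0) (at_right (0 :: real))"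
      using eventually_at_right_less[of "0 :: real"]
      by eventually_elim (use n True in \<open>auto intro!: D0 simp: inner_add_right\<close>)
    then have "((\<lambda>s. D x (y + s *\<^sub>R ?n)) \<longlongrightarrow> 0) (at_right (0 :: real))"
      by (rule tendsto_eventually)
    from tendsto_unique[OF _ lim this] show ?thesis by simp
  qed (rule D0)
  define r where "r y = (N y)\<^sup>2 / ?g y y" for y
  have gpos: "?g y y > 0" if "y \<noteq> 0" for y using avg_form_pos[OF that] .
  have "(r has_derivative (\<lambda>x. 0)) (at y)" if y: "y \<in> - {0}" for y
  proof -
    have y0: "y \<noteq> 0" using y by simp
    have dN: "(N has_derivative frechet_derivative N (at y)) (at y)"
      by (rule has_derivative_frechet[OF differentiable_N[OF y0]])
    have dg: "((\<lambda>y. ?g y y) has_derivative (\<lambda>x. ?g y x + ?g x y)) (at y)"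
      by (rule bounded_bilinear.FDERIV[OF bounded_bilinear_avg has_derivative_ident has_derivative_ident])
    have "(r has_derivative (\<lambda>x. - (N y)\<^sup>2 * (inverse (?g y y) * (?g y x + ?g x y) * inverse (?g y y))
        + 2 * frechet_derivative N (at y) x * N y / ?g y y)) (at y)"
      unfolding r_def[abs_def]
      by (rule has_derivative_eq_rhs[OF has_derivative_divide[OF has_derivative_power[OF dN, of 2] dg]])
        (use gpos[OF y0] in \<open>auto simp: fun_eq_iff\<close>)
    moreover have "- (N y)\<^sup>2 * (inverse (?g y y) * (?g y x + ?g x y) * inverse (?g y y))
        + 2 * frechet_derivative N (at y) x * N y / ?g y y = 0" for x
    proof -
      have e: "?g y y * frechet_derivative N (at y) x = ?g y x * N y" using Dz[OF y0, of x] D1[OF y0, of x] by simp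
      then have "frechet_derivative N (at y) x = ?g y x * N y / ?g y y" using gpos[OF y0] by (simp add: field_simps)
      then show ?thesis
        using gpos[OF y0] avg_form_symmetric[of x y] by (simp add: field_simps power2_eq_square)
    qed
    ultimately show ?thesis by simp
  qed
  note dr = this
  have conn: "connected (- {0 :: real^3})" by (rule connected_punctured_universe) simp
  define k where "k = r (axis 1 1)"
  have rk: "r y = k" if "y \<noteq> 0" for y
    unfolding k_def
    by (rule has_derivative_zero_unique_connected[OF open_nz conn dr]) (use that in \<open>auto simp: axis_eq_0_iff\<close>)
  have "(N v)\<^sup>2 = k * ?g v v" for v
  proof (cases "v = 0")
    case True
    then show ?thesis by (simp add: zero bilinear_lzero[OF bilinear_avg_form])
  next
    case False
    then show ?thesis using rk[OF False] gpos[OF False] by (simp add: r_def nonzero_divide_eq_eq)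
  qed
  moreover have "bilinear (\<lambda>v w. k * ?g v w)"
    unfolding bilinear_def
    by (intro conjI allI linearI)
      (simp_all add: bilinear_ladd[OF bilinear_avg_form] bilinear_radd[OF bilinear_avg_form]
        bilinear_lmul[OF bilinear_avg_form] bilinear_rmul[OF bilinear_avg_form] algebra_simps)
  ultimately show ?thesis by blast
qed

text \<open>If the axis of another element were not parallel to that of \<open>B0\<close>, the
  square of \<open>N\<close> would be quadratic. Hence every element kills the axis of
  \<open>B0\<close>, while the kernel of \<open>B0\<close> is no larger than this axis.\<close>

lemma axis_space_line:
  assumes nq: "\<not> (\<exists>Q. bilinear Q \<and> (\<forall>v. (N v)\<^sup>2 = Q v v))"
    and B0: "B0 \<in> iso_alg N" "B0 v0 \<noteq> 0"
  obtains b where "b \<noteq> 0" "axis_space N = span {b}"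
proof -
  obtain b where b: "\<And>w. flat_map (B0 w) = cross3 b w" using iso_alg_cross[OF B0(1)] by blast
  have nz: "b \<noteq> 0" using b[of v0] B0(2) flat_map_eq_0[of "B0 v0"] by auto
  have "B b = 0" if B: "B \<in> iso_alg N" for B
  proof -
    obtain b' where b': "\<And>w. flat_map (B w) = cross3 b' w" using iso_alg_cross[OF B] by blast
    have "cross3 b' b = 0" using two_rotations_quadratic[OF B B0(1) b' b] nq by blast
    then show ?thesis using b'[of b] flat_map_eq_0 by simp
  qed
  then have 1: "b \<in> axis_space N" by (simp add: axis_space_def)
  have lin: "linear B" if "B \<in> iso_alg N" for B using that by (simp add: iso_alg_def)
  have "axis_space N = span {b}"
  proof
    show "span {b} \<subseteq> axis_space N"
      using 1 lin by (auto simp: span_singleton axis_space_def linear_scale)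
    show "axis_space N \<subseteq> span {b}"
    proof
      fix v assume "v \<in> axis_space N"
      then have "B0 v = 0" using B0(1) by (simp add: axis_space_def)
      then have "cross3 b v = 0" using b[of v] linear_0[OF linear_flat_map] by simp
      then have "collinear {0, b, v}" by (simp add: cross_eq_0)
      then show "v \<in> span {b}" using nz by (auto simp: collinear_lemma span_singleton)
    qed
  qed
  with nz that show thesis by blast
qed

end

section \<open>Derivatives at a shifted base point and unit vectors on a line\<close>

lemma has_derivative_shift:
  assumes "((\<lambda>u. f (x + u)) has_derivative f') (at 0)"
  shows "(f has_derivative f') (at x)"
proof -
  have g: "((\<lambda>y. y - x) has_derivative (\<lambda>u. u)) (at x)" by (auto intro!: derivative_eq_intros)
  have "((\<lambda>u. f (x + u)) has_derivative f') (at (x - x))" using assms by simp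
  from has_derivative_compose[OF g this] show ?thesis by simp
qed

lemma has_derivative_shift_iff:
  "((\<lambda>u. f (x + u)) has_derivative f') (at 0) \<longleftrightarrow> (f has_derivative f') (at x)"
proof
  assume f: "(f has_derivative f') (at x)"
  have g: "((\<lambda>u. x + u) has_derivative (\<lambda>u. u)) (at 0)" by (auto intro!: derivative_eq_intros)
  have "(f has_derivative f') (at (x + 0))" using f by simp
  from has_derivative_compose[OF g this] show "((\<lambda>u. f (x + u)) has_derivative f') (at 0)" by simp
qed (rule has_derivative_shift)

lemma isCont_eventually_pos:
  fixes f :: "'a::t2_space \<Rightarrow> real"
  assumes "isCont f x" "f x > 0"
  shows "eventually (\<lambda>y. f y > 0) (nhds x)"
  using assms order_tendstoD(1)[of f "f x" "nhds x" 0]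
  by (simp add: isCont_def tendsto_at_iff_tendsto_nhds)

text \<open>A product rule for \<open>Q u\<close> applied to a moving vector. Only
  \<open>u \<mapsto> Q u y\<close> with fixed \<open>y\<close> is known to be differentiable, hence
  the basis expansion.\<close>

lemma near_identity_apply:
  fixes Q :: "'a::euclidean_space \<Rightarrow> 'a \<Rightarrow> 'a"
  assumes B: "bilinear B" and d: "d > 0" and Q: "\<And>u. norm u < d \<Longrightarrow> linear (Q u)"
    and dQ: "\<And>y. ((\<lambda>u. Q u y) has_derivative (\<lambda>u. B u y)) (at 0)" and Q0: "\<And>y. Q 0 y = y"
    and h: "(h has_derivative h') (at 0)"
  shows "((\<lambda>u. Q u (h u)) has_derivative (\<lambda>u. h' u + B u (h 0))) (at 0)"
proof -
  have hb: "((\<lambda>z. h z \<bullet> b) has_derivative (\<lambda>v. h' v \<bullet> b)) (at 0)" for b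
    using bounded_linear.has_derivative[OF bounded_linear_inner_left h] .
  have "((\<lambda>u. \<Sum>b\<in>Basis. (h u \<bullet> b) *\<^sub>R Q u b) has_derivative
      (\<lambda>u. \<Sum>b\<in>Basis. (h 0 \<bullet> b) *\<^sub>R B u b + (h' u \<bullet> b) *\<^sub>R Q 0 b)) (at 0)"
    by (intro has_derivative_sum has_derivative_scaleR hb dQ)
  moreover have "(\<Sum>b\<in>Basis. (h 0 \<bullet> b) *\<^sub>R B u b + (h' u \<bullet> b) *\<^sub>R Q 0 b) = h' u + B u (h 0)" for u
  proof -
    have "linear (B u)" using B by (simp add: bilinear_def)
    from linear_basis_sum[OF this, of "h 0"] show ?thesis
      by (simp add: Q0 sum.distrib euclidean_representation)
  qed
  ultimately have *: "((\<lambda>u. \<Sum>b\<in>Basis. (h u \<bullet> b) *\<^sub>R Q u b) has_derivative (\<lambda>u. h' u + B u (h 0))) (at 0)"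
    by simp
  show ?thesis
  proof (rule has_derivative_transform_within_open[OF *, of "ball 0 d"])
    show "(\<Sum>b\<in>Basis. (h u \<bullet> b) *\<^sub>R Q u b) = Q u (h u)" if "u \<in> ball 0 d" for u
      using linear_basis_sum[OF Q[of u], of "h u"] that by simp
  qed (use d in auto)
qed

text \<open>Two vectors of equal length on a line agree up to sign, and the functional
  \<open>f\<close> decides the sign. This identifies a section of the axis distribution with the
  parallel transport of its value.\<close>

lemma line_unit_unique:
  assumes S: "S = span {b}" and g: "bilinear g" "\<And>v. v \<noteq> 0 \<Longrightarrow> g v v > (0 :: real)"
    and vw: "v \<in> S" "w \<in> S" "g v v = g w w" and f: "linear f" "f v > (0 :: real)" "f w > 0"
  shows "v = w"
proof -
  obtain s t where st: "v = s *\<^sub>R b" "w = t *\<^sub>R b" using vw S by (auto simp: span_singleton)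
  have b: "b \<noteq> 0" using f linear_0[OF f(1)] st by auto
  have "s * s * g b b = t * t * g b b"
    using vw(3) by (simp add: st bilinear_lmul[OF g(1)] bilinear_rmul[OF g(1)])
  then have "s * s = t * t" using g(2)[OF b] by simp
  then have "s = t \<or> s = - t" by (simp add: square_eq_iff)
  moreover have "s \<noteq> - t"
    using f(2,3) by (auto simp: st linear_scale[OF f(1)] linear_neg[OF f(1)])
  ultimately show ?thesis using st by simp
qed

section \<open>The averaged metric on the manifold and the isometry of all tangent spaces\<close>

context finsler_connection begin

definition avg :: "'m \<Rightarrow> real^3 \<Rightarrow> real^3 \<Rightarrow> real" where "avg p = avg_form (F p)"

lemma avg_metric_eq: "avg_metric F p = avg p"
  by (simp add: avg_def avg_metric_form)

lemma bilinear_avg: "bilinear (avg p)"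
  by (simp add: avg_def bilinear_avg_form)

lemma avg_pos: "v \<noteq> 0 \<Longrightarrow> avg p v v > 0"
  unfolding avg_def by (rule minkowski.avg_form_pos[OF minkowski_F])

lemma avg_sym: "avg p v w = avg p w v"
  unfolding avg_def by (rule minkowski.avg_form_symmetric[OF minkowski_F])

definition rot_axis :: "'m \<Rightarrow> (real^3) set" where "rot_axis p = axis_space (F p)"

text \<open>Transport inside a chart ball makes each isometry class of points open. The complement
  of a class is open by the same argument, so connectedness leaves a single class.\<close>

lemma isometric:
  assumes conn: "connected (UNIV :: 'm set)"
  shows "\<exists>L K. isometry (F p) (F q) L K"
proof -
  let ?I = "\<lambda>p q. \<exists>L K. isometry (F p) (F q) L K"
  have nb: "\<exists>W. open W \<and> p \<in> W \<and> (\<forall>q\<in>W. ?I p q)" for p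
  proof -
    let ?c = "chart_at A p"
    let ?x = "cmap ?c p"
    obtain d Q P where tf: "transport_family ?c p d Q P"
      using transport_family_exists[OF chart_at[of p]] by blast
    note Q = transport_familyD[OF tf]
    have B: "y \<in> cmap ?c ` cdom ?c \<and> ?I p (cinv ?c y)" if "y \<in> ball ?x d" for y
      using Q(2,3)[of "y - ?x"] that by (auto simp: dist_norm norm_minus_commute)
    have "open (cinv ?c ` ball ?x d)" by (rule open_cinv_image[OF chart_at(1)]) (use B in auto)
    moreover have "p \<in> cinv ?c ` ball ?x d"
      using Q(1) cinv_cmap[OF chart_at, of p] by (metis centre_in_ball imageI)
    ultimately show ?thesis using B by blast
  qed
  have sym: "?I p q \<Longrightarrow> ?I q p" for p q using isometry_sym by blast
  have trans: "?I p q \<Longrightarrow> ?I q r \<Longrightarrow> ?I p r" for p q r using isometry_trans by blast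
  let ?C = "{q. ?I p q}"
  have "open ?C"
    unfolding open_subopen[of ?C]
  proof
    fix q assume q: "q \<in> ?C"
    obtain W where W: "open W" "q \<in> W" "\<forall>r\<in>W. ?I q r" using nb[of q] by (elim exE conjE)
    have "r \<in> ?C" if "r \<in> W" for r
      unfolding mem_Collect_eq by (rule trans[of p q r]) (use q W(3) that in simp_all)
    then show "\<exists>T. open T \<and> q \<in> T \<and> T \<subseteq> ?C" using W(1,2) by (intro exI[of _ W]) auto
  qed
  moreover have "open (- ?C)"
    unfolding open_subopen[of "- ?C"]
  proof
    fix q assume q: "q \<in> - ?C"
    obtain W where W: "open W" "q \<in> W" "\<forall>r\<in>W. ?I q r" using nb[of q] by (elim exE conjE)
    have "r \<in> - ?C" if r: "r \<in> W" for r
    proof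
      assume "r \<in> ?C"
      then have "?I p q" using trans[of p r q] sym[of q r] bspec[OF W(3) r] by simp
      then show False using q by simp
    qed
    then show "\<exists>T. open T \<and> q \<in> T \<and> T \<subseteq> - ?C" using W(1,2) by (intro exI[of _ W]) auto
  qed
  moreover have "p \<in> ?C" using nb[of p] by auto
  moreover have "\<forall>T :: 'm set. open T \<and> open (- T) \<longrightarrow> T = {} \<or> T = UNIV"
    using conn unfolding connected_clopen by (auto simp: closed_def)
  ultimately have "?C = UNIV" by (metis empty_iff)
  then have "q \<in> ?C" by (rule ssubst) (rule UNIV_I)
  then show ?thesis by simp
qed

end

section \<open>The distribution of rotation axes\<close>

locale nonflat_finsler_connection = finsler_connection A nabla F
  for A :: "'m::{t2_space, second_countable_topology} chart set" and nabla :: "'m connection"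
    and F :: "'m \<Rightarrow> real^3 \<Rightarrow> real" +
  assumes conn_space: "connected (UNIV :: 'm set)" and nonriem: "\<not> riemannian F"
    and nonflat: "\<not> flat A nabla"
    and antisym: "antisymmetric_torsion A (avg_metric F) nabla"
begin

text \<open>A quadratic form at one point pulls back along isometries to every other point,
  contradicting that \<open>F\<close> is not Riemannian.\<close>

lemma not_quadratic: "\<not> (\<exists>B. bilinear B \<and> (\<forall>v. (F q v)\<^sup>2 = B v v))"
proof
  assume "\<exists>B. bilinear B \<and> (\<forall>v. (F q v)\<^sup>2 = B v v)"
  then obtain B where B: "bilinear B" "\<And>v. (F q v)\<^sup>2 = B v v" by blast
  obtain p where p: "\<not> (\<exists>B. bilinear B \<and> (\<forall>v. (F p v)\<^sup>2 = B v v))"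
    using nonriem by (auto simp: riemannian_def)
  obtain L K where "isometry (F p) (F q) L K" using isometric[OF conn_space] by blast
  then have L: "linear L" "\<And>v. F q (L v) = F p v" by (auto simp: isometry_def)
  have "bilinear (\<lambda>v w. B (L v) (L w))"
    unfolding bilinear_def
    by (intro conjI allI linearI) (simp_all add: linear_add[OF L(1)] linear_scale[OF L(1)]
        bilinear_ladd[OF B(1)] bilinear_radd[OF B(1)] bilinear_lmul[OF B(1)] bilinear_rmul[OF B(1)])
  moreover have "(F p v)\<^sup>2 = B (L v) (L v)" for v using B(2)[of "L v"] L(2) by simp
  ultimately show False using p by blast
qed

text \<open>Curvature is only known to be nonzero at some point \<open>p\<close>. There it gives a
  nonzero infinitesimal isometry, and conjugation by an isometry carries it to
  \<open>q\<close>.\<close>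

lemma iso_alg_nontrivial: "\<exists>B v. B \<in> iso_alg (F q) \<and> B v \<noteq> 0"
proof -
  obtain U X Y Z p where U: "open U" "p \<in> U" and X: "smooth_vf_on A U X" and Y: "smooth_vf_on A U Y"
    and Z: "smooth_vf_on A U Z" and nz: "curvature A nabla X Y Z p \<noteq> 0"
    using nonflat by (auto simp: flat_def)
  let ?c = "chart_at A p"
  have c: "?c \<in> A" "p \<in> cdom ?c" by (rule chart_at)+
  let ?B = "Riem ?c p (X p) (Y p)"
  have Bnz: "?B (Z p) \<noteq> 0" using nz by (simp add: curvature_chart[OF U X Y Z])
  have "frechet_derivative (F p) (at y) (?B y) = 0" if y: "y \<noteq> 0" for y
  proof -
    let ?z = "(cmap ?c p, y)"
    have zT: "?z \<in> (cmap ?c ` cdom ?c) \<times> (- {0})" using c y by blast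
    have diff: "Fc ?c differentiable (at ?z)"
      by (rule smooth_on_differentiable[OF smooth_Fc[OF c(1)] zT])
    have eq: "F p = (\<lambda>y. Fc ?c (cmap ?c p, y))"
      using tcoord_chart_at(2)[OF atlas, of p] by (simp add: finsler_coord_def cinv_cmap[OF c] fun_eq_iff)
    have gd: "((\<lambda>y. (cmap ?c p, y)) has_derivative (\<lambda>v. (0, v))) (at y)"
      by (intro has_derivative_Pair) (auto intro!: derivative_eq_intros)
    have "((\<lambda>y. Fc ?c (cmap ?c p, y)) has_derivative (\<lambda>v. frechet_derivative (Fc ?c) (at ?z) (0, v))) (at y)"
      by (rule has_derivative_compose[OF gd has_derivative_frechet[OF diff]])
    from frechet_eqI[OF this] show ?thesis
      using Riem_kills[OF c y, of "X p" "Y p"] by (simp add: eq)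
  qed
  then have B: "?B \<in> iso_alg (F p)" using linear_Riem[OF c] by (simp add: iso_alg_def)
  obtain L K where iso: "isometry (F p) (F q) L K" using isometric[OF conn_space] by blast
  have "(\<lambda>v. L (?B (K v))) \<in> iso_alg (F q)"
    by (rule isometry_iso_alg[OF iso minkowski_F minkowski_F B])
  moreover have "L (?B (K (L (Z p)))) \<noteq> 0" using iso Bnz unfolding isometry_def by (metis linear_0)
  ultimately show ?thesis by blast
qed

lemma rot_axis_line: "\<exists>b. b \<noteq> 0 \<and> rot_axis q = span {b}"
proof -
  obtain B v where B: "B \<in> iso_alg (F q)" "B v \<noteq> 0" using iso_alg_nontrivial by blast
  show ?thesis
    unfolding rot_axis_def using minkowski.axis_space_line[OF minkowski_F not_quadratic B] by metis
qed

text \<open>The transported vector \<open>P u a\<close> again lies on the axis, has the same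
  averaged length and, for small \<open>u\<close>, lies on the same side of the plane orthogonal to
  \<open>e\<close>. So it coincides with \<open>h u\<close>, and \<open>h\<close> inherits the
  derivative of \<open>P u a\<close>. The vector \<open>e\<close> only serves to fix a sign.\<close>

lemma section_has_derivative:
  assumes c: "c \<in> A" "p \<in> cdom c" and a: "tvec A c p a \<in> rot_axis p" "a \<bullet> e > 0"
    and ev: "eventually (\<lambda>u. tvec A c (cinv c (cmap c p + u)) (h u) \<in> rot_axis (cinv c (cmap c p + u)) \<and>
      avg (cinv c (cmap c p + u)) (tvec A c (cinv c (cmap c p + u)) (h u)) (tvec A c (cinv c (cmap c p + u)) (h u))
        = avg p (tvec A c p a) (tvec A c p a) \<and> h u \<bullet> e > 0) (nhds 0)"
  shows "(h has_derivative (\<lambda>u. - Gam c p u a)) (at 0)"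
proof -
  let ?x = "cmap c p" and ?q = "\<lambda>u. cinv c (cmap c p + u)"
  obtain d Q P where tf: "transport_family c p d Q P"
    using transport_family_exists[OF c] by blast
  note Q = transport_familyD[OF tf]
  have "isCont (\<lambda>u. P u a \<bullet> e) 0"
    by (intro continuous_intros has_derivative_continuous[OF Q(6)])
  then have "eventually (\<lambda>u. P u a \<bullet> e > 0) (nhds 0)"
    by (rule isCont_eventually_pos) (simp add: Q(8) a(2))
  moreover have "eventually (\<lambda>u. norm u < d) (nhds (0 :: real^3))"
    using Q(1) by (auto simp: eventually_nhds_metric)
  ultimately have "eventually (\<lambda>u. P u a = h u) (nhds 0)"
    using ev
  proof eventually_elim
    case (elim u)
    have x: "?x + u \<in> cmap c ` cdom c" by (rule Q(2)[OF elim(2)])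
    have q: "?q u \<in> cdom c" by (rule cinv_in[OF x])
    note iso = Q(3)[OF elim(2)]
    have 1: "tvec A c (?q u) (P u a) \<in> rot_axis (?q u)"
      using isometry_axis_space[OF iso minkowski_F minkowski_F, of "tvec A c p a"] a(1)
      by (simp add: rot_axis_def tcoord_tvec_self[OF c])
    have 2: "avg (?q u) (tvec A c (?q u) (P u a)) (tvec A c (?q u) (P u a)) = avg p (tvec A c p a) (tvec A c p a)"
      using isometry_avg_form[OF iso minkowski_F minkowski_F, of "tvec A c p a" "tvec A c p a"]
      by (simp add: avg_def tcoord_tvec_self[OF c])
    have f: "linear (\<lambda>v. tcoord A c (?q u) v \<bullet> e)"
      using linear_tcoord[OF c(1) q] by (intro linearI) (simp_all add: linear_add linear_scale inner_add_left)
    obtain b where b: "rot_axis (?q u) = span {b}" using rot_axis_line by blast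
    have "tvec A c (?q u) (P u a) = tvec A c (?q u) (h u)"
      by (rule line_unit_unique[OF b bilinear_avg[of "?q u"] avg_pos 1 _ _ f])
        (use elim 2 in \<open>auto simp: tcoord_tvec_self[OF c(1) q]\<close>)
    then show ?case by (metis tcoord_tvec_self[OF c(1) q])
  qed
  then obtain T where T: "open T" "0 \<in> T" "\<And>u. u \<in> T \<Longrightarrow> P u a = h u"
    by (auto simp: eventually_nhds)
  show ?thesis by (rule has_derivative_transform_within_open[OF Q(6) T])
qed

text \<open>Near \<open>p\<close> the unit vector on the axis lying on the side of \<open>a\<close>
  is chosen pointwise. At every point of the ball \<open>section_has_derivative\<close> applies, so
  the choice solves a linear total differential equation and \<open>smooth_on_bootstrap\<close>
  makes it smooth.\<close>

lemma rot_axis_local_section: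
  assumes c: "c \<in> A" "p \<in> cdom c"
  shows "\<exists>W X. open W \<and> p \<in> W \<and> smooth_vf_on A W X \<and> (\<forall>q\<in>W. rot_axis q = span {X q})"
proof -
  let ?x = "cmap c p"
  obtain b where b: "b \<noteq> 0" "rot_axis p = span {b}" using rot_axis_line by blast
  define r where "r = 1 / sqrt (avg p b b)"
  have r: "r > 0" "r * r * avg p b b = 1"
    using avg_pos[OF b(1), of p] by (simp_all add: r_def)
  define a where "a = tcoord A c p (r *\<^sub>R b)"
  have ta: "tvec A c p a = r *\<^sub>R b" by (simp add: a_def tvec_tcoord[OF c])
  have a: "tvec A c p a \<in> rot_axis p" "avg p (tvec A c p a) (tvec A c p a) = 1"
    using r b(2) by (simp_all add: ta span_base span_scale bilinear_lmul[OF bilinear_avg] bilinear_rmul[OF bilinear_avg])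
  have anz: "a \<bullet> a > 0"
  proof -
    have "a \<noteq> 0" using ta r(1) b(1) linear_0[OF linear_tvec[OF c]] by auto
    then show ?thesis by simp
  qed
  define U where "U x w \<longleftrightarrow> tvec A c (cinv c x) w \<in> rot_axis (cinv c x) \<and>
      avg (cinv c x) (tvec A c (cinv c x) w) (tvec A c (cinv c x) w) = 1 \<and> w \<bullet> a > 0" for x w
  obtain d Q P where tf: "transport_family c p d Q P"
    using transport_family_exists[OF c] by blast
  note Q = transport_familyD[OF tf]
  have "isCont (\<lambda>u. P u a \<bullet> a) 0"
    by (intro continuous_intros has_derivative_continuous[OF Q(6)])
  then have "eventually (\<lambda>u. P u a \<bullet> a > 0) (nhds 0)"
    by (rule isCont_eventually_pos) (use anz in \<open>simp only: Q(8)\<close>)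
  then obtain d' where d': "d' > 0" "\<And>u. norm u < d' \<Longrightarrow> P u a \<bullet> a > 0"
    by (auto simp: eventually_nhds_metric)
  \<comment> \<open>Within \<open>d\<close> transport provides a unit axis vector, and within
    \<open>d'\<close> this vector has the prescribed sign; both are needed for existence at every
    point of the ball.\<close>
  define R where "R = min d d'"
  have R: "R > 0" using Q d' by (simp add: R_def)
  let ?B = "ball ?x R"
  have B: "?B \<subseteq> cmap c ` cdom c"
  proof
    fix x assume "x \<in> ?B"
    then show "x \<in> cmap c ` cdom c"
      using Q(2)[of "x - ?x"] by (simp add: R_def dist_norm norm_minus_commute)
  qed
  have ex: "\<exists>w. U x w" if "x \<in> ?B" for x
  proof -
    let ?u = "x - ?x"
    have u: "norm ?u < d" "norm ?u < d'" using that by (auto simp: R_def dist_norm norm_minus_commute)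
    note iso = Q(3)[OF u(1), simplified]
    have "U x (P ?u a)"
      using isometry_axis_space[OF iso minkowski_F minkowski_F, of "tvec A c p a"]
        isometry_avg_form[OF iso minkowski_F minkowski_F, of "tvec A c p a" "tvec A c p a"] a d'(2)[OF u(2)]
      by (simp add: U_def rot_axis_def avg_def tcoord_tvec_self[OF c])
    then show ?thesis by blast
  qed
  define X where "X x = (SOME w. U x w)" for x
  have X: "U x (X x)" if "x \<in> ?B" for x unfolding X_def by (rule someI_ex[OF ex[OF that]])
  have dX: "(X has_derivative (\<lambda>u. \<Sum>j\<in>UNIV. (X x $ j) *\<^sub>R Gam c (cinv c x) (- u) (axis j 1))) (at x)"
    if x: "x \<in> ?B" for x
  proof -
    let ?q = "cinv c x"
    have xi: "x \<in> cmap c ` cdom c" using B x by blast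
    have q: "?q \<in> cdom c" "cmap c ?q = x" using cinv_in[OF xi] cmap_cinv[OF xi] by auto
    have "eventually (\<lambda>u. x + u \<in> ?B) (nhds 0)"
    proof -
      have "((\<lambda>u. x + u) \<longlongrightarrow> x + 0) (nhds 0)" by (intro tendsto_intros filterlim_ident)
      then show ?thesis using topological_tendstoD[OF _ open_ball, of "\<lambda>u. x + u" x "nhds 0" ?x R] x by simp
    qed
    then have ev: "eventually (\<lambda>u. tvec A c (cinv c (cmap c ?q + u)) (X (x + u)) \<in> rot_axis (cinv c (cmap c ?q + u)) \<and>
      avg (cinv c (cmap c ?q + u)) (tvec A c (cinv c (cmap c ?q + u)) (X (x + u))) (tvec A c (cinv c (cmap c ?q + u)) (X (x + u)))
        = avg ?q (tvec A c ?q (X x)) (tvec A c ?q (X x)) \<and> X (x + u) \<bullet> a > 0) (nhds 0)"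
      by eventually_elim (use X[OF x] X in \<open>simp add: U_def q(2)\<close>)
    have "((\<lambda>u. X (x + u)) has_derivative (\<lambda>u. - Gam c ?q u (X x))) (at 0)"
      by (rule section_has_derivative[OF c(1) q(1) _ _ ev]) (use X[OF x] in \<open>auto simp: U_def\<close>)
    then have "(X has_derivative (\<lambda>u. - Gam c ?q u (X x))) (at x)" by (rule has_derivative_shift)
    \<comment> \<open>The sign is moved into the direction so that the coefficients have the shape
      demanded by \<open>smooth_on_bootstrap\<close> and are smooth by
      \<open>smooth_Gam\<close>.\<close>
    moreover have "- Gam c ?q u (X x) = (\<Sum>j\<in>UNIV. (X x $ j) *\<^sub>R Gam c ?q (- u) (axis j 1))" for u
    proof -
      have "linear (Gam c ?q (- u))" using bilinear_Gam by (simp add: bilinear_def)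
      from linear_axis_sum[OF this, of "X x"] show ?thesis by (simp add: bilinear_lneg[OF bilinear_Gam])
    qed
    ultimately show ?thesis by simp
  qed
  have sX: "smooth_on ?B X"
    by (rule smooth_on_bootstrap[OF open_ball dX]) (auto intro: smooth_on_subset[OF smooth_Gam[OF c(1)] B])
  let ?W = "cinv c ` ?B"
  have W: "open ?W" by (rule open_cinv_image[OF c(1) open_ball B])
  have Wc: "?W \<subseteq> cdom c" using subsetD[OF B] by (auto intro: cinv_in)
  have ci: "cmap c (cinv c x) = x" if "x \<in> ?B" for x by (rule cmap_cinv[OF subsetD[OF B that]])
  then have Wi: "cmap c ` ?W = ?B" by (simp add: image_image cong: image_cong_simp)
  have "smooth_vf_on A ?W (\<lambda>q. tvec A c q (X (cmap c q)))"
    by (rule smooth_vf_onI_coord[OF c(1) W Wc]) (simp only: Wi sX)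
  moreover have "p \<in> ?W" using R cinv_cmap[OF c] by (metis centre_in_ball imageI)
  moreover have "rot_axis q = span {tvec A c q (X (cmap c q))}" if "q \<in> ?W" for q
  proof -
    let ?v = "tvec A c q (X (cmap c q))"
    obtain x where x: "x \<in> ?B" "q = cinv c x" using \<open>q \<in> ?W\<close> by blast
    then have cx: "cmap c q = x" by (simp add: ci)
    have v: "?v \<in> rot_axis q" "avg q ?v ?v = 1" using X[OF x(1)] x cx by (auto simp: U_def)
    have "?v \<noteq> 0" using v(2) bilinear_lzero[OF bilinear_avg] by (metis zero_neq_one)
    moreover obtain b where b: "rot_axis q = span {b}" using rot_axis_line by blast
    moreover obtain s where s: "?v = s *\<^sub>R b" using v(1) b by (auto simp: span_singleton)
    ultimately have "b = (1 / s) *\<^sub>R ?v" by auto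
    then have "b \<in> span {?v}" by (metis insertI1 span_base span_mul)
    then show ?thesis using v(1) unfolding b by (auto simp: span_eq)
  qed
  ultimately show ?thesis using W by blast
qed

lemma line_distribution_rot_axis: "line_distribution A rot_axis"
  unfolding line_distribution_def
proof (intro conjI allI)
  fix p
  obtain b where b: "b \<noteq> 0" "rot_axis p = span {b}" using rot_axis_line by blast
  show "subspace (rot_axis p)" using b by simp
  show "dim (rot_axis p) = 1"
    unfolding b(2) dim_span using dim_eq_card_independent[of "{b}"] b(1) by simp
  show "\<exists>U X. open U \<and> p \<in> U \<and> smooth_vf_on A U X \<and> (\<forall>q\<in>U. rot_axis q = span {X q})"
    by (rule rot_axis_local_section[OF chart_at])
qed

text \<open>In chart components, \<open>section_has_derivative\<close> says that the derivative of
  the section is \<open>- Gam\<close>, which is exactly the vanishing of its covariant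
  derivative.\<close>

lemma section_covariant_constant:
  assumes sec: "local_section A rot_axis U \<beta>" and len: "constant_length (avg_metric F) U \<beta>"
  shows "covariant_constant_on nabla U \<beta>"
  unfolding covariant_constant_on_def
proof (intro ballI allI)
  fix p v assume p: "p \<in> U"
  let ?c = "chart_at A p"
  let ?x = "cmap ?c p" and ?b = "vf_coord A ?c \<beta>"
  let ?T = "cmap ?c ` (U \<inter> cdom ?c)"
  have c: "?c \<in> A" "p \<in> cdom ?c" by (rule chart_at)+
  have U: "open U" "smooth_vf_on A U \<beta>" "\<And>q. q \<in> U \<Longrightarrow> \<beta> q \<in> rot_axis q" using sec by (auto simp: local_section_def)
  obtain l where l: "\<And>q. q \<in> U \<Longrightarrow> sqrt (avg q (\<beta> q) (\<beta> q)) = l"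
    using len by (auto simp: constant_length_def avg_metric_eq)
  have gl: "avg q (\<beta> q) (\<beta> q) = avg p (\<beta> p) (\<beta> p)" if "q \<in> U" for q
    using l[OF that] l[OF p] by (metis real_sqrt_eq_iff)
  have T: "open ?T" "?x \<in> ?T" using open_chart_image[OF c(1) U(1)] p c by auto
  have bx: "?b ?x = \<beta> p" by (simp add: vf_coord_cmap[OF c] tcoord_chart_at(1)[OF atlas])
  have tv: "tvec A ?c p y = y" for y by (rule tcoord_chart_at(2)[OF atlas])
  have bd: "?b differentiable (at ?x)" by (rule vf_coord_differentiable[OF U(2) c(1) p c(2)])
  have "frechet_derivative ?b (at ?x) v = - Gam ?c p v (\<beta> p)"
  \<comment> \<open>A zero value leaves no direction to fix the sign with. In that case constancy of
    the length makes the section vanish identically, since \<gamma> is definite.\<close>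
  proof (cases "\<beta> p = 0")
    case True
    have "\<beta> q = 0" if "q \<in> U" for q
      using gl[OF that] avg_pos[of "\<beta> q" q] by (auto simp: True bilinear_lzero[OF bilinear_avg])
    then have "?b y = 0" if "y \<in> ?T" for y
      using that linear_0[OF linear_tcoord[OF c(1)]] by (auto simp: vf_coord_cmap[OF c(1)])
    then have "frechet_derivative ?b (at ?x) = frechet_derivative (\<lambda>_. 0) (at ?x)"
      by (intro frechet_cong_open[OF T]) auto
    then show ?thesis by (simp add: True frechet_derivative_const bilinear_rzero[OF bilinear_Gam])
  next
    case False
    have ib: "isCont ?b ?x" using bd differentiable_imp_continuous_within by blast
    have "eventually (\<lambda>y. ?b y \<bullet> \<beta> p > 0) (nhds ?x)"
      by (rule isCont_eventually_pos) (use False in \<open>auto simp: bx intro!: continuous_intros ib\<close>)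
    moreover have "eventually (\<lambda>y. y \<in> ?T) (nhds ?x)" by (rule eventually_nhds_in_open[OF T])
    ultimately have "eventually (\<lambda>y. ?b y \<bullet> \<beta> p > 0 \<and> y \<in> ?T) (nhds ?x)" by (rule eventually_conj)
    moreover have "((\<lambda>u. ?x + u) \<longlongrightarrow> ?x + 0) (nhds 0)" by (intro tendsto_intros filterlim_ident)
    ultimately have "eventually (\<lambda>u. ?b (?x + u) \<bullet> \<beta> p > 0 \<and> ?x + u \<in> ?T) (nhds 0)"
      using eventually_compose_filterlim by fastforce
    then have ev: "eventually (\<lambda>u. tvec A ?c (cinv ?c (?x + u)) (?b (?x + u)) \<in> rot_axis (cinv ?c (?x + u)) \<and>
      avg (cinv ?c (?x + u)) (tvec A ?c (cinv ?c (?x + u)) (?b (?x + u))) (tvec A ?c (cinv ?c (?x + u)) (?b (?x + u)))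
        = avg p (tvec A ?c p (\<beta> p)) (tvec A ?c p (\<beta> p)) \<and> ?b (?x + u) \<bullet> \<beta> p > 0) (nhds 0)"
    proof eventually_elim
      case (elim u)
      then obtain q where q: "q \<in> U" "q \<in> cdom ?c" "?x + u = cmap ?c q" by blast
      then have "cinv ?c (?x + u) = q" by (simp add: cinv_cmap[OF c(1)])
      moreover have "tvec A ?c q (?b (cmap ?c q)) = \<beta> q" by (rule tvec_vf_coord[OF c(1) q(2)])
      ultimately show ?case using elim U(3)[OF q(1)] gl[OF q(1)] q(3) by (simp add: tv)
    qed
    have "((\<lambda>u. ?b (?x + u)) has_derivative (\<lambda>u. - Gam ?c p u (\<beta> p))) (at 0)"
      by (rule section_has_derivative[OF c _ _ ev]) (use U(3)[OF p] False in \<open>auto simp: tv\<close>)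
    then have "(?b has_derivative (\<lambda>u. - Gam ?c p u (\<beta> p))) (at ?x)" by (rule has_derivative_shift)
    then show ?thesis by (simp add: frechet_eqI)
  qed
  then show "nabla p v \<beta> = 0"
    using nabla_chart[OF U(1,2) p c, of v] by (simp add: tcoord_chart_at(1)[OF atlas] bx)
qed

text \<open>The isometries \<open>Q u\<close> pull the scalar product at nearby points back to
  \<open>p\<close>, where it is a fixed bilinear form. The pulled back fields
  \<open>Q u (Y (x + u))\<close> have the covariant derivative of \<open>Y\<close> as their
  derivative at 0, and the product rule gives the formula.\<close>

lemma metric_compatible:
  assumes W: "open W" "p \<in> W" and Y: "smooth_vf_on A W Y" and Z: "smooth_vf_on A W Z"
  shows "dir_deriv A (\<lambda>q. avg q (Y q) (Z q)) p v = avg p (nabla p v Y) (Z p) + avg p (Y p) (nabla p v Z)"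
proof -
  let ?c = "chart_at A p"
  let ?x = "cmap ?c p"
  have c: "?c \<in> A" "p \<in> cdom ?c" by (rule chart_at)+
  have tc: "tcoord A ?c p y = y" "tvec A ?c p y = y" for y by (rule tcoord_chart_at[OF atlas])+
  obtain d Q P where tf: "transport_family ?c p d Q P"
    using transport_family_exists[OF c] by blast
  note Q = transport_familyD[OF tf]
  let ?Y = "vf_coord A ?c Y" and ?Z = "vf_coord A ?c Z"
  have at_x: "vf_coord A ?c V ?x = V p" for V by (simp add: vf_coord_cmap[OF c] tc)
  have QV: "((\<lambda>u. Q u (vf_coord A ?c V (?x + u))) has_derivative (\<lambda>u. nabla p u V)) (at 0)"
    if V: "smooth_vf_on A W V" for V
  proof -
    have "(vf_coord A ?c V has_derivative frechet_derivative (vf_coord A ?c V) (at ?x)) (at ?x)"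
      by (rule has_derivative_frechet[OF vf_coord_differentiable[OF V c(1) W(2) c(2)]])
    then have "((\<lambda>u. vf_coord A ?c V (?x + u)) has_derivative frechet_derivative (vf_coord A ?c V) (at ?x)) (at 0)"
      by (simp only: has_derivative_shift_iff)
    from near_identity_apply[OF bilinear_Gam Q(1,4,5,7) this]
    show ?thesis using nabla_chart[OF W(1) V W(2) c] by (simp add: tc)
  qed
  have "bounded_bilinear (avg p)" using bilinear_avg bilinear_conv_bounded_bilinear by blast
  from bounded_bilinear.FDERIV[OF this QV[OF Y] QV[OF Z]]
  have D: "((\<lambda>u. avg p (Q u (?Y (?x + u))) (Q u (?Z (?x + u)))) has_derivative
      (\<lambda>u. avg p (Y p) (nabla p u Z) + avg p (nabla p u Y) (Z p))) (at 0)"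
    by (simp add: Q(7) at_x)
  have "((\<lambda>u. ((\<lambda>q. avg q (Y q) (Z q)) \<circ> cinv ?c) (?x + u)) has_derivative
      (\<lambda>u. avg p (Y p) (nabla p u Z) + avg p (nabla p u Y) (Z p))) (at 0)"
  proof (rule has_derivative_transform_within_open[OF D, of "ball 0 d"])
    fix u :: "real^3" assume "u \<in> ball 0 d"
    then have u: "norm u < d" by simp
    let ?q = "cinv ?c (?x + u)"
    have "vf_coord A ?c V (?x + u) = tcoord A ?c ?q (V ?q)" for V by (simp add: vf_coord_def)
    then show "avg p (Q u (?Y (?x + u))) (Q u (?Z (?x + u))) = ((\<lambda>q. avg q (Y q) (Z q)) \<circ> cinv ?c) (?x + u)"
      using isometry_avg_form[OF isometry_sym[OF Q(3)[OF u]] minkowski_F minkowski_F, of "Y ?q" "Z ?q"]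
      by (simp add: avg_def tc)
  qed (use Q(1) in auto)
  then have "(((\<lambda>q. avg q (Y q) (Z q)) \<circ> cinv ?c) has_derivative
      (\<lambda>u. avg p (Y p) (nabla p u Z) + avg p (nabla p u Y) (Z p))) (at ?x)" by (rule has_derivative_shift)
  from frechet_eqI[OF this] show ?thesis by (simp add: dir_deriv_def)
qed

text \<open>Since \<beta> is parallel, its torsion satisfies
  \<open>T(\<beta>, V) = nabla_\<beta> V - [\<beta>, V]\<close>. By metric compatibility the Lie
  derivative of \<gamma> on \<open>Y\<close>, \<open>Z\<close> becomes
  \<open>\<gamma>(T(\<beta>, Y), Z) + \<gamma>(Y, T(\<beta>, Z))\<close>, which vanishes because the
  torsion is antisymmetric in its last two slots.\<close>

lemma section_killing:
  assumes sec: "local_section A rot_axis U \<beta>" and len: "constant_length (avg_metric F) U \<beta>"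
  shows "killing_on A (avg_metric F) U \<beta>"
  unfolding killing_on_def avg_metric_eq
proof (intro allI impI ballI)
  fix W Y Z p
  assume W: "open W" "W \<subseteq> U" and Y: "smooth_vf_on A W Y" and Z: "smooth_vf_on A W Z" and p: "p \<in> W"
  have cc: "nabla p v \<beta> = 0" for v
    using section_covariant_constant[OF sec len] W(2) p by (auto simp: covariant_constant_on_def)
  have b: "smooth_vf_on A W \<beta>"
    using sec W(2) smooth_vf_on_subset by (auto simp: local_section_def)
  let ?T = "torsion A nabla \<beta>"
  have T: "?T V p = nabla p (\<beta> p) V - lie_bracket A \<beta> V p" for V
    by (simp add: torsion_def cc)
  have "avg p (?T Z p) (Y p) = - avg p (?T Y p) (Z p)"
    using antisym W(1) b Y Z p unfolding antisymmetric_torsion_def avg_metric_eq by blast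
  then have "avg p (nabla p (\<beta> p) Y) (Z p) - avg p (lie_bracket A \<beta> Y p) (Z p)
      + (avg p (Y p) (nabla p (\<beta> p) Z) - avg p (Y p) (lie_bracket A \<beta> Z p)) = 0"
    by (simp add: T bilinear_lsub[OF bilinear_avg] avg_sym[of p "Y p"])
  then show "dir_deriv A (\<lambda>q. avg q (Y q) (Z q)) p (\<beta> p)
      - avg p (lie_bracket A \<beta> Y p) (Z p) - avg p (Y p) (lie_bracket A \<beta> Z p) = 0"
    unfolding metric_compatible[OF W(1) p Y Z] by simp
qed

end

theorem theorem4:
  fixes A :: "'m::{t2_space, second_countable_topology} chart set"
    and F :: "'m \<Rightarrow> real^3 \<Rightarrow> real"
    and nabla :: "'m connection"
  assumes "smooth_atlas A"
    and "connected (UNIV :: 'm set)"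
    and "finsler_metric A F"
    and "\<not> riemannian F"
    and "linear_connection A nabla"
    and "compatible A F nabla"
    and "\<not> flat A nabla"
    and "antisymmetric_torsion A (avg_metric F) nabla"
  shows "\<exists>D. line_distribution A D \<and>
    (\<forall>U \<beta>. local_section A D U \<beta> \<longrightarrow> constant_length (avg_metric F) U \<beta> \<longrightarrow>
       covariant_constant_on nabla U \<beta>) \<and>
    (\<forall>U \<beta>. local_section A D U \<beta> \<longrightarrow> constant_length (avg_metric F) U \<beta> \<longrightarrow>
       killing_on A (avg_metric F) U \<beta> \<and> constant_length (avg_metric F) U \<beta>)"
proof -
  interpret nonflat_finsler_connection A nabla F
    using assms by unfold_locales
  show ?thesis
    using line_distribution_rot_axis section_covariant_constant section_killing by blast
qed

end
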